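(* Let $d\in\mathfrak{D}$, $t,m>0$ and $V_1,V_2>0$. Then $\left(V_1^{1/d}L_d,\,V_2^{1/d}L_d\right)$ is the unique maximizer (uniqueness being understood up to linear isometries of $\mathbb{R}^d$ applied to each of the two lattices separately) of the map $$(L,\Lambda)\mapsto E_{L,\Lambda}^{(m)}(it)$$ on $\mathcal{L}_d^\circ(V_1)\times\mathcal{L}_d^\circ(V_2)$.
   Context: For $d\ge 1$, $\mathcal{L}_d$ is the set of lattices $L=\bigoplus_{i=1}^d\mathbb{Z}v_i$ with $(v_1,\dots,v_d)$ a basis of $\mathbb{R}^d$. For $V>0$, $\mathcal{L}_d^\circ(V)$ is the subset of lattices with covolume $|\det(v_1,\dots,v_d)|=V$. The Euclidean norm is denoted by $|\cdot|$ on vectors, and $|L|$ denotes the covolume of a lattice $L$. The dual lattice is $L^*=\{y\in\mathbb{R}^d:\ y\cdot p\in\mathbb{Z}\text{ for all }p\in L\}$. The lattice theta function is $\theta_L(\alpha)=\sum_{p\in L}e^{-\pi\alpha|p|^2}$ for $\alpha>0$. $\mathfrak{D}$ is the set of dimensions $d\geq 1$ for which there is a lattice $L_d\in\mathcal{L}_d^\circ(1)$ such that, for all $V>0$ and all $\alpha>0$, $V^{1/d}L_d$ is the unique minimizer (up to linear isometries of $\mathbb{R}^d$) of $L\mapsto\theta_L(\alpha)$ in $\mathcal{L}_d^\circ(V)$. For $d\in\mathfrak{D}$, $L_d$ denotes this lattice. For $\Lambda\in\mathcal{L}_d$, $\mathcal{P}_\Lambda$ is the set of nonzero vectors $v\in\Lambda$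 such that the only scalar multiples $\lambda v$ ($\lambda\in\mathbb{R}$) belonging to $\Lambda$ are the integer multiples of $v$. $\mathcal{P}_\Lambda/\pm$ is a subset of $\mathcal{P}_\Lambda$ containing exactly one representative of each pair $\pm v$. For $m,t>0$ and $L,\Lambda\in\mathcal{L}_d$, set $q=e^{-\pi t}$ and $$E_{L,\Lambda}^{(m)}(it):=q^{-t^{\frac{d-1}{2}}\Delta_m(L)}\prod_{w\in\mathcal{P}_\Lambda/\pm}\ \prod_{v\in L}\left(1-q^{|w|(m^2+|v|^2)}\right)^{\frac{t^{\frac{d-1}{2}}}{2|w|}},$$ where $$\Delta_m(L):=-\frac{1}{8\pi|L|^{1/2}}\int_0^\infty s^{\frac{d-1}{2}}e^{-\pi\frac{m^2}{s}}\left(\theta_{L^*}(s)-1\right)ds.$$ *)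

theory Defs
  imports "HOL-Analysis.Analysis"
begin

text \<open>
  The dimension \<open>d\<close> is \<open>CARD('n)\<close>; since types are non-empty, \<open>d \<ge> 1\<close> is automatic.
\<close>

definition basis_family :: "('n::finite \<Rightarrow> real^'n) \<Rightarrow> bool" where
  "basis_family v \<longleftrightarrow> inj v \<and> independent (range v) \<and> span (range v) = UNIV"

definition int_span :: "('n::finite \<Rightarrow> real^'n) \<Rightarrow> (real^'n) set" where
  "int_span v = range (\<lambda>k :: 'n \<Rightarrow> int. \<Sum>i\<in>UNIV. of_int (k i) *\<^sub>R v i)"

definition lattices :: "(real^'n::finite) set set" where
  "lattices = {int_span v | v. basis_family v}"

definition covolume :: "(real^'n::finite) set \<Rightarrow> real" where
  "covolume L = (THE c. \<exists>v. basis_family v \<and> L = int_span v \<and> c = \<bar>det (\<chi> i. v i)\<bar>)"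

definition lattices_of_covolume :: "real \<Rightarrow> (real^'n::finite) set set" where
  "lattices_of_covolume V = {L \<in> lattices. covolume L = V}"

definition dual_lattice :: "(real^'n::finite) set \<Rightarrow> (real^'n) set" where
  "dual_lattice L = {y. \<forall>p\<in>L. y \<bullet> p \<in> \<int>}"

definition dilate :: "real \<Rightarrow> (real^'n::finite) set \<Rightarrow> (real^'n) set" where
  "dilate c L = (\<lambda>x. c *\<^sub>R x) ` L"

definition isometric :: "(real^'n::finite) set \<Rightarrow> (real^'n) set \<Rightarrow> bool" where
  "isometric L L' \<longleftrightarrow> (\<exists>f. orthogonal_transformation f \<and> L' = f ` L)"

definition lattice_theta :: "(real^'n::finite) set \<Rightarrow> real \<Rightarrow> real" where
  "lattice_theta L \<alpha> = (\<Sum>\<^sub>\<infinity>p\<in>L. exp (- pi * \<alpha> * (norm p)\<^sup>2))"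

text \<open>Optimizers on \<open>S\<close> that are unique up to the relation \<open>R\<close>.\<close>

definition unique_minimizer_upto ::
    "('a \<Rightarrow> 'a \<Rightarrow> bool) \<Rightarrow> ('a \<Rightarrow> real) \<Rightarrow> 'a set \<Rightarrow> 'a \<Rightarrow> bool" where
  "unique_minimizer_upto R f S x \<longleftrightarrow>
     is_arg_min f (\<lambda>y. y \<in> S) x \<and> (\<forall>y. is_arg_min f (\<lambda>y. y \<in> S) y \<longrightarrow> R x y)"

definition unique_maximizer_upto ::
    "('a \<Rightarrow> 'a \<Rightarrow> bool) \<Rightarrow> ('a \<Rightarrow> real) \<Rightarrow> 'a set \<Rightarrow> 'a \<Rightarrow> bool" where
  "unique_maximizer_upto R f S x \<longleftrightarrow>
     is_arg_max f (\<lambda>y. y \<in> S) x \<and> (\<forall>y. is_arg_max f (\<lambda>y. y \<in> S) y \<longrightarrow> R x y)"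

text \<open>
  The dimension \<open>d = CARD('n)\<close> belongs to \<open>\<DD>\<close> iff some \<open>Ld :: (real^'n) set\<close> satisfies the
  following predicate; any such \<open>Ld\<close> is (up to isometry) the lattice denoted \<open>L\<^sub>d\<close>.
\<close>

definition theta_optimal :: "(real^'n::finite) set \<Rightarrow> bool" where
  "theta_optimal Ld \<longleftrightarrow>
     Ld \<in> lattices_of_covolume 1 \<and>
     (\<forall>V>0. \<forall>\<alpha>>0.
        unique_minimizer_upto isometric (\<lambda>L. lattice_theta L \<alpha>) (lattices_of_covolume V)
          (dilate (V powr (1 / CARD('n))) Ld))"

definition primitive_vectors :: "(real^'n::finite) set \<Rightarrow> (real^'n) set" where
  "primitive_vectors \<Lambda> = {v \<in> \<Lambda>. v \<noteq> 0 \<and> (\<forall>c::real. c *\<^sub>R v \<in> \<Lambda> \<longrightarrow> c \<in> \<int>)}"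

text \<open>\<open>R\<close> contains exactly one representative of each pair \<open>\<plusminus>v\<close> of elements of \<open>P\<close>.\<close>

definition sign_representatives :: "(real^'n::finite) set \<Rightarrow> (real^'n) set \<Rightarrow> bool" where
  "sign_representatives P R \<longleftrightarrow> R \<subseteq> P \<and> (\<forall>v\<in>P. \<exists>!u. u \<in> R \<and> u \<in> {v, - v})"

text \<open>
  Unordered infinite product: the limit of the finite subproducts along the finite subsets
  of \<open>A\<close> ordered by inclusion, in analogy with \<^const>\<open>infsum\<close>.  The products over lattices
  below converge absolutely, so the (unspecified) value in the divergent case plays no role.
\<close>

definition infprod :: "('a \<Rightarrow> real) \<Rightarrow> 'a set \<Rightarrow> real" where
  "infprod f A = Lim (finite_subsets_at_top A) (\<lambda>F. \<Prod>x\<in>F. f x)"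

definition Delta_m :: "real \<Rightarrow> (real^'n::finite) set \<Rightarrow> real" where
  "Delta_m m L =
     - (1 / (8 * pi * covolume L powr (1 / 2))) *
     (LINT s:{0<..}|lborel.
        s powr ((real CARD('n) - 1) / 2) * exp (- pi * m\<^sup>2 / s) *
        (lattice_theta (dual_lattice L) s - 1))"

text \<open>
  \<open>E_fun rep m L \<Lambda> t\<close> is the value at \<open>\<i>t\<close> of the function \<open>E\<close> with parameters \<open>m\<close>, \<open>L\<close>, \<open>\<Lambda>\<close>.
  The argument \<open>rep\<close> supplies the chosen set \<open>rep \<Lambda>\<close> of representatives of the primitive
  vectors of \<open>\<Lambda>\<close> modulo sign.
\<close>

definition E_fun ::
    "((real^'n::finite) set \<Rightarrow> (real^'n) set) \<Rightarrow> real \<Rightarrow> (real^'n) set \<Rightarrow> (real^'n) set \<Rightarrow>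
     real \<Rightarrow> real" where
  "E_fun rep m L \<Lambda> t =
     (let q = exp (- pi * t);
          T = t powr ((real CARD('n) - 1) / 2)
      in q powr (- T * Delta_m m L) *
         infprod (\<lambda>w. infprod (\<lambda>v.
             (1 - q powr (norm w * (m\<^sup>2 + (norm v)\<^sup>2))) powr (T / (2 * norm w))) L)
           (rep \<Lambda>))"

text \<open>Well-definedness of the covolume, and existence of representatives modulo sign.\<close>

lemma int_span_det_dvd:
  fixes v w :: "'n::finite \<Rightarrow> real^'n"
  assumes "int_span v \<subseteq> int_span w"
  shows "\<exists>z::int. det (\<chi> i. v i) = of_int z * det (\<chi> i. w i)"
proof -
  have "v i \<in> int_span w" for i
  proof -
    have "v i = (\<Sum>j\<in>UNIV. of_int (if j = i then 1 else 0) *\<^sub>R v j)"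
      by (simp add: if_distrib[of "\<lambda>c. c *\<^sub>R _"] if_distrib[of real_of_int] cong: if_cong)
    then have "v i \<in> int_span v"
      unfolding int_span_def by (rule range_eqI[where x = "\<lambda>j. if j = i then 1 else 0"])
    with assms show ?thesis by blast
  qed
  then have "\<forall>i. \<exists>k :: 'n \<Rightarrow> int. v i = (\<Sum>j\<in>UNIV. of_int (k j) *\<^sub>R w j)"
    unfolding int_span_def by blast
  then obtain A :: "'n \<Rightarrow> 'n \<Rightarrow> int"
    where A: "\<And>i. v i = (\<Sum>j\<in>UNIV. of_int (A i j) *\<^sub>R w j)"
    by metis
  have "(\<chi> i. v i) = (\<chi> i j. real_of_int (A i j)) ** (\<chi> i. w i)"
    by (simp add: vec_eq_iff matrix_matrix_mult_def A)
  moreover have "det (\<chi> i j. real_of_int (A i j)) = of_int (det (\<chi> i j. A i j))"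
    by (simp add: det_def)
  ultimately show ?thesis
    by (auto simp: det_mul)
qed

lemma covolume_int_span:
  fixes v :: "'n::finite \<Rightarrow> real^'n"
  assumes "basis_family v"
  shows "covolume (int_span v) = \<bar>det (\<chi> i. v i)\<bar>"
proof -
  have le: "\<bar>det (\<chi> i. b i)\<bar> \<le> \<bar>det (\<chi> i. a i)\<bar>"
    if a: "basis_family a" and eq: "int_span a = int_span b" for a b :: "'n \<Rightarrow> real^'n"
  proof -
    obtain z :: int where z: "det (\<chi> i. a i) = of_int z * det (\<chi> i. b i)"
      using int_span_det_dvd[of a b] eq by blast
    have "det (\<chi> i. a i) \<noteq> 0"
    proof -
      have "rows (\<chi> i. a i) = range a"
        by (auto simp: rows_def row_def vec_lambda_eta)
      then have "span (rows (\<chi> i. a i)) = UNIV"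
        using a by (simp add: basis_family_def)
      then show ?thesis
        by (metis invertible_det_nz invertible_left_inverse matrix_left_invertible_span_rows)
    qed
    with z have "\<bar>of_int z :: real\<bar> \<ge> 1"
      by (cases "z = 0") auto
    then show ?thesis
      unfolding z abs_mult by (simp add: mult_le_cancel_right1)
  qed
  show ?thesis
    unfolding covolume_def using assms by (intro the_equality) (auto intro: antisym le)
qed

lemma sign_representatives_exist: "\<exists>R. sign_representatives (primitive_vectors \<Lambda>) R"
proof
  let ?P = "primitive_vectors \<Lambda>"
  let ?s = "\<lambda>v. SOME u. u \<in> ?P \<and> u \<in> {v, - v}"
  have s: "?s v \<in> ?P \<and> ?s v \<in> {v, - v}" if "v \<in> ?P" for v
    by (rule someI[of _ v]) (use that in auto)
  have neg: "?s (- v) = ?s v" for v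
    by (rule arg_cong[of _ _ Eps]) auto
  have "\<exists>!u. u \<in> ?s ` ?P \<and> u \<in> {v, - v}" if v: "v \<in> ?P" for v
  proof (rule ex1I[of _ "?s v"])
    show "?s v \<in> ?s ` ?P \<and> ?s v \<in> {v, - v}" using s[OF v] v by blast
    fix u assume u: "u \<in> ?s ` ?P \<and> u \<in> {v, - v}"
    then obtain x where x: "x \<in> ?P" "u = ?s x" by blast
    then have "u = x \<or> u = - x" using s[of x] by blast
    with u have "x = v \<or> x = - v" by auto
    then show "u = ?s v" using x neg[of v] by auto
  qed
  then show "sign_representatives ?P (?s ` ?P)"
    unfolding sign_representatives_def using s by blast
qed

end

theory Submission
  imports Defs "HOL-Probability.Characteristic_Functions" "HOL-Real_Asymp.Real_Asymp"
begin

text \<open>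
  Put \<open>T = t powr ((d - 1) / 2)\<close>. The theorem rests on the formula
  \<open>E = exp (T * (pi * t * \<Delta>\<^sub>m(L) - S(L,\<Lambda>) / 4))\<close>, in which
  \<open>S(L,\<Lambda>) = \<Sum>p\<in>\<Lambda>-{0}. \<Sum>v\<in>L. exp (-pi t |p| (m\<^sup>2 + |v|\<^sup>2)) / |p|\<close>
  is called the interaction of the two lattices (\<open>E_fun_eq\<close>). To obtain it, expand
  each logarithm of the product as \<open>-ln (1 - x) = \<Sum>k. x^(k+1) / (k+1)\<close>. The exponent
  \<open>k+1\<close> and the primitive vector \<open>w\<close> only enter through \<open>p = (k+1) w\<close>, and every nonzero
  vector of \<open>\<Lambda>\<close> is, up to sign, such a multiple in exactly one way
  (\<open>primitive_multiples_bij\<close>).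

  So \<open>\<Delta>\<^sub>m(L)\<close> should be large and \<open>S(L,\<Lambda>)\<close> small, and both are governed by theta functions.

  \<^item> For fixed \<open>\<Lambda>\<close>, the interaction is a sum of the values \<open>\<theta>\<^sub>L(t |p|)\<close> with positive weights.

  \<^item> The function \<open>exp (-c r) / r\<close> is a mixture of the Gaussians \<open>exp (-pi s r\<^sup>2)\<close>, \<open>s > 0\<close>,
    with a positive density (\<open>gaussian_mixture\<close>). Hence for fixed \<open>L\<close> the interaction is an
    integral of \<open>\<theta>\<^sub>\<Lambda>(s) - 1\<close> against a positive weight.

  \<^item> \<open>\<Delta>\<^sub>m(L)\<close> is an integral of \<open>1 - \<theta>\<^sub>L\<^sub>*(s)\<close>, and Poisson summation gives
    \<open>\<theta>\<^sub>L\<^sub>*(s) = |L| s powr (-d/2) \<theta>\<^sub>L(1/s)\<close> (\<open>lattice_theta_dual\<close>). Within a fixed covolume,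
    \<open>\<Delta>\<^sub>m\<close> is therefore monotonically decreasing in the theta function of \<open>L\<close> itself.

  A theta-optimal lattice minimizes all values of theta simultaneously, and a lattice that
  reaches the minimum for a single parameter is already isometric to it. Thus replacing first
  \<open>L\<close> and then \<open>\<Lambda>\<close> by the optimal lattice does not decrease \<open>E\<close>. The interaction is finite and
  drops strictly whenever the replaced lattice is not isometric to the optimal one, which
  yields uniqueness for both factors; from \<open>\<Delta>\<^sub>m\<close> only the weak inequality is used.

  Poisson summation for a Gaussian \<open>\<phi>\<close> on \<open>\<real>\<^sup>d\<close> is obtained by computing the integral of
  \<open>\<phi>\<close> times the product kernel \<open>\<Prod>i. c\<^sub>N cos (pi u\<^sub>i)^(2N)\<close> in two ways. As a trigonometric
  polynomial the kernel has the coefficients \<open>(2N choose N+j) / (2N choose N)\<close>, which lie in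
  \<open>[0,1]\<close> and tend to \<open>1\<close>; so the integral tends to the sum of the Fourier transform of \<open>\<phi>\<close>
  over all frequencies. On the other hand the kernel is periodic and concentrates at the
  integer points, so the integral tends to the sum of \<open>\<phi>\<close> over the integer points
  (\<open>poisson_gaussian\<close>).

  Sums and integrals of nonnegative functions are mostly taken in the extended nonnegative
  reals, where they can be interchanged freely.
\<close>

section \<open>Linear changes of variables\<close>

lemma Basis_vec_eq: "(Basis :: (real^'n::finite) set) = range (\<lambda>i. axis i 1)"
  by (auto simp: Basis_vec_def)

lemma nn_integral_lborel_Basis:
  assumes [measurable]: "f \<in> borel_measurable borel"
  shows "(\<integral>\<^sup>+x. f (x::real^'n::finite) \<partial>lborel)
    = (\<integral>\<^sup>+z. f (\<Sum>b\<in>Basis. z b *\<^sub>R b) \<partial>(\<Pi>\<^sub>M b\<in>Basis. lborel))"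
  by (subst lborel_eq) (simp add: nn_integral_distr)

lemma sum_Basis_nth: "(\<Sum>b\<in>(Basis::(real^'n::finite) set). z b *\<^sub>R b) $ i = z (axis i 1)"
proof -
  have "(\<Sum>b\<in>(Basis::(real^'n) set). z b *\<^sub>R b) = (\<Sum>j\<in>UNIV. z (axis j 1) *\<^sub>R axis j 1)"
    unfolding Basis_vec_eq by (subst sum.reindex) (auto simp: inj_on_def axis_eq_axis)
  then show ?thesis by (simp add: axis_def if_distrib[of "\<lambda>x. _ * x"] cong: if_cong)
qed

text \<open>
  The shear moves the coordinate \<open>m\<close> by an amount that depends on the other coordinates only.
  Integrating over the coordinate \<open>m\<close> first therefore reduces the claim to the translation
  invariance of Lebesgue measure on the line.
\<close>
lemma nn_integral_shear:
  fixes g :: "real^'n::finite \<Rightarrow> ennreal"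
  assumes "m \<noteq> n" and [measurable]: "g \<in> borel_measurable borel"
  shows "(\<integral>\<^sup>+x. g (\<chi> i. if i = m then x$m + x$n else x$i) \<partial>lborel) = (\<integral>\<^sup>+x. g x \<partial>lborel)"
proof -
  interpret product_sigma_finite "\<lambda>_::real^'n. lborel :: real measure" by standard
  let ?B = "Basis :: (real^'n) set"
  let ?e = "axis m 1 :: real^'n"
  let ?I = "?B - {?e}"
  let ?s = "\<lambda>x::real^'n. \<chi> i. if i = m then x$m + x$n else x$i"
  have ins: "insert ?e ?I = ?B" by auto
  have "linear ?s" by (rule linearI) (auto simp: vec_eq_iff algebra_simps)
  then have [measurable]: "?s \<in> borel_measurable borel"
    by (intro borel_measurable_continuous_onI linear_continuous_on) (simp add: linear_linear)
  let ?v = "\<lambda>z. \<Sum>b\<in>?B. z b *\<^sub>R b :: real^'n"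
  have eq: "?s (?v (z(?e := y))) = ?v (z(?e := y + z (axis n 1)))" for z y
    using assms(1) unfolding vec_eq_iff
    by (auto simp: sum_Basis_nth axis_eq_axis simp del: sum_component)
  have split: "(\<integral>\<^sup>+x. f x \<partial>lborel) = (\<integral>\<^sup>+z. (\<integral>\<^sup>+y. f (?v (z(?e := y))) \<partial>lborel) \<partial>(\<Pi>\<^sub>M b\<in>?I. lborel))"
    if [measurable]: "f \<in> borel_measurable borel" for f :: "real^'n \<Rightarrow> ennreal"
  proof -
    have "(\<integral>\<^sup>+x. f x \<partial>lborel) = (\<integral>\<^sup>+z. f (?v z) \<partial>(\<Pi>\<^sub>M b\<in>insert ?e ?I. lborel))"
      by (simp add: nn_integral_lborel_Basis insert_absorb ins)
    also have "\<dots> = (\<integral>\<^sup>+z. (\<integral>\<^sup>+y. f (?v (z(?e := y))) \<partial>lborel) \<partial>(\<Pi>\<^sub>M b\<in>?I. lborel))"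
      by (rule product_nn_integral_insert) (simp_all add: insert_absorb)
    finally show ?thesis .
  qed
  have "(\<integral>\<^sup>+x. g (?s x) \<partial>lborel)
      = (\<integral>\<^sup>+z. (\<integral>\<^sup>+y. g (?v (z(?e := y + z (axis n 1)))) \<partial>lborel) \<partial>(\<Pi>\<^sub>M b\<in>?I. lborel))"
    by (subst split) (simp_all add: eq)
  also have "\<dots> = (\<integral>\<^sup>+z. (\<integral>\<^sup>+y. g (?v (z(?e := y))) \<partial>lborel) \<partial>(\<Pi>\<^sub>M b\<in>?I. lborel))"
  proof (rule nn_integral_cong)
    fix z assume z: "z \<in> space (\<Pi>\<^sub>M b\<in>?I. lborel :: real measure)"
    have "(\<lambda>y. z(?e := y)) \<in> borel \<rightarrow>\<^sub>M (\<Pi>\<^sub>M b\<in>insert ?e ?I. lborel)"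
      using z by (intro measurable_fun_upd[where J="?I"]) auto
    then have upd: "(\<lambda>y. z(?e := y)) \<in> borel \<rightarrow>\<^sub>M (\<Pi>\<^sub>M b\<in>?B. lborel)" by (simp add: ins insert_absorb)
    have "?v \<in> (\<Pi>\<^sub>M b\<in>?B. lborel) \<rightarrow>\<^sub>M borel" by measurable
    from measurable_compose[OF measurable_compose[OF upd this] assms(2)]
    have [measurable]: "(\<lambda>y. g (?v (z(?e := y)))) \<in> borel_measurable borel" .
    show "(\<integral>\<^sup>+y. g (?v (z(?e := y + z (axis n 1)))) \<partial>lborel) = (\<integral>\<^sup>+y. g (?v (z(?e := y))) \<partial>lborel)"
      using nn_integral_real_affine[of "\<lambda>y. g (?v (z(?e := y)))" 1 "z (axis n 1)"]
      by (simp add: add.commute)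
  qed
  also have "\<dots> = (\<integral>\<^sup>+x. g x \<partial>lborel)"
    by (rule split[symmetric]) simp
  finally show ?thesis .
qed

lemma nn_integral_permute_coords:
  fixes g :: "real^'n::finite \<Rightarrow> ennreal"
  assumes p: "p permutes UNIV" and [measurable]: "g \<in> borel_measurable borel"
  shows "(\<integral>\<^sup>+x. g (\<chi> i. x $ p i) \<partial>lborel) = (\<integral>\<^sup>+x. g x \<partial>lborel)"
proof -
  let ?p = "\<lambda>x::real^'n. \<chi> i. x $ p i"
  have "linear ?p" by (rule linearI) (auto simp: vec_eq_iff)
  then have [measurable]: "?p \<in> borel_measurable borel"
    by (intro borel_measurable_continuous_onI linear_continuous_on) (simp add: linear_linear)
  have "lborel = distr lborel borel ?p"
  proof (rule lborel_eqI)
    fix l u :: "real^'n" assume le: "\<And>b. b \<in> Basis \<Longrightarrow> l \<bullet> b \<le> u \<bullet> b"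
    have le': "l $ i \<le> u $ i" for i using le[of "axis i 1"] by (simp add: inner_axis)
    let ?q = "inv p"
    have q: "?q (p i) = i" "p (?q i) = i" for i using p by (simp_all add: permutes_inverses)
    have "?p -` box l u = box (\<chi> i. l $ ?q i) (\<chi> i. u $ ?q i)"
      by (auto simp: mem_box_cart) (metis q)+
    moreover have "emeasure lborel (box a b) = ennreal (\<Prod>i\<in>UNIV. b$i - a$i)"
      if "\<And>i. a $ i \<le> b $ i" for a b :: "real^'n"
      using that
      by (simp add: emeasure_lborel_box_eq Basis_vec_eq prod.reindex inj_on_def axis_eq_axis inner_axis)
    moreover have "(\<Prod>i\<in>UNIV. u $ ?q i - l $ ?q i) = (\<Prod>i\<in>UNIV. u $ i - l $ i)"
      by (rule prod.permute[OF permutes_inv[OF p], symmetric, unfolded o_def])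
    moreover have "(\<Prod>b\<in>Basis. (u - l) \<bullet> b) = (\<Prod>i\<in>UNIV. u $ i - l $ i)"
      by (simp add: Basis_vec_eq prod.reindex inj_on_def axis_eq_axis inner_axis)
    ultimately show "emeasure (distr lborel borel ?p) (box l u) = (\<Prod>b\<in>Basis. (u - l) \<bullet> b)"
      using le' by (simp add: emeasure_distr)
  qed simp
  then have "(\<integral>\<^sup>+x. g x \<partial>lborel) = (\<integral>\<^sup>+x. g x \<partial>distr lborel borel ?p)" by simp
  then show ?thesis by (simp add: nn_integral_distr)
qed

text \<open>
  By Gaussian elimination it suffices to treat the elementary maps: a map with a zero row is
  excluded by the determinant, a diagonal map is a scaling of the coordinates, and
  transpositions and shears preserve Lebesgue measure.
\<close>
lemma nn_integral_linear:
  fixes f :: "real^'n::finite \<Rightarrow> real^'n" and g :: "real^'n \<Rightarrow> ennreal"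
  assumes "linear f" and "det (matrix f) \<noteq> 0" and "g \<in> borel_measurable borel"
  shows "ennreal \<bar>det (matrix f)\<bar> * (\<integral>\<^sup>+x. g (f x) \<partial>lborel) = (\<integral>\<^sup>+x. g x \<partial>lborel)"
proof -
  define P where "P f \<longleftrightarrow> (det (matrix f) \<noteq> 0 \<longrightarrow> (\<forall>g\<in>borel_measurable borel.
     ennreal \<bar>det (matrix f)\<bar> * (\<integral>\<^sup>+x. g (f x) \<partial>lborel) = (\<integral>\<^sup>+x. g x \<partial>lborel)))"
    for f :: "real^'n \<Rightarrow> real^'n"
  have meas: "f \<in> borel_measurable borel" if "linear f" for f :: "real^'n \<Rightarrow> real^'n"
    using that by (intro borel_measurable_continuous_onI linear_continuous_on) (simp add: linear_linear)
  have "P f"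
    using assms(1)
  proof (rule induct_linear_elementary)
    fix f g :: "real^'n \<Rightarrow> real^'n" assume lin: "linear f" "linear g" and P: "P f" "P g"
    have "det (matrix (f \<circ> g)) = det (matrix f) * det (matrix g)"
      using lin by (simp add: matrix_compose det_mul)
    moreover have "ennreal (\<bar>det (matrix f)\<bar> * \<bar>det (matrix g)\<bar>) * (\<integral>\<^sup>+x. h (f (g x)) \<partial>lborel)
        = (\<integral>\<^sup>+x. h x \<partial>lborel)"
      if ne: "det (matrix f) \<noteq> 0" "det (matrix g) \<noteq> 0" and h: "h \<in> borel_measurable borel"
          for h :: "real^'n \<Rightarrow> ennreal"
    proof -
      have "(\<lambda>x. h (f x)) \<in> borel_measurable borel"
        using h meas[OF lin(1)] by measurable
      then have "ennreal \<bar>det (matrix g)\<bar> * (\<integral>\<^sup>+x. h (f (g x)) \<partial>lborel) = (\<integral>\<^sup>+x. h (f x) \<partial>lborel)"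
        using P(2)[unfolded P_def, rule_format, OF ne(2), of "\<lambda>x. h (f x)"] by simp
      moreover have "ennreal \<bar>det (matrix f)\<bar> * (\<integral>\<^sup>+x. h (f x) \<partial>lborel) = (\<integral>\<^sup>+x. h x \<partial>lborel)"
        using P(1) ne h unfolding P_def by blast
      ultimately show ?thesis by (simp add: ennreal_mult mult.assoc)
    qed
    ultimately show "P (f \<circ> g)"
      unfolding P_def by (simp add: abs_mult)
  next
    fix f :: "real^'n \<Rightarrow> real^'n" and i assume "linear f" "\<And>x. f x $ i = 0"
    then have "row i (matrix f) = 0" by (simp add: row_def matrix_def vec_eq_iff)
    then show "P f" by (simp add: P_def det_zero_row)
  next
    fix c :: "'n \<Rightarrow> real"
    let ?f = "\<lambda>x::real^'n. \<chi> i. c i * x $ i"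
    have "matrix ?f = (\<chi> i j. if i = j then c i else 0)"
      by (simp add: matrix_def axis_def vec_eq_iff)
    then have det: "det (matrix ?f) = prod c UNIV"
      by (simp add: det_diagonal)
    have "linear ?f" by (rule linearI) (auto simp: vec_eq_iff algebra_simps)
    note [measurable] = meas[OF this]
    show "P ?f"
      unfolding P_def det
    proof (intro impI ballI)
      fix g :: "real^'n \<Rightarrow> ennreal" assume c: "prod c UNIV \<noteq> 0" and [measurable]: "g \<in>
          borel_measurable borel"
      let ?T = "\<lambda>x. \<Sum>j\<in>Basis. (c (THE i. j = axis i 1) * (x \<bullet> j)) *\<^sub>R j :: real^'n"
      have the: "(THE i. axis k (1::real) = axis i 1) = k" for k :: 'n
        by (simp add: axis_eq_axis)
      have T: "?T = ?f"
        by (intro ext, rule vec_eq_iff[THEN iffD2])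
           (simp add: sum_Basis_nth the inner_axis del: sum_component)
      have "lborel = density (distr lborel borel (\<lambda>x. 0 + ?T x)) (\<lambda>_. (\<Prod>j\<in>(Basis::(real^'n) set).
          \<bar>c (THE i. j = axis i 1)\<bar>))"
        by (rule lborel_affine_euclidean) (use c in \<open>auto simp: Basis_vec_eq the\<close>)
      also have "(\<Prod>j\<in>(Basis::(real^'n) set). \<bar>c (THE i. j = axis i 1)\<bar>) = \<bar>prod c UNIV\<bar>"
        by (simp add: Basis_vec_eq prod.reindex inj_on_def axis_eq_axis abs_prod)
      finally have "lborel = density (distr lborel borel ?f) (\<lambda>_. \<bar>prod c UNIV\<bar>)"
        by (simp add: T)
      then have "(\<integral>\<^sup>+x. g x \<partial>lborel) = (\<integral>\<^sup>+x. g x \<partial>density (distr lborel borel ?f) (\<lambda>_. \<bar>prod c UNIV\<bar>))"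
        by simp
      then show "ennreal \<bar>prod c UNIV\<bar> * (\<integral>\<^sup>+x. g (?f x) \<partial>lborel) = (\<integral>\<^sup>+x. g x \<partial>lborel)"
        by (simp add: nn_integral_density nn_integral_distr nn_integral_cmult)
    qed
  next
    fix m n :: 'n assume "m \<noteq> n"
    let ?f = "\<lambda>x::real^'n. \<chi> i. x $ Transposition.transpose m n i"
    have p: "Transposition.transpose m n permutes UNIV" by (simp add: permutes_swap_id)
    have "matrix ?f = (\<chi> i. (mat 1 :: real^'n^'n) $ Transposition.transpose m n i)"
      by (auto simp: matrix_def mat_def axis_def vec_eq_iff)
    then have "\<bar>det (matrix ?f)\<bar> = 1"
      by (simp add: det_permute_rows[OF p] sign_def abs_mult)
    then show "P ?f"
      using nn_integral_permute_coords[OF p] by (auto simp: P_def)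
  next
    fix m n :: 'n assume mn: "m \<noteq> n"
    let ?f = "\<lambda>x::real^'n. \<chi> i. if i = m then x$m + x$n else x$i"
    have "matrix ?f = (\<chi> k. if k
        = m then row m (mat 1 :: real^'n^'n) + 1 *s row n (mat 1) else row k (mat 1))"
      by (auto simp: matrix_def mat_def axis_def vec_eq_iff row_def)
    then have "det (matrix ?f) = 1"
      by (simp only: det_row_operation[OF mn] det_I)
    then show "P ?f"
      using nn_integral_shear[OF mn] by (auto simp: P_def)
  qed
  then show ?thesis using assms by (auto simp: P_def)
qed

lemma distr_lborel_linear:
  fixes f :: "real^'n::finite \<Rightarrow> real^'n"
  assumes "linear f" and "det (matrix f) \<noteq> 0"
  shows "distr lborel borel f = density lborel (\<lambda>_. ennreal (1 / \<bar>det (matrix f)\<bar>))"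
proof (rule measure_eqI)
  have [measurable]: "f \<in> borel_measurable borel"
    using assms(1) by (intro borel_measurable_continuous_onI linear_continuous_on) (simp add:
        linear_linear)
  fix A assume "A \<in> sets (distr lborel borel f)"
  then have [measurable]: "A \<in> sets borel" by simp
  let ?d = "\<bar>det (matrix f)\<bar>"
  let ?I = "\<integral>\<^sup>+x. indicator A (f x) \<partial>lborel"
  have "ennreal (1 / ?d) * (\<integral>\<^sup>+x. indicator A x \<partial>lborel) = ennreal (1 / ?d) * (ennreal ?d * ?I)"
    using nn_integral_linear[OF assms, of "indicator A"] by simp
  also have "\<dots> = ?I"
    using assms(2) by (simp add: mult.assoc[symmetric] ennreal_mult'[symmetric])
  finally show "emeasure (distr lborel borel f) A = emeasure (density lborel (\<lambda>_. ennreal (1 / ?d))) A"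
    by (subst emeasure_density)
       (simp_all add: nn_integral_cmult nn_integral_distr flip: nn_integral_indicator)
qed simp

lemma integral_linear:
  fixes f :: "real^'n::finite \<Rightarrow> real^'n" and g :: "real^'n \<Rightarrow> 'b::{banach, second_countable_topology}"
  assumes "linear f" and "det (matrix f) \<noteq> 0" and [measurable]: "g \<in> borel_measurable borel"
  shows "(\<integral>x. g (f x) \<partial>lborel) = (1 / \<bar>det (matrix f)\<bar>) *\<^sub>R (\<integral>x. g x \<partial>lborel)"
proof -
  have [measurable]: "f \<in> borel_measurable borel"
    using assms(1) by (intro borel_measurable_continuous_onI linear_continuous_on) (simp add:
        linear_linear)
  have "(\<integral>x. g (f x) \<partial>lborel) = (\<integral>x. g x \<partial>distr lborel borel f)"
    by (simp add: integral_distr)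
  also have "\<dots> = (\<integral>x. (1 / \<bar>det (matrix f)\<bar>) *\<^sub>R g x \<partial>lborel)"
    by (subst distr_lborel_linear[OF assms(1,2)]) (simp add: integral_density)
  finally show ?thesis by simp
qed

section \<open>The Fourier transform of a Gaussian\<close>

text \<open>
  Lebesgue measure on \<open>\<real>\<^sup>n\<close> is the image of a product measure over the basis vectors; this is
  Fubini's theorem for products of functions of one coordinate each.
\<close>
lemma integral_lborel_prod:
  fixes f :: "'n::finite \<Rightarrow> real \<Rightarrow> 'b::{real_normed_field, banach, second_countable_topology}"
  assumes "\<And>i. integrable lborel (f i)"
  shows "integrable lborel (\<lambda>x::real^'n. \<Prod>i\<in>UNIV. f i (x $ i))"
    and "(\<integral>x. (\<Prod>i\<in>UNIV. f i ((x::real^'n) $ i)) \<partial>lborel) = (\<Prod>i\<in>UNIV. \<integral>x. f i x \<partial>lborel)"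
proof -
  interpret product_sigma_finite "\<lambda>_::real^'n. lborel :: real measure" by standard
  let ?F = "\<lambda>b::real^'n. f (THE i. b = axis i 1)"
  let ?v = "\<lambda>z. \<Sum>b\<in>Basis. z b *\<^sub>R b :: real^'n"
  let ?M = "\<Pi>\<^sub>M b\<in>(Basis::(real^'n) set). lborel :: real measure"
  have the: "(THE i. axis k (1::real) = axis i 1) = k" for k :: 'n
    by (simp add: axis_eq_axis)
  have v: "?v \<in> ?M \<rightarrow>\<^sub>M borel" by measurable
  have reindex: "(\<Prod>i\<in>UNIV. h (axis i 1) i) = (\<Prod>b\<in>Basis. h b (THE i. b = axis i 1))"
    for h :: "real^'n \<Rightarrow> 'n \<Rightarrow> 'b"
    by (simp add: Basis_vec_eq prod.reindex inj_on_def axis_eq_axis)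
  have [measurable]: "f i \<in> borel_measurable borel" for i
    using borel_measurable_integrable[OF assms[of i]] by simp
  have eq: "(\<Prod>i\<in>UNIV. f i (?v z $ i)) = (\<Prod>b\<in>Basis. ?F b (z b))" for z
    by (subst reindex[symmetric]) (simp add: sum_Basis_nth del: sum_component)
  have meas: "(\<lambda>x::real^'n. \<Prod>i\<in>UNIV. f i (x $ i)) \<in> borel_measurable borel"
    by measurable
  show "integrable lborel (\<lambda>x::real^'n. \<Prod>i\<in>UNIV. f i (x $ i))"
    by (subst lborel_eq, subst integrable_distr_eq[OF v meas], unfold eq,
        rule product_integrable_prod) (simp_all add: assms)
  have "(\<integral>x. (\<Prod>i\<in>UNIV. f i ((x::real^'n) $ i)) \<partial>lborel) = (\<integral>z. (\<Prod>b\<in>Basis. ?F b (z b)) \<partial>?M)"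
    by (subst lborel_eq, subst integral_distr[OF v meas], unfold eq, rule refl)
  also have "\<dots> = (\<Prod>b\<in>Basis. \<integral>x. ?F b x \<partial>lborel)"
    by (rule product_integral_prod) (simp_all add: assms)
  also have "\<dots> = (\<Prod>i\<in>UNIV. \<integral>x. f i x \<partial>lborel)"
    by (rule reindex[symmetric])
  finally show "(\<integral>x. (\<Prod>i\<in>UNIV. f i ((x::real^'n) $ i)) \<partial>lborel) = (\<Prod>i\<in>UNIV. \<integral>x. f i x \<partial>lborel)" .
qed

text \<open>
  Substituting \<open>x \<mapsto> sqrt (2 pi / s) x\<close> in the characteristic function of the standard normal
  distribution.
\<close>
lemma fourier_gaussian_1:
  fixes s y :: real
  assumes "s > 0"
  shows "integrable lborel (\<lambda>x. complex_of_real (exp (- pi * x\<^sup>2 / s)) * cis (2 * pi * y * x))"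
    and "(\<integral>x. complex_of_real (exp (- pi * x\<^sup>2 / s)) * cis (2 * pi * y * x) \<partial>lborel)
       = complex_of_real (sqrt s * exp (- pi * s * y\<^sup>2))"
proof -
  define c where "c = sqrt (2 * pi / s)"
  have c: "c > 0" "c\<^sup>2 = 2 * pi / s" using assms by (auto simp: c_def)
  define t where "t = 2 * pi * y / c"
  let ?h = "\<lambda>x. complex_of_real (std_normal_density x) * cis (t * x)"
  have h_eq: "?h (0 + c * x) = complex_of_real (1 / sqrt (2 * pi)) *
      (complex_of_real (exp (- pi * x\<^sup>2 / s)) * cis (2 * pi * y * x))" for x
  proof -
    have e: "- (c * x)\<^sup>2 / 2 = - pi * x\<^sup>2 / s" "t * (c * x) = 2 * pi * y * x"
      using c assms by (simp_all add: power_mult_distrib t_def)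
    show ?thesis unfolding std_normal_density_def add_0_left e by simp
  qed
  have "integrable lborel (\<lambda>x. std_normal_density x)" by simp
  then have ih: "integrable lborel ?h"
    by (rule Bochner_Integration.integrable_bound)
       (auto simp: norm_mult intro!: borel_measurable_times borel_measurable_of_real
         borel_measurable_continuous_onI[of "\<lambda>x. cis (t * x)"] continuous_intros)
  have "(\<integral>x. ?h x \<partial>lborel) = char std_normal_distribution t"
    unfolding char_def
    by (subst integral_density) (auto simp: cis_conv_exp scaleR_conv_of_real mult_ac)
  then have Ih: "(\<integral>x. ?h x \<partial>lborel) = complex_of_real (exp (- (t^2) / 2))"
    by (simp add: char_std_normal_distribution)
  have "integrable lborel (\<lambda>x. ?h (0 + c * x))"
    using ih c by (subst lborel_integrable_real_affine_iff) auto
  then have "integrable lborel (\<lambda>x. complex_of_real (sqrt (2 * pi)) * ?h (0 + c * x))"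
    by (rule integrable_mult_right)
  moreover have "complex_of_real (sqrt (2 * pi)) * ?h (0 + c * x)
      = complex_of_real (exp (- pi * x\<^sup>2 / s)) * cis (2 * pi * y * x)" for x
  proof -
    have "complex_of_real (sqrt (2 * pi)) * complex_of_real (1 / sqrt (2 * pi)) = 1"
      by (simp flip: of_real_mult)
    then show ?thesis unfolding h_eq by (simp only: mult.assoc[symmetric] mult_1)
  qed
  ultimately show "integrable lborel (\<lambda>x. complex_of_real (exp (- pi * x\<^sup>2 / s)) * cis (2 * pi * y * x))"
    by (simp only:)
  have "(\<integral>x. ?h x \<partial>lborel) = c *\<^sub>R (\<integral>x. ?h (0 + c * x) \<partial>lborel)"
    using lborel_integral_real_affine[of c ?h 0] c by simp
  then have "complex_of_real (exp (- (t^2) / 2)) = c *\<^sub>R (complex_of_real (1 / sqrt (2 * pi)) *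
      (\<integral>x. complex_of_real (exp (- pi * x\<^sup>2 / s)) * cis (2 * pi * y * x) \<partial>lborel))" (is "_
          = _ *\<^sub>R (_ * ?I)")
    unfolding h_eq Ih by simp
  then have "complex_of_real (exp (- (t^2) / 2)) = complex_of_real (c / sqrt (2 * pi)) * ?I"
    by (simp add: scaleR_conv_of_real)
  moreover have "c / sqrt (2 * pi) = 1 / sqrt s"
    using assms by (simp add: c_def real_sqrt_divide)
  moreover have "t\<^sup>2 / 2 = pi * s * y\<^sup>2"
    using assms c by (simp add: t_def power_divide power_mult_distrib) (simp add: power2_eq_square)
  ultimately have "complex_of_real (exp (- (pi * s * y\<^sup>2))) = complex_of_real (1 / sqrt s) * ?I" by simp
  then have "complex_of_real (sqrt s) * complex_of_real (exp (- (pi * s * y\<^sup>2)))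
      = (complex_of_real (sqrt s) * complex_of_real (1 / sqrt s)) * ?I" by (simp only: mult.assoc)
  also have "complex_of_real (sqrt s) * complex_of_real (1 / sqrt s) = 1"
    using assms by (simp flip: of_real_mult)
  finally show "?I = complex_of_real (sqrt s * exp (- pi * s * y\<^sup>2))" by simp
qed

lemma cis_sum: "finite A \<Longrightarrow> cis (\<Sum>i\<in>A. f i) = (\<Prod>i\<in>A. cis (f i))"
  by (induction rule: finite_induct) (auto simp: cis_mult[symmetric])

lemma norm_vec_square: "(norm (x::real^'n::finite))\<^sup>2 = (\<Sum>i\<in>UNIV. (x $ i)\<^sup>2)"
  by (simp add: norm_vec_def L2_set_def sum_nonneg)

lemma fourier_gaussian:
  fixes y :: "real^'n::finite"
  assumes "s > 0"
  shows "integrable lborel (\<lambda>x. complex_of_real (exp (- pi * (norm x)\<^sup>2 / s)) * cis (2 * pi * (y \<bullet> x)))"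
    and "(\<integral>x. complex_of_real (exp (- pi * (norm x)\<^sup>2 / s)) * cis (2 * pi * (y \<bullet> x)) \<partial>lborel)
       = complex_of_real (sqrt s ^ CARD('n) * exp (- pi * s * (norm y)\<^sup>2))"
proof -
  let ?f = "\<lambda>i x. complex_of_real (exp (- pi * x\<^sup>2 / s)) * cis (2 * pi * (y $ i) * x)"
  have eq: "complex_of_real (exp (- pi * (norm x)\<^sup>2 / s)) * cis (2 * pi * (y \<bullet> x))
      = (\<Prod>i\<in>UNIV. ?f i (x $ i))"
    for x :: "real^'n"
  proof -
    have "- pi * (norm x)\<^sup>2 / s = (\<Sum>i\<in>UNIV. - pi * (x $ i)\<^sup>2 / s)"
      by (simp add: norm_vec_square sum_distrib_left sum_divide_distrib sum_negf)
    moreover have "2 * pi * (y \<bullet> x) = (\<Sum>i\<in>UNIV. 2 * pi * (y $ i) * x $ i)"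
      by (simp add: inner_vec_def sum_distrib_left mult.assoc)
    ultimately show ?thesis by (simp add: exp_sum cis_sum prod.distrib)
  qed
  note f = fourier_gaussian_1[OF assms]
  show "integrable lborel (\<lambda>x. complex_of_real (exp (- pi * (norm x)\<^sup>2 / s)) * cis (2 * pi * (y \<bullet> x)))"
    unfolding eq by (rule integral_lborel_prod) (rule f)
  have "(\<integral>x. complex_of_real (exp (- pi * (norm x)\<^sup>2 / s)) * cis (2 * pi * (y \<bullet> x)) \<partial>lborel)
      = (\<Prod>i\<in>UNIV. complex_of_real (sqrt s * exp (- pi * s * (y $ i)\<^sup>2)))"
    unfolding eq by (subst integral_lborel_prod(2)[OF f(1)]) (simp only: f(2))
  also have "\<dots> = complex_of_real (sqrt s ^ CARD('n) * exp (- pi * s * (norm y)\<^sup>2))"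
    by (simp add: norm_vec_square sum_distrib_left exp_sum prod.distrib flip: of_real_prod sum_negf)
  finally show "(\<integral>x. complex_of_real (exp (- pi * (norm x)\<^sup>2 / s)) * cis (2 * pi * (y \<bullet> x)) \<partial>lborel)
       = complex_of_real (sqrt s ^ CARD('n) * exp (- pi * s * (norm y)\<^sup>2))" .
qed

section \<open>An approximate identity of cosine powers\<close>

text \<open>
  The Fourier coefficients of \<open>cos_kernel\<close>. They are extended by \<open>0\<close> beyond the degree of the
  trigonometric polynomial, so that their limit at a fixed frequency makes sense.
\<close>
definition kernel_coeff :: "nat \<Rightarrow> int \<Rightarrow> real" where
  "kernel_coeff N j = (if \<bar>j\<bar>
      \<le> int N then real ((2*N) choose nat (int N + j)) / real ((2*N) choose N) else 0)"

text \<open>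
  The normalization makes the mean over a period equal to \<open>1\<close>. Powers of the cosine are chosen
  since their Fourier coefficients are explicit, nonnegative and bounded by \<open>1\<close>, so that
  dominated convergence applies on the Fourier side.
\<close>
definition cos_kernel :: "nat \<Rightarrow> real \<Rightarrow> real" where
  "cos_kernel N x = 4 ^ N / real ((2*N) choose N) * cos (pi * x) ^ (2*N)"

text \<open>
  The binomial expansion of \<open>(2 cos (pi x))^(2N) = (cis (pi x) + cis (-pi x))^(2N)\<close>.
\<close>
lemma cos_kernel_eq_sum:
  "complex_of_real (cos_kernel N x)
      = (\<Sum>j\<in>{-int N..int N}. complex_of_real (kernel_coeff N j) * cis (2 * pi * (of_int j * x)))"
proof -
  let ?C = "real ((2*N) choose N)"
  have "complex_of_real (4 ^ N * cos (pi * x) ^ (2*N)) = (cis (pi * x) + cis (- (pi * x))) ^ (2*N)"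
  proof -
    have "cis (pi * x) + cis (- (pi * x)) = complex_of_real (2 * cos (pi * x))"
      by (simp add: complex_eq_iff)
    then show ?thesis by (simp add: power_mult_distrib power_mult)
  qed
  also have "\<dots> = (\<Sum>l\<le>2*N. of_nat ((2*N) choose l) * cis (pi * x) ^ l * cis (- (pi * x)) ^ (2*N - l))"
    by (rule binomial_ring)
  also have "\<dots> = (\<Sum>l\<le>2*N. of_nat ((2*N) choose l) * cis (2 * pi * (of_int (int l - int N) * x)))"
  proof (intro sum.cong refl)
    fix l assume "l \<in> {..2*N}"
    then have "real l * (pi * x) + real (2*N - l) * (- (pi * x))
        = 2 * pi * (of_int (int l - int N) * x)"
      by (simp add: of_nat_diff algebra_simps)
    then show "of_nat ((2*N) choose l) * cis (pi * x) ^ l * cis (- (pi * x)) ^ (2*N - l)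
        = of_nat ((2*N) choose l) * cis (2 * pi * (of_int (int l - int N) * x))"
      by (simp only: Complex.DeMoivre cis_mult mult.assoc)
  qed
  also have "\<dots> = (\<Sum>j\<in>{-int N..int N}. of_nat ((2*N) choose nat (int N + j)) * cis (2 * pi *
      (of_int j * x)))"
    by (rule sum.reindex_bij_witness[of _ "\<lambda>j. nat (int N + j)" "\<lambda>l. int l - int N"]) auto
  finally have "complex_of_real (cos_kernel N x)
     = (\<Sum>j\<in>{-int N..int N}. of_nat ((2*N) choose nat (int N + j)) * cis (2 * pi * (of_int j * x))) / ?C"
    by (simp add: cos_kernel_def)
  then show ?thesis
    by (auto simp: sum_divide_distrib kernel_coeff_def intro!: sum.cong)
qed

lemma kernel_coeff_nonneg: "0 \<le> kernel_coeff N j"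
  by (simp add: kernel_coeff_def)

lemma kernel_coeff_le_1: "kernel_coeff N j \<le> 1"
  using binomial_maximum'[of N "nat (int N + j)"] by (simp add: kernel_coeff_def divide_le_eq)

lemma kernel_coeff_uminus: "kernel_coeff N (- j) = kernel_coeff N j"
proof -
  have "(2*N) choose nat (int N - j) = (2*N) choose nat (int N + j)" if "\<bar>j\<bar> \<le> int N"
  proof -
    have "nat (int N - j) = 2*N - nat (int N + j)" "nat (int N + j) \<le> 2*N" using that by auto
    then show ?thesis by (simp add: binomial_symmetric[symmetric])
  qed
  then show ?thesis by (simp add: kernel_coeff_def)
qed

text \<open>
  Neighbouring coefficients have the quotient \<open>(N - k) / (N + k + 1)\<close>, which tends to \<open>1\<close>.
\<close>
lemma kernel_coeff_tendsto: "(\<lambda>N. kernel_coeff N j) \<longlonglongrightarrow> 1"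
proof -
  have nat: "(\<lambda>N. kernel_coeff N (int k)) \<longlonglongrightarrow> 1" for k
  proof (induction k)
    case 0
    then show ?case by (simp add: kernel_coeff_def)
  next
    case (Suc k)
    have "(\<lambda>N. (real N - real k) / (real N + real k + 1)) \<longlonglongrightarrow> 1"
      by real_asymp
    from tendsto_mult[OF Suc this]
    have "(\<lambda>N. kernel_coeff N (int k) * ((real N - real k) / (real N + real k + 1))) \<longlonglongrightarrow> 1" by simp
    moreover have "\<forall>\<^sub>F N in sequentially. kernel_coeff N (int k) * ((real N - real k) / (real N +
        real k + 1))
        = kernel_coeff N (int (Suc k))"
      using eventually_ge_at_top[of "Suc k"]
    proof eventually_elim
      case (elim N)
      have "Suc (N + k) * ((2*N) choose Suc (N + k)) = (2*N - (N + k)) * ((2*N) choose (N + k))"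
        by (simp only: binomial_absorb_comp binomial_absorption)
      then have "real (Suc (N + k)) * real ((2*N) choose Suc (N + k))
          = real (2*N - (N + k)) * real ((2*N) choose (N + k))"
        by (simp only: of_nat_mult[symmetric])
      moreover have "real (2*N - (N + k)) = real N - real k" using elim by (simp add: of_nat_diff)
      ultimately have "real ((2*N) choose Suc (N + k))
          = real ((2*N) choose (N + k)) * ((real N - real k) / (real N + real k + 1))"
        by (simp add: field_simps)
      moreover have "nat (int N + int k) = N + k" "nat (int N + int (Suc k)) = Suc (N + k)" by auto
      ultimately show ?case
        using elim by (simp add: kernel_coeff_def)
    qed
    ultimately show ?case by (rule Lim_transform_eventually)
  qed
  show ?thesis
  proof (cases "j \<ge> 0")
    case True then show ?thesis using nat[of "nat j"] by simp
  next
    case False then show ?thesis using nat[of "nat (-j)"] by (simp add: kernel_coeff_uminus)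
  qed
qed

lemma cos_kernel_nonneg: "0 \<le> cos_kernel N x"
  by (simp add: cos_kernel_def power_mult)

lemma cos_kernel_add_int: "cos_kernel N (x + of_int k) = cos_kernel N x"
proof -
  have "cos (pi * (x + of_int k)) ^ 2 = cos (pi * x) ^ 2"
  proof -
    have "sin (pi * of_int k) = 0" by (metis sin_npi_int mult.commute)
    moreover have "(cos (pi * of_int k))\<^sup>2 = 1"
      using sin_cos_squared_add[of "pi * of_int k"] calculation by simp
    ultimately show ?thesis by (simp add: distrib_left cos_add power_mult_distrib)
  qed
  then show ?thesis by (simp add: cos_kernel_def power_mult)
qed

text \<open>
  The normalizing constant grows only linearly in \<open>N\<close>, whereas the power of the cosine decays
  exponentially away from the integers.
\<close>
lemma cos_kernel_bound:
  assumes "N > 0"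
  shows "cos_kernel N x \<le> 2 * real N * cos (pi * x) ^ (2*N)"
proof -
  have "4 ^ N / real ((2*N) choose N) \<le> 2 * real N"
    using central_binomial_lower_bound[OF assms] assms by (simp add: field_simps)
  then show ?thesis unfolding cos_kernel_def by (rule mult_right_mono) (simp add: power_mult)
qed

lemma cos_kernel_le: "N > 0 \<Longrightarrow> cos_kernel N x \<le> 2 * real N"
proof -
  assume "N > 0"
  moreover have "cos (pi * x) ^ (2*N) \<le> 1"
    unfolding power_mult by (rule power_le_one) (auto simp: abs_square_le_1)
  ultimately show ?thesis using cos_kernel_bound[of N x] 
    by (meson landau_o.R_mult_left_mono mult_left_le of_nat_0_le_iff order_trans zero_le_mult_iff
        zero_le_numeral)
qed

lemma cos_kernel_le_away:
  assumes "N > 0" "0 \<le> \<delta>" "\<delta> \<le> \<bar>x\<bar>" "\<bar>x\<bar> \<le> 1/2"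
  shows "cos_kernel N x \<le> 2 * real N * cos (pi * \<delta>) ^ (2*N)"
proof -
  have "cos (pi * \<bar>x\<bar>) \<le> cos (pi * \<delta>)"
    using assms by (intro cos_monotone_0_pi_le) (auto simp: field_simps)
  moreover have "cos (pi * \<bar>x\<bar>) = cos (pi * x)" by (cases "x \<ge> 0") auto
  moreover have "cos (pi * \<bar>x\<bar>) \<ge> 0"
    using assms mult_left_mono[OF assms(4), of pi] by (intro cos_ge_zero) (auto intro:
        order_trans[of _ 0])
  ultimately have "cos (pi * x) ^ (2*N) \<le> cos (pi * \<delta>) ^ (2*N)"
    by (metis power_mono)
  then show ?thesis
    using cos_kernel_bound[OF assms(1), of x] mult_left_mono[of _ _ "2 * real N"] by (meson
        mult_nonneg_nonneg of_nat_0_le_iff order_trans zero_le_numeral)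
qed

text \<open>
  All frequencies except \<open>0\<close> integrate to \<open>0\<close> over a period. The half-open interval is used
  because its integer translates tile the line.
\<close>
lemma integral_cos_kernel:
  "integrable lborel (\<lambda>x. indicator {-1/2..<1/2} x * cos_kernel N x)"
  "(\<integral>x. indicator {-1/2..<1/2} x * cos_kernel N x \<partial>lborel) = 1"
proof -
  have kern: "cos_kernel N x
      = (\<Sum>j\<in>{-int N..int N}. kernel_coeff N j * cos (2 * pi * (of_int j * x)))" for x
    using arg_cong[OF cos_kernel_eq_sum[of N x], of Re] by simp
  have cosint: "has_bochner_integral lborel (\<lambda>x. cos (2 * pi * (of_int j * x)) * indicator
      {-1/2..1/2} x) (if j = 0 then 1 else 0)"
    for j :: int
  proof (cases "j = 0")
    case True
    then show ?thesis by (simp add: has_bochner_integral_iff)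
  next
    case False
    have "has_bochner_integral lborel (\<lambda>x. cos (2 * pi * (of_int j * x)) * indicator {-1/2..1/2} x)
      (sin (2 * pi * (of_int j * (1/2))) / (2 * pi * of_int j) - sin (2 * pi * (of_int j *
          (-1/2))) / (2 * pi * of_int j))"
      by (rule has_bochner_integral_FTC_Icc_real)
         (use False in \<open>auto intro!: derivative_eq_intros continuous_intros\<close>)
    moreover have "sin (2 * pi * (of_int j * (1/2))) = 0"
      using sin_npi_int[of j] by (simp add: mult.commute)
    ultimately show ?thesis using False by simp
  qed
  have "has_bochner_integral lborel (\<lambda>x. \<Sum>j\<in>{-int N..int N}. kernel_coeff N j * (cos (2 * pi *
      (of_int j * x)) * indicator {-1/2..1/2} x))
     (\<Sum>j\<in>{-int N..int N}. kernel_coeff N j * (if j = 0 then 1 else 0))"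
    by (intro has_bochner_integral_sum has_bochner_integral_mult_right) (rule cosint)
  moreover have "(\<Sum>j\<in>{-int N..int N}. kernel_coeff N j * (if j = 0 then 1 else 0)) = 1"
    by (simp add: if_distrib[of "\<lambda>x. _ * x"] sum.delta cong: if_cong) (simp add: kernel_coeff_def)
  moreover have "(\<Sum>j\<in>{-int N..int N}. kernel_coeff N j * (cos (2 * pi * (of_int j * x)) *
      indicator {-1/2..1/2} x))
      = indicator {-1/2..1/2} x * cos_kernel N x" for x
    unfolding kern sum_distrib_left by (intro sum.cong) auto
  ultimately have *: "has_bochner_integral lborel (\<lambda>x. indicator {-1/2..1/2} x * cos_kernel N x) 1"
    by simp
  have "AE x in lborel. x \<noteq> (1/2::real)" by (rule AE_lborel_singleton)
  then have "AE x in lborel. indicator {-1/2..1/2} x * cos_kernel N x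
      = indicator {-1/2..<1/2} x * cos_kernel N x"
    by eventually_elim (auto simp: indicator_def)
  moreover have [measurable]: "cos_kernel N \<in> borel_measurable borel"
    unfolding cos_kernel_def by measurable
  ultimately have "has_bochner_integral lborel (\<lambda>x. indicator {-1/2..<1/2} x * cos_kernel N x) 1"
    by (subst has_bochner_integral_cong_AE[symmetric]) (use * in auto)
  then show "integrable lborel (\<lambda>x. indicator {-1/2..<1/2} x * cos_kernel N x)"
    "(\<integral>x. indicator {-1/2..<1/2} x * cos_kernel N x \<partial>lborel) = 1"
    by (auto simp: has_bochner_integral_iff)
qed

definition int_vec :: "('n::finite \<Rightarrow> int) \<Rightarrow> real^'n" where
  "int_vec k = (\<chi> i. of_int (k i))"

lemma int_vec_nth [simp]: "int_vec k $ i = of_int (k i)"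
  by (simp add: int_vec_def)

lemma countable_int_functions: "countable (UNIV :: ('n::finite \<Rightarrow> int) set)"
proof -
  have "countable (PiE (UNIV::'n set) (\<lambda>_. UNIV :: int set))"
    by (rule countable_PiE) auto
  then show ?thesis by (simp add: PiE_UNIV_domain)
qed

lemma abs_summable_exp_int:
  assumes "c > 0"
  shows "Infinite_Set_Sum.abs_summable_on (\<lambda>j::int. exp (- c * \<bar>real_of_int j\<bar>)) (UNIV)"
proof -
  have "summable (\<lambda>n. exp (- c) ^ n)" using assms by (intro summable_geometric) simp
  then have *: "Infinite_Set_Sum.abs_summable_on (\<lambda>n::nat. exp (- c * real n)) (UNIV)"
    by (simp add: abs_summable_on_nat_iff' exp_of_nat_mult[symmetric] mult.commute)
  have 1: "Infinite_Set_Sum.abs_summable_on (\<lambda>j::int. exp (- c * \<bar>real_of_int j\<bar>)) (range int)"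
    by (subst abs_summable_on_reindex_iff[symmetric]) (use * in auto)
  have 2: "Infinite_Set_Sum.abs_summable_on (\<lambda>j::int. exp (- c * \<bar>real_of_int j\<bar>)) (range (\<lambda>n. -
      int n))"
    by (subst abs_summable_on_reindex_iff[symmetric]) (use * in \<open>auto simp: inj_on_def\<close>)
  have "(UNIV :: int set) = range int \<union> range (\<lambda>n. - int n)"
    by (auto simp: image_iff) (metis int_cases2)
  then show ?thesis using abs_summable_on_union[OF 1 2] by simp
qed

lemma abs_summable_exp_int_vec:
  assumes "c > 0"
  shows "Infinite_Set_Sum.abs_summable_on (\<lambda>k :: 'n::finite \<Rightarrow> int. exp (- c * (\<Sum>i\<in>UNIV.
      \<bar>real_of_int (k i)\<bar>))) (UNIV)"
proof -
  have "Infinite_Set_Sum.abs_summable_on (\<lambda>k. \<Prod>i\<in>UNIV. exp (- c * \<bar>real_of_int (k i)\<bar>)) (PiE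
      (UNIV::'n set) (\<lambda>_. UNIV))"
    by (rule abs_summable_on_prod_PiE) (use abs_summable_exp_int[OF assms] in auto)
  moreover have "exp (- c * (\<Sum>i\<in>UNIV. \<bar>real_of_int (k i)\<bar>))
      = (\<Prod>i\<in>UNIV. exp (- c * \<bar>real_of_int (k i)\<bar>))"
    for k :: "'n \<Rightarrow> int"
    by (simp add: exp_sum[symmetric] sum_distrib_left)
  ultimately show ?thesis by (simp add: PiE_UNIV_domain)
qed

text \<open>
  An injective linear map is bounded from below by a multiple of the norm. The bound is uniform
  over the cube around an integer point and summable over all integer points, which makes it
  the dominating function in both limits of the Poisson argument. A decay that is exponential
  in the sum norm suffices, and turns the sum over \<open>\<int>\<^sup>n\<close> into a product of geometric series.
\<close>
lemma gaussian_le_exp_int_vec: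
  fixes f :: "real^'n::finite \<Rightarrow> real^'n"
  assumes "linear f" "inj f" "a > 0"
  shows "\<exists>c>0. \<exists>C>0. \<forall>u k. (\<forall>i. \<bar>u $ i\<bar> \<le> 1/2) \<longrightarrow>
       exp (- a * (norm (f (u + int_vec k)))\<^sup>2) \<le> C * exp (- c * (\<Sum>i\<in>UNIV. \<bar>real_of_int (k i)\<bar>))"
proof -
  obtain B where B: "B > 0" "\<And>x. B * norm x \<le> norm (f x)"
    using linear_inj_bounded_below_pos[OF assms(1,2)] by blast
  define c where "c = a * B\<^sup>2"
  have "c > 0" using assms B by (simp add: c_def)
  moreover have "exp (- a * (norm (f (u + int_vec k)))\<^sup>2)
      \<le> exp (c * CARD('n)) * exp (- c * (\<Sum>i\<in>UNIV. \<bar>real_of_int (k i)\<bar>))"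
    if u: "\<And>i. \<bar>u $ i\<bar> \<le> 1/2" for u k
  proof -
    have "(B * norm (u + int_vec k))\<^sup>2 \<le> (norm (f (u + int_vec k)))\<^sup>2"
      using B by (intro power_mono) auto
    then have 1: "a * (B\<^sup>2 * (norm (u + int_vec k))\<^sup>2) \<le> a * (norm (f (u + int_vec k)))\<^sup>2"
      using assms(3) by (intro mult_left_mono) (auto simp: power_mult_distrib)
    have "\<bar>real_of_int (k i)\<bar> - 1 \<le> (u $ i + real_of_int (k i))\<^sup>2" for i
    proof -
      let ?x = "\<bar>u $ i + real_of_int (k i)\<bar>"
      have "0 \<le> (?x - 1/2)\<^sup>2" by simp
      then have "?x - 1/4 \<le> ?x\<^sup>2" by (simp add: power2_diff power2_eq_square[of "1/2"])
      moreover have "\<bar>real_of_int (k i)\<bar> - 1/2 \<le> ?x" using u[of i] by linarith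
      ultimately show ?thesis by simp
    qed
    then have "(\<Sum>i\<in>UNIV. \<bar>real_of_int (k i)\<bar> - 1) \<le> (norm (u + int_vec k))\<^sup>2"
      unfolding norm_vec_square by (intro sum_mono) simp
    then have "c * ((\<Sum>i\<in>UNIV. \<bar>real_of_int (k i)\<bar>) - CARD('n)) \<le> c * (norm (u + int_vec k))\<^sup>2"
      using \<open>c > 0\<close> by (simp add: sum_subtractf)
    then have "- a * (norm (f (u + int_vec k)))\<^sup>2 \<le> c * CARD('n) + - c * (\<Sum>i\<in>UNIV. \<bar>real_of_int (k i)\<bar>)"
      using 1 by (simp add: c_def algebra_simps)
    then show ?thesis by (simp flip: exp_add)
  qed
  ultimately show ?thesis by (intro exI[of _ c] conjI exI[of _ "exp (c * CARD('n))"]) auto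
qed

definition vec_kernel :: "nat \<Rightarrow> real^'n::finite \<Rightarrow> real" where
  "vec_kernel N u = (\<Prod>i\<in>UNIV. cos_kernel N (u $ i))"

definition unit_cell :: "(real^'n::finite) set" where
  "unit_cell = {u. \<forall>i. u $ i \<in> {-1/2..<1/2}}"

lemma cos_kernel_measurable [measurable]: "cos_kernel N \<in> borel_measurable borel"
  unfolding cos_kernel_def by measurable

lemma vec_kernel_measurable [measurable]: "vec_kernel N \<in> borel_measurable borel"
  unfolding vec_kernel_def by measurable

lemma vec_kernel_nonneg: "0 \<le> vec_kernel N u"
  by (simp add: vec_kernel_def prod_nonneg cos_kernel_nonneg)

lemma vec_kernel_add_int: "vec_kernel N (u + int_vec k) = vec_kernel N u"
  by (simp add: vec_kernel_def cos_kernel_add_int)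

lemma indicator_unit_cell: "indicator unit_cell u = (\<Prod>i\<in>UNIV. indicator {-1/2..<1/2} (u $ i) :: real)"
  by (auto simp: unit_cell_def indicator_def prod.neutral)

lemma unit_cell_measurable [measurable]: "(unit_cell :: (real^'n::finite) set) \<in> sets borel"
proof -
  have "unit_cell = (\<Inter>i. {u::real^'n. u $ i \<in> {-1/2..<1/2}})" by (auto simp: unit_cell_def)
  also have "\<dots> \<in> sets borel" by (intro sets.countable_INT'' ) measurable
  finally show ?thesis .
qed

lemma integral_vec_kernel:
  shows "integrable lborel (\<lambda>u::real^'n::finite. indicator unit_cell u * vec_kernel N u)"
    and "(\<integral>u. indicator unit_cell u * vec_kernel N (u::real^'n) \<partial>lborel) = 1"
proof -
  have eq: "indicator unit_cell u * vec_kernel N u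
      = (\<Prod>i\<in>UNIV. indicator {-1/2..<1/2} (u $ i) * cos_kernel N (u $ i))"
    for u :: "real^'n"
    by (simp add: indicator_unit_cell vec_kernel_def prod.distrib)
  show "integrable lborel (\<lambda>u::real^'n::finite. indicator unit_cell u * vec_kernel N u)"
    unfolding eq by (rule integral_lborel_prod(1)[where f="\<lambda>_ x. indicator {-1/2..<1/2} x *
        cos_kernel N x"])
      (rule integral_cos_kernel)
  show "(\<integral>u. indicator unit_cell u * vec_kernel N (u::real^'n) \<partial>lborel) = 1"
    unfolding eq by (subst integral_lborel_prod(2)[where f="\<lambda>_ x. indicator {-1/2..<1/2} x *
        cos_kernel N x"])
      (simp_all only: integral_cos_kernel prod.neutral_const)
qed

lemma vec_kernel_le_away:
  assumes "N > 0" "0 \<le> \<delta>" "u \<in> unit_cell" "\<delta> \<le> \<bar>u $ i\<bar>"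
  shows "vec_kernel N (u::real^'n::finite) \<le> (2 * real N) ^ CARD('n) * cos (pi * \<delta>) ^ (2*N)"
proof -
  have u: "\<bar>u $ i\<bar> \<le> 1/2"
  proof -
    have "u $ i \<in> {-1/2..<1/2}" using assms(3) unfolding unit_cell_def by blast
    then show ?thesis by (auto simp: abs_le_iff)
  qed
  have "vec_kernel N u = cos_kernel N (u $ i) * (\<Prod>j\<in>UNIV - {i}. cos_kernel N (u $ j))"
    unfolding vec_kernel_def by (rule prod.remove) auto
  also have "\<dots> \<le> (2 * real N * cos (pi * \<delta>) ^ (2*N)) * (\<Prod>j\<in>UNIV - {i}. 2 * real N)"
  proof (rule mult_mono)
    show "cos_kernel N (u $ i) \<le> 2 * real N * cos (pi * \<delta>) ^ (2*N)"
      by (rule cos_kernel_le_away[OF assms(1,2,4) u])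
    show "(\<Prod>j\<in>UNIV - {i}. cos_kernel N (u $ j)) \<le> (\<Prod>j\<in>UNIV - {i}. 2 * real N)"
      by (intro prod_mono conjI cos_kernel_nonneg cos_kernel_le assms)
    show "0 \<le> 2 * real N * cos (pi * \<delta>) ^ (2*N)" by (simp add: power_mult)
  qed (intro prod_nonneg ballI cos_kernel_nonneg)
  also have "\<dots> = (2 * real N) ^ CARD('n) * cos (pi * \<delta>) ^ (2*N)"
  proof -
    have "CARD('n) = Suc (card (UNIV - {i}))" by (rule card.remove) auto
    then show ?thesis by (simp only: prod_constant power_Suc mult_ac)
  qed
  finally show ?thesis .
qed

text \<open>
  Near \<open>0\<close> the function \<open>h\<close> is almost constant and the kernel has mass \<open>1\<close>; away from \<open>0\<close> the
  kernel tends to \<open>0\<close> uniformly on the cell, because there at least one coordinate is bounded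
  away from the integers.
\<close>
lemma vec_kernel_approx_identity:
  fixes h :: "real^'n::finite \<Rightarrow> real"
  assumes [measurable]: "h \<in> borel_measurable borel" and cont: "isCont h 0"
    and h: "\<And>u. 0 \<le> h u" "\<And>u. u \<in> unit_cell \<Longrightarrow> h u \<le> M"
  shows "(\<lambda>N. \<integral>u. indicator unit_cell u * h u * vec_kernel N u \<partial>lborel) \<longlonglongrightarrow> h 0"
    and "integrable lborel (\<lambda>u. indicator unit_cell u * h u * vec_kernel N u)"
proof -
  let ?Q = "unit_cell :: (real^'n) set"
  have Q0: "0 \<in> ?Q" by (simp add: unit_cell_def)
  have M: "0 \<le> M" using h(1)[of 0] h(2)[OF Q0] by linarith
  show int: "integrable lborel (\<lambda>u. indicator ?Q u * h u * vec_kernel N u)" for N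
  proof (rule Bochner_Integration.integrable_bound)
    show "integrable lborel (\<lambda>u. M * (indicator ?Q u * vec_kernel N u))"
      by (intro integrable_mult_right integral_vec_kernel)
    show "AE u in lborel. norm (indicator ?Q u * h u * vec_kernel N u)
        \<le> norm (M * (indicator ?Q u * vec_kernel N u))"
      using h M by (auto simp: indicator_def abs_mult vec_kernel_nonneg intro!: mult_right_mono)
  qed measurable
  \<comment> \<open>For \<open>N = 0\<close> the kernel is constantly \<open>1\<close>, so its mass is the volume of the cell.\<close>
  have volQ: "integrable lborel (\<lambda>u. indicator ?Q u :: real)" "(\<integral>u. indicator ?Q u \<partial>lborel) = (1::real)"
  proof -
    have "cos_kernel 0 x = 1" for x by (simp add: cos_kernel_def)
    then have "vec_kernel 0 u = 1" for u :: "real^'n" by (simp add: vec_kernel_def)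
    then show "integrable lborel (\<lambda>u. indicator ?Q u :: real)" "(\<integral>u. indicator ?Q u \<partial>lborel)
        = (1::real)"
      using integral_vec_kernel[of 0, where 'n='n] by (simp_all)
  qed
  show "(\<lambda>N. \<integral>u. indicator ?Q u * h u * vec_kernel N u \<partial>lborel) \<longlonglongrightarrow> h 0"
  proof (rule LIMSEQ_I)
    fix r :: real assume r: "r > 0"
    obtain d where d: "d > 0" "\<And>u. norm u < d \<Longrightarrow> \<bar>h u - h 0\<bar> < r/2"
      using cont[unfolded continuous_at_eps_delta, rule_format, of "r/2"] r by (auto simp: dist_norm)
    \<comment> \<open>The cube of half side \<open>\<delta>\<close> fits into the ball of radius \<open>d\<close>, and \<open>cos (pi * \<delta>)\<close> is positive.\<close>
    define \<delta> where "\<delta> = min (1/4) (d / (2 * CARD('n)))"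
    have \<delta>: "0 < \<delta>" "\<delta> \<le> 1/4" using d by (auto simp: \<delta>_def)
    have near: "\<bar>h u - h 0\<bar> \<le> r/2" if "\<And>i. \<bar>u $ i\<bar> < \<delta>" for u
    proof -
      have "norm u \<le> (\<Sum>i\<in>UNIV. \<bar>u $ i\<bar>)" by (rule norm_le_l1_cart)
      also have "\<dots> \<le> (\<Sum>i\<in>(UNIV::'n set). \<delta>)" using that by (intro sum_mono) (simp add: less_imp_le)
      also have "\<dots> = CARD('n) * \<delta>" by simp
      also have "\<dots> \<le> CARD('n) * (d / (2 * CARD('n)))"
        unfolding \<delta>_def by (intro mult_left_mono) auto
      also have "\<dots> < d" using d by simp
      finally show ?thesis using d(2)[of u] by simp
    qed
    define \<rho> where "\<rho> N = (2 * real N) ^ CARD('n) * cos (pi * \<delta>) ^ (2*N)" for N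
    have \<rho>: "\<rho> \<longlonglongrightarrow> 0"
    proof -
      let ?c = "(cos (pi * \<delta>))\<^sup>2"
      have c: "0 < cos (pi * \<delta>)" using \<delta> by (intro cos_gt_zero_pi) (auto simp: field_simps intro:
          less_le_trans[of _ 0])
      have "cos (pi * \<delta>) < cos 0" using \<delta> by (intro cos_monotone_0_pi) (auto simp: field_simps)
      then have "?c < 1" using c by (simp add: abs_square_less_1)
      then have c1: "0 < ?c" "?c < 1" using c by auto
      have "(\<lambda>N. (2 * real N) ^ CARD('n) * ?c ^ N) \<longlonglongrightarrow> 0"
        using c1 by real_asymp
      then show ?thesis by (simp add: \<rho>_def[abs_def] power_mult)
    qed
    have "(\<lambda>N. 2 * M * \<rho> N) \<longlonglongrightarrow> 0" using tendsto_mult_left[OF \<rho>, of "2*M"] by simp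
    then have ev: "\<forall>\<^sub>F N in sequentially. 2 * M * \<rho> N < r/2" using r by (intro order_tendstoD) auto
    have bound: "\<bar>(\<integral>u. indicator ?Q u * h u * vec_kernel N u \<partial>lborel) - h 0\<bar>
        \<le> r/2 + 2 * M * \<rho> N" if N: "N > 0" for N
    proof -
      note iK = integral_vec_kernel[of N, where 'n='n]
      have i0: "integrable lborel (\<lambda>u. h 0 * (indicator ?Q u * vec_kernel N u))" by (intro
          integrable_mult_right iK)
      have "(\<integral>u. indicator ?Q u * h u * vec_kernel N u \<partial>lborel) - h 0
          = (\<integral>u. indicator ?Q u * h u * vec_kernel N u \<partial>lborel) - (\<integral>u. h 0 * (indicator ?Q u *
              vec_kernel N u) \<partial>lborel)"
        by (simp add: iK)
      also have "\<dots> = (\<integral>u. indicator ?Q u * h u * vec_kernel N u - h 0 * (indicator ?Q u *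
          vec_kernel N u) \<partial>lborel)"
        by (rule Bochner_Integration.integral_diff[OF int i0, symmetric])
      finally have "\<bar>(\<integral>u. indicator ?Q u * h u * vec_kernel N u \<partial>lborel) - h 0\<bar>
          \<le> (\<integral>u. \<bar>indicator ?Q u * h u * vec_kernel N u - h 0 * (indicator ?Q u * vec_kernel N u)\<bar>
              \<partial>lborel)"
        using integral_abs_bound by simp
      also have "\<dots> \<le> (\<integral>u. r/2 * (indicator ?Q u * vec_kernel N u) + 2 * M * \<rho> N * indicator ?Q u
          \<partial>lborel)"
      proof (rule integral_mono)
        show "integrable lborel (\<lambda>u. \<bar>indicator ?Q u * h u * vec_kernel N u - h 0 * (indicator ?Q
            u * vec_kernel N u)\<bar>)"
          by (intro integrable_abs Bochner_Integration.integrable_diff int i0)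
        show "integrable lborel (\<lambda>u. r/2 * (indicator ?Q u * vec_kernel N u) + 2 * M * \<rho> N *
            indicator ?Q u)"
          by (intro Bochner_Integration.integrable_add integrable_mult_right iK volQ)
        fix u :: "real^'n"
        have \<rho>0: "\<rho> N \<ge> 0" by (simp add: \<rho>_def power_mult)
        show "\<bar>indicator ?Q u * h u * vec_kernel N u - h 0 * (indicator ?Q u * vec_kernel N u)\<bar>
          \<le> r/2 * (indicator ?Q u * vec_kernel N u) + 2 * M * \<rho> N * indicator ?Q u"
        proof (cases "u \<in> ?Q")
          case False then show ?thesis by simp
        next
          case True
          have eq: "\<bar>h u * vec_kernel N u - h 0 * vec_kernel N u\<bar> = \<bar>h u - h 0\<bar> * vec_kernel N u"
            by (simp add: abs_mult vec_kernel_nonneg flip: left_diff_distrib)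
          have "\<bar>h u - h 0\<bar> * vec_kernel N u \<le> r/2 * vec_kernel N u + 2 * M * \<rho> N"
          proof (cases "\<forall>i. \<bar>u $ i\<bar> < \<delta>")
            case True
            then have "\<bar>h u - h 0\<bar> * vec_kernel N u \<le> r/2 * vec_kernel N u"
              using near by (intro mult_right_mono vec_kernel_nonneg) auto
            then show ?thesis using \<rho>0 M by (simp add: add_increasing2)
          next
            case False
            then obtain i where "\<delta> \<le> \<bar>u $ i\<bar>" by (auto simp: not_less)
            then have "vec_kernel N u \<le> \<rho> N"
              unfolding \<rho>_def using vec_kernel_le_away[OF N _ True] \<delta> by simp
            moreover have "\<bar>h u - h 0\<bar>
                \<le> 2 * M" using h(1)[of u] h(1)[of 0] h(2)[OF True] h(2)[OF Q0] by linarith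
            ultimately have "\<bar>h u - h 0\<bar> * vec_kernel N u \<le> 2 * M * \<rho> N"
              using M by (intro mult_mono vec_kernel_nonneg) auto
            then show ?thesis using r vec_kernel_nonneg[of N u] by (simp add: add_increasing)
          qed
          then show ?thesis using True eq by simp
        qed
      qed
      also have "\<dots> = r/2 + 2 * M * \<rho> N"
        by (subst Bochner_Integration.integral_add)
           (use iK volQ in \<open>simp_all\<close>)
      finally show ?thesis .
    qed
    have "\<forall>\<^sub>F N in sequentially. norm ((\<integral>u. indicator ?Q u * h u * vec_kernel N u \<partial>lborel) - h 0) < r"
      using ev eventually_gt_at_top[of 0]
    proof eventually_elim
      case (elim N) then show ?case using bound[of N] by simp
    qed
    then show "\<exists>no. \<forall>N\<ge>no. norm ((\<integral>u. indicator ?Q u * h u * vec_kernel N u \<partial>lborel) - h 0) < r"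
      by (simp add: eventually_sequentially)
  qed
qed

text \<open>
  Every point lies in exactly one integer translate of the half-open unit cell, the one around
  the vector of its rounded coordinates.
\<close>
lemma nn_integral_tiling:
  fixes g :: "real^'n::finite \<Rightarrow> ennreal"
  assumes [measurable]: "g \<in> borel_measurable borel"
  shows "(\<integral>\<^sup>+u. g u \<partial>lborel)
    = (\<integral>\<^sup>+k. (\<integral>\<^sup>+u. indicator unit_cell u * g (u + int_vec k) \<partial>lborel) \<partial>count_space UNIV)"
proof -
  let ?Q = "unit_cell :: (real^'n) set"
  have one: "(\<integral>\<^sup>+k. indicator ?Q (u - int_vec k) \<partial>count_space UNIV) = (1::ennreal)" for u
  proof -
    let ?k = "\<lambda>i. \<lfloor>u $ i + 1/2\<rfloor>"
    have iff: "u - int_vec k \<in> ?Q \<longleftrightarrow> k = ?k" for k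
    proof -
      have "u - int_vec k \<in> ?Q \<longleftrightarrow> (\<forall>i. of_int (k i) \<le> u $ i + 1/2 \<and> u $ i + 1/2 < of_int (k i) + 1)"
        unfolding unit_cell_def mem_Collect_eq
        by (intro all_cong1) auto
      also have "\<dots> \<longleftrightarrow> (\<forall>i. k i = ?k i)" by (auto simp: floor_eq_iff eq_commute[of "k _"])
      finally show ?thesis by auto
    qed
    have "(\<integral>\<^sup>+k. indicator ?Q (u - int_vec k) \<partial>count_space UNIV)
        = (\<integral>\<^sup>+k. indicator {?k} k \<partial>count_space UNIV)"
      by (intro nn_integral_cong) (simp add: indicator_def iff)
    then show ?thesis by simp
  qed
  have "(\<integral>\<^sup>+u. g u \<partial>lborel) = (\<integral>\<^sup>+u. (\<integral>\<^sup>+k. indicator ?Q (u - int_vec k) * g u \<partial>count_space UNIV) \<partial>lborel)"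
    by (simp add: nn_integral_multc one)
  also have "\<dots> = (\<integral>\<^sup>+k. (\<integral>\<^sup>+u. indicator ?Q (u - int_vec k) * g u \<partial>lborel) \<partial>count_space UNIV)"
    by (rule nn_integral_count_space_nn_integral[OF countable_int_functions]) measurable
  also have "\<dots> = (\<integral>\<^sup>+k. (\<integral>\<^sup>+u. indicator ?Q u * g (u + int_vec k) \<partial>lborel) \<partial>count_space UNIV)"
  proof (rule nn_integral_cong)
    fix k :: "'n \<Rightarrow> int"
    have "(\<integral>\<^sup>+u. indicator ?Q (u - int_vec k) * g u \<partial>lborel)
        = (\<integral>\<^sup>+u. indicator ?Q (u - int_vec k) * g u \<partial>distr lborel borel ((+) (int_vec k)))"
      by (simp add: lborel_distr_plus)
    also have "\<dots> = (\<integral>\<^sup>+u. indicator ?Q u * g (u + int_vec k) \<partial>lborel)"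
      by (subst nn_integral_distr) (auto simp: add.commute)
    finally show "(\<integral>\<^sup>+u. indicator ?Q (u - int_vec k) * g u \<partial>lborel)
        = (\<integral>\<^sup>+u. indicator ?Q u * g (u + int_vec k) \<partial>lborel)" .
  qed
  finally show ?thesis .
qed

section \<open>Poisson summation for Gaussians\<close>

text \<open>
  Cut \<open>\<real>\<^sup>n\<close> into the translates of the unit cell. The kernel is periodic, so the contribution of
  the cell around \<open>k\<close> tends to \<open>\<phi> k\<close> by the approximate identity property, and the sum over
  the cells converges by dominated convergence.
\<close>
lemma kernel_integral_tendsto:
  fixes \<phi> :: "real^'n::finite \<Rightarrow> real"
  assumes cont: "continuous_on UNIV \<phi>" and nonneg: "\<And>u. 0 \<le> \<phi> u"
    and bound: "\<And>u k. u \<in> unit_cell \<Longrightarrow> \<phi> (u + int_vec k) \<le> M k"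
    and fin: "(\<integral>\<^sup>+k. ennreal (M k) \<partial>count_space UNIV) < \<infinity>"
  shows "(\<lambda>N. \<integral>\<^sup>+u. ennreal (\<phi> u * vec_kernel N u) \<partial>lborel)
     \<longlonglongrightarrow> (\<integral>\<^sup>+k. ennreal (\<phi> (int_vec k)) \<partial>count_space UNIV)"
proof -
  let ?Q = "unit_cell :: (real^'n) set"
  have [measurable]: "\<phi> \<in> borel_measurable borel" by (rule borel_measurable_continuous_onI[OF cont])
  define b where "b N k = (\<integral>u. indicator ?Q u * \<phi> (u + int_vec k) * vec_kernel N u \<partial>lborel)" for N k
  have lim: "(\<lambda>N. b N k) \<longlonglongrightarrow> \<phi> (int_vec k)"
    and int: "integrable lborel (\<lambda>u. indicator ?Q u * \<phi> (u + int_vec k) * vec_kernel N u)" for k N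
  proof -
    have cont0: "isCont (\<lambda>u. \<phi> (u + int_vec k)) 0"
    proof -
      have "continuous_on UNIV (\<lambda>u. \<phi> (u + int_vec k))"
        by (intro continuous_on_compose2[OF cont] continuous_intros) auto
      then show ?thesis by (simp add: continuous_on_eq_continuous_at)
    qed
    have hm: "(\<lambda>u. \<phi> (u + int_vec k)) \<in> borel_measurable borel" by measurable
    have hb: "\<phi> (u + int_vec k) \<le> M k" if "u \<in> ?Q" for u using bound[OF that] .
    show "(\<lambda>N. b N k) \<longlonglongrightarrow> \<phi> (int_vec k)"
      using vec_kernel_approx_identity(1)[OF hm cont0 nonneg hb] by (simp add: b_def)
    show "integrable lborel (\<lambda>u. indicator ?Q u * \<phi> (u + int_vec k) * vec_kernel N u)"
      using vec_kernel_approx_identity(2)[OF hm cont0 nonneg hb] by simp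
  qed
  have b: "ennreal (b N k) = (\<integral>\<^sup>+u. indicator ?Q u * ennreal (\<phi> (u + int_vec k) * vec_kernel N (u +
      int_vec k)) \<partial>lborel)" for N k
  proof -
    have "ennreal (b N k) = (\<integral>\<^sup>+u. ennreal (indicator ?Q u * \<phi> (u + int_vec k) * vec_kernel N u)
        \<partial>lborel)"
      unfolding b_def by (rule nn_integral_eq_integral[symmetric, OF int]) (simp add: nonneg
          vec_kernel_nonneg)
    also have "\<dots> = (\<integral>\<^sup>+u. indicator ?Q u * ennreal (\<phi> (u + int_vec k) * vec_kernel N (u + int_vec
        k)) \<partial>lborel)"
      by (intro nn_integral_cong) (auto simp: vec_kernel_add_int indicator_def)
    finally show ?thesis .
  qed
  have bM: "ennreal (b N k) \<le> ennreal (M k)" for N k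
  proof (rule ennreal_leI)
    have "b N k \<le> (\<integral>u. M k * (indicator ?Q u * vec_kernel N u) \<partial>lborel)"
      unfolding b_def
    proof (rule integral_mono[OF int integrable_mult_right[OF integral_vec_kernel(1)]])
      show "indicator ?Q u * \<phi> (u + int_vec k) * vec_kernel N u
          \<le> M k * (indicator ?Q u * vec_kernel N u)" for u
        using bound[of u k] by (auto simp: indicator_def vec_kernel_nonneg intro!: mult_right_mono)
    qed
    then show "b N k \<le> M k" by (simp add: integral_vec_kernel)
  qed
  have eq: "(\<integral>\<^sup>+k. ennreal (b N k) \<partial>count_space UNIV)
      = (\<integral>\<^sup>+u. ennreal (\<phi> u * vec_kernel N u) \<partial>lborel)" for N
    unfolding b by (rule nn_integral_tiling[symmetric]) measurable
  have "(\<lambda>N. \<integral>\<^sup>+k. ennreal (b N k) \<partial>count_space UNIV) \<longlonglongrightarrow> (\<integral>\<^sup>+k. ennreal (\<phi> (int_vec k)) \<partial>count_space UNIV)"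
    by (rule nn_integral_dominated_convergence[where w="\<lambda>k. ennreal (M k)"])
       (use fin in \<open>simp_all add: bM lim tendsto_ennrealI\<close>)
  then show ?thesis unfolding eq .
qed

lemma vec_kernel_eq_sum:
  "complex_of_real (vec_kernel N (u::real^'n::finite))
    = (\<Sum>j\<in>PiE UNIV (\<lambda>_. {-int N..int N}). complex_of_real (\<Prod>i\<in>UNIV. kernel_coeff N (j i)) * cis (2
        * pi * (int_vec j \<bullet> u)))"
proof -
  have "complex_of_real (vec_kernel N u)
      = (\<Prod>i\<in>UNIV. \<Sum>j\<in>{-int N..int N}. complex_of_real (kernel_coeff N j) * cis (2 * pi * (of_int j
          * u $ i)))"
    by (simp add: vec_kernel_def cos_kernel_eq_sum)
  also have "\<dots> = (\<Sum>j\<in>PiE UNIV (\<lambda>_. {-int N..int N}). \<Prod>i\<in>UNIV. complex_of_real (kernel_coeff N (j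
      i)) * cis (2 * pi * (of_int (j i) * u $ i)))"
    by (rule prod_sum_PiE) auto
  also have "\<dots> = (\<Sum>j\<in>PiE UNIV (\<lambda>_. {-int N..int N}). complex_of_real (\<Prod>i\<in>UNIV. kernel_coeff N (j
      i)) * cis (2 * pi * (int_vec j \<bullet> u)))"
    by (intro sum.cong refl) (simp add: prod.distrib cis_sum[symmetric] inner_vec_def sum_distrib_left)
  finally show ?thesis .
qed

text \<open>
  The linear map \<open>f\<close> sends \<open>\<int>\<^sup>n\<close> to a lattice and the contragredient map \<open>g\<close> sends it to the dual
  lattice. Both sides are the limit of the integrals of \<open>exp (-pi |f u|\<^sup>2 / s)\<close> against the
  kernels: the left one by localization at the integer points, the right one by expanding the
  kernel into exponentials and using that its coefficients tend to \<open>1\<close>.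
\<close>
lemma poisson_gaussian:
  fixes f g :: "real^'n::finite \<Rightarrow> real^'n"
  assumes s: "s > 0" and f: "linear f" "det (matrix f) \<noteq> 0" and g: "linear g"
    and dual: "\<And>x y. g x \<bullet> f y = x \<bullet> y"
  shows "(\<integral>\<^sup>+k. ennreal (exp (- pi * (norm (f (int_vec k)))\<^sup>2 / s)) \<partial>count_space UNIV)
       = (\<integral>\<^sup>+j. ennreal (sqrt s ^ CARD('n) / \<bar>det (matrix f)\<bar> * exp (- pi * s * (norm (g (int_vec
           j)))\<^sup>2)) \<partial>count_space UNIV)"
proof -
  let ?d = "\<bar>det (matrix f)\<bar>"
  let ?c = "sqrt s ^ CARD('n) / ?d"
  let ?\<phi> = "\<lambda>u. exp (- pi * (norm (f u))\<^sup>2 / s)"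
  have c: "?c \<ge> 0" using s by simp
  have "inj f" using f det_nz_iff_inj by blast
  have "g x = 0 \<Longrightarrow> x = 0" for x using dual[of x x] by simp
  then have "inj g" using g by (simp add: linear_injective_0)
  have fin: "(\<integral>\<^sup>+k. ennreal (C * exp (- c * (\<Sum>i\<in>UNIV. \<bar>real_of_int (k i)\<bar>))) \<partial>count_space (UNIV ::
      ('n \<Rightarrow> int) set)) < \<infinity>"
    if "c > 0" "C > 0" for c C
    using abs_summable_exp_int_vec[OF that(1), where 'n='n] that
    by (simp add: abs_summable_on_def integrable_iff_bounded ennreal_mult nn_integral_cmult
        ennreal_mult_less_top)
  have contf: "continuous_on UNIV f" using f by (simp add: linear_continuous_on linear_linear)
  have lim1: "(\<lambda>N. \<integral>\<^sup>+u. ennreal (?\<phi> u * vec_kernel N u) \<partial>lborel)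
     \<longlonglongrightarrow> (\<integral>\<^sup>+k. ennreal (?\<phi> (int_vec k)) \<partial>count_space UNIV)"
  proof -
    have ps: "pi / s > 0" using s by simp
    obtain a C where C: "a > 0" "C > 0"
      "\<And>u k. \<forall>i. \<bar>u $ i\<bar> \<le> 1/2 \<Longrightarrow>
       exp (- (pi / s) * (norm (f (u + int_vec k)))\<^sup>2) \<le> C * exp (- a * (\<Sum>i\<in>UNIV. \<bar>real_of_int (k i)\<bar>))"
      using gaussian_le_exp_int_vec[OF f(1) \<open>inj f\<close> ps] by blast
    show ?thesis
    proof (rule kernel_integral_tendsto[OF _ _ _ fin[OF C(1,2)]])
      show "continuous_on UNIV ?\<phi>" by (intro continuous_intros contf) (use s in auto)
      fix u :: "real^'n" and k :: "'n \<Rightarrow> int" assume "u \<in> unit_cell"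
      then have "-1/2 \<le> u $ i \<and> u $ i < 1/2" for i unfolding unit_cell_def by auto
      then have "\<bar>u $ i\<bar> \<le> 1/2"
          for i using abs_le_iff[of "u $ i" "1/2"] by (metis less_imp_le minus_le_iff minus_divide_left)
      then have "\<forall>i. \<bar>u $ i\<bar> \<le> 1/2" by blast
      from C(3)[OF this] show "?\<phi> (u + int_vec k) \<le> C * exp (- a * (\<Sum>i\<in>UNIV. \<bar>real_of_int (k i)\<bar>))"
        by simp
    qed simp
  qed
  let ?a = "\<lambda>N j. \<Prod>i\<in>UNIV. kernel_coeff N (j i)"
  let ?e = "\<lambda>j. exp (- pi * s * (norm (g (int_vec j)))\<^sup>2)"
  have a: "0 \<le> ?a N j" "?a N j \<le> 1" for N and j :: "'n \<Rightarrow> int"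
    by (auto intro!: prod_nonneg prod_le_1 kernel_coeff_nonneg kernel_coeff_le_1)
  have lim2: "(\<lambda>N. \<integral>\<^sup>+j. ennreal (?a N j * (?c * ?e j)) \<partial>count_space UNIV)
     \<longlonglongrightarrow> (\<integral>\<^sup>+j. ennreal (?c * ?e j) \<partial>count_space UNIV)"
  proof -
    have ps: "pi * s > 0" using s by simp
    obtain b C where C: "b > 0" "C > 0"
      "\<And>u k. \<forall>i. \<bar>u $ i\<bar> \<le> 1/2 \<Longrightarrow>
       exp (- (pi * s) * (norm (g (u + int_vec k)))\<^sup>2) \<le> C * exp (- b * (\<Sum>i\<in>UNIV. \<bar>real_of_int (k i)\<bar>))"
      using gaussian_le_exp_int_vec[OF g \<open>inj g\<close> ps] by blast
    have "?e j \<le> C * exp (- b * (\<Sum>i\<in>UNIV. \<bar>real_of_int (j i)\<bar>))" for j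
      using C(3)[of 0 j] by simp
    then have "(\<integral>\<^sup>+j. ennreal (?e j) \<partial>count_space UNIV)
      \<le> (\<integral>\<^sup>+k. ennreal (C * exp (- b * (\<Sum>i\<in>UNIV. \<bar>real_of_int (k i)\<bar>))) \<partial>count_space (UNIV :: ('n \<Rightarrow>
          int) set))"
      by (intro nn_integral_mono ennreal_leI)
    also have "\<dots> < \<infinity>" by (rule fin[OF C(1,2)])
    finally have "ennreal ?c * (\<integral>\<^sup>+j. ennreal (?e j) \<partial>count_space UNIV) < \<infinity>"
      by (simp add: ennreal_mult_less_top)
    then have "(\<integral>\<^sup>+j. ennreal (?c * ?e j) \<partial>count_space UNIV) < \<infinity>"
      by (simp only: ennreal_mult'[OF c] nn_integral_cmult borel_measurable_count_space)
    moreover have "(\<lambda>N. ?a N j * (?c * ?e j)) \<longlonglongrightarrow> ?c * ?e j" for j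
    proof -
      have "(\<lambda>N. ?a N j) \<longlonglongrightarrow> (\<Prod>i\<in>(UNIV::'n set). 1)" by (intro tendsto_prod kernel_coeff_tendsto)
      from tendsto_mult_right[OF this, of "?c * ?e j"] show ?thesis by simp
    qed
    moreover have "?a N j * (?c * ?e j) \<le> ?c * ?e j" for N j
      by (rule mult_left_le_one_le) (use a c in auto)
    ultimately show ?thesis
      by (intro nn_integral_dominated_convergence[where w="\<lambda>j. ennreal (?c * ?e j)"])
         (auto intro!: tendsto_ennrealI ennreal_leI)
  qed
  have "(\<integral>\<^sup>+u. ennreal (?\<phi> u * vec_kernel N u) \<partial>lborel)
      = (\<integral>\<^sup>+j. ennreal (?a N j * (?c * ?e j)) \<partial>count_space UNIV)" for N
  proof -
    let ?F = "PiE UNIV (\<lambda>_. {-int N..int N}) :: ('n \<Rightarrow> int) set"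
    have finF: "finite ?F" by (rule finite_PiE) auto
    let ?G = "\<lambda>y x. complex_of_real (exp (- pi * (norm x)\<^sup>2 / s)) * cis (2 * pi * (y \<bullet> x)) :: complex"
    have Gm: "?G y \<in> borel_measurable borel" for y :: "real^'n"
      using borel_measurable_integrable[OF fourier_gaussian(1)[OF s, of y]] by simp
    have fm: "f \<in> borel_measurable borel" by (rule borel_measurable_continuous_onI[OF contf])
    have Gint: "integrable lborel (\<lambda>u. ?G y (f u))" for y
    proof -
      have "integrable (distr lborel borel f) (?G y)"
        unfolding distr_lborel_linear[OF f]
        using fourier_gaussian(1)[OF s, of y] Gm[of y] by (subst integrable_density) auto
      then show ?thesis using fm Gm by (subst (asm) integrable_distr_eq) auto
    qed
    have GI: "(\<integral>u. ?G (g y) (f u) \<partial>lborel)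
        = complex_of_real (?c * exp (- pi * s * (norm (g y))\<^sup>2))" for y
      by (subst integral_linear[OF f Gm], subst fourier_gaussian(2)[OF s]) (simp add:
          scaleR_conv_of_real)
    have eq: "complex_of_real (?\<phi> u * vec_kernel N u)
        = (\<Sum>j\<in>?F. complex_of_real (?a N j) * ?G (g (int_vec j)) (f u))" for u
      by (simp add: vec_kernel_eq_sum dual sum_distrib_left mult_ac del: of_real_prod)
    have int: "integrable lborel (\<lambda>u. complex_of_real (?\<phi> u * vec_kernel N u))"
      unfolding eq by (intro Bochner_Integration.integrable_sum integrable_mult_right Gint)
    have "complex_of_real (\<integral>u. ?\<phi> u * vec_kernel N u \<partial>lborel)
        = (\<integral>u. complex_of_real (?\<phi> u * vec_kernel N u) \<partial>lborel)"
      by (rule integral_complex_of_real[symmetric])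
    also have "\<dots> = (\<Sum>j\<in>?F. complex_of_real (?a N j) * complex_of_real (?c * ?e j))"
      unfolding eq by (subst Bochner_Integration.integral_sum) (simp_all only:
          integral_mult_right_zero GI integrable_mult_right Gint)
    also have "\<dots> = complex_of_real (\<Sum>j\<in>?F. ?a N j * (?c * ?e j))"
      by simp
    finally have I: "(\<integral>u. ?\<phi> u * vec_kernel N u \<partial>lborel) = (\<Sum>j\<in>?F. ?a N j * (?c * ?e j))"
      using of_real_eq_iff by blast
    have "integrable lborel (\<lambda>u. Re (complex_of_real (?\<phi> u * vec_kernel N u)))"
      using int by (rule integrable_Re)
    then have "(\<integral>\<^sup>+u. ennreal (?\<phi> u * vec_kernel N u) \<partial>lborel) = ennreal (\<Sum>j\<in>?F. ?a N j * (?c * ?e j))"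
      unfolding I[symmetric] by (intro nn_integral_eq_integral) (auto simp: vec_kernel_nonneg)
    also have "\<dots> = (\<Sum>j\<in>?F. ennreal (?a N j * (?c * ?e j)))"
      by (intro sum_ennreal[symmetric] mult_nonneg_nonneg[OF a(1) mult_nonneg_nonneg[OF c exp_ge_zero]])
    also have "\<dots> = (\<integral>\<^sup>+j. ennreal (?a N j * (?c * ?e j)) \<partial>count_space UNIV)"
    proof (rule nn_integral_count_space'[symmetric, OF finF])
      fix j :: "'n \<Rightarrow> int" assume "j \<notin> ?F"
      then obtain i where "j i \<notin> {-int N..int N}" by (auto simp: PiE_UNIV_domain Pi_iff)
      then have "\<not> \<bar>j i\<bar> \<le> int N" by (auto simp: abs_le_iff)
      then have "kernel_coeff N (j i) = 0" by (simp add: kernel_coeff_def)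
      then have "?a N j = 0" by (intro prod_zero) auto
      then show "ennreal (?a N j * (?c * ?e j)) = 0" by (simp only: mult_zero_left ennreal_0)
    qed auto
    finally show ?thesis .
  qed
  then show ?thesis using LIMSEQ_unique[OF lim1] lim2 by simp
qed

section \<open>Lattices and their theta functions\<close>

lemma nn_integral_count_space_infsum:
  fixes f :: "'a \<Rightarrow> real"
  assumes nonneg: "\<And>x. x \<in> A \<Longrightarrow> 0 \<le> f x" and fin: "(\<integral>\<^sup>+x. ennreal (f x) \<partial>count_space A) < \<infinity>"
  shows "f summable_on A" and "(\<integral>\<^sup>+x. ennreal (f x) \<partial>count_space A) = ennreal (infsum f A)"
proof -
  have "(\<integral>\<^sup>+x. ennreal (norm (f x)) \<partial>count_space A) = (\<integral>\<^sup>+x. ennreal (f x) \<partial>count_space A)"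
    by (intro nn_integral_cong) (simp add: nonneg)
  then have abs: "Infinite_Set_Sum.abs_summable_on f A"
    using fin by (simp add: abs_summable_on_def integrable_iff_bounded)
  then show "f summable_on A" using abs_summable_equivalent abs_summable_summable by blast
  show "(\<integral>\<^sup>+x. ennreal (f x) \<partial>count_space A) = ennreal (infsum f A)"
    using nn_integral_conv_infsetsum[OF abs nonneg] infsetsum_infsum[OF abs] by simp
qed

text \<open>
  This form of a lattice is used from here on: sums over the lattice become sums over integer
  vectors, and the covolume becomes the Jacobian determinant of \<open>f\<close>.
\<close>
lemma lattice_as_linear_image:
  fixes L :: "(real^'n::finite) set"
  assumes "L \<in> lattices"
  shows "\<exists>f. linear f \<and> det (matrix f) \<noteq> 0 \<and> L = range (\<lambda>k. f (int_vec k)) \<and> covolume L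
      = \<bar>det (matrix f)\<bar>"
proof -
  obtain v where v: "basis_family v" "L = int_span v" using assms unfolding lattices_def by blast
  define f where "f u = (\<Sum>i\<in>UNIV. (u $ i) *\<^sub>R v i)" for u :: "real^'n"
  have "linear f"
    by (rule linearI) (auto simp: f_def algebra_simps sum.distrib scaleR_sum_right)
  moreover have "matrix f = transpose (\<chi> i. v i)"
    by (simp add: matrix_def f_def vec_eq_iff transpose_def axis_def if_distrib[of "\<lambda>x. x * _"]
        cong: if_cong)
  then have det: "det (matrix f) = det (\<chi> i. v i)" by (simp add: det_transpose)
  moreover have "det (\<chi> i. v i) \<noteq> 0"
  proof -
    have "rows (\<chi> i. v i) = range v"
      by (auto simp: rows_def row_def vec_lambda_eta)
    then have "span (rows (\<chi> i. v i)) = UNIV"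
      using v by (simp add: basis_family_def)
    then show ?thesis
      by (metis invertible_det_nz invertible_left_inverse matrix_left_invertible_span_rows)
  qed
  moreover have "L = range (\<lambda>k. f (int_vec k))"
    by (simp add: v int_span_def f_def)
  moreover have "covolume L = \<bar>det (matrix f)\<bar>"
    using covolume_int_span[OF v(1)] v(2) det by simp
  ultimately show ?thesis by metis
qed

lemma bij_betw_linear_int_vec:
  assumes "linear f" "det (matrix f) \<noteq> 0"
  shows "bij_betw (\<lambda>k. f (int_vec k)) UNIV (range (\<lambda>k. f (int_vec k)))"
proof -
  have "inj f" using assms det_nz_iff_inj by blast
  moreover have "inj int_vec"
    by (rule injI) (simp add: vec_eq_iff fun_eq_iff)
  ultimately have "inj (\<lambda>k. f (int_vec k))" using inj_compose[of f int_vec] by (simp add: o_def)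
  then show ?thesis by (rule inj_on_imp_bij_betw)
qed

lemma countable_lattice:
  assumes "L \<in> lattices"
  shows "countable L"
  using lattice_as_linear_image[OF assms] countable_int_functions by (metis countable_image)

lemma lattice_exp_norm_finite:
  fixes L :: "(real^'n::finite) set"
  assumes L: "L \<in> lattices" and c: "c > 0"
  shows "(\<integral>\<^sup>+p. ennreal (exp (- c * norm p)) \<partial>count_space L) < \<infinity>"
proof -
  obtain f where f: "linear f" "det (matrix f) \<noteq> 0" "L = range (\<lambda>k. f (int_vec k))"
    using lattice_as_linear_image[OF L] by blast
  have "inj f" using f det_nz_iff_inj by blast
  then obtain B where B: "B > 0" "\<And>x. B * norm x \<le> norm (f x)"
    using linear_inj_bounded_below_pos[OF f(1)] by blast
  define b where "b = c * B / CARD('n)"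
  have b: "b > 0" using c B by (simp add: b_def)
  have le: "exp (- c * norm (f (int_vec k))) \<le> exp (- b * (\<Sum>i\<in>UNIV. \<bar>real_of_int (k i)\<bar>))" for k
  proof -
    have "(\<Sum>i\<in>UNIV. \<bar>real_of_int (k i)\<bar>) \<le> real CARD('n) * norm (int_vec k)"
      using component_le_norm_cart[of "int_vec k"] by (intro sum_bounded_above) simp
    then have "b * (\<Sum>i\<in>UNIV. \<bar>real_of_int (k i)\<bar>) \<le> b * (real CARD('n) * norm (int_vec k))"
      using b by (intro mult_left_mono) auto
    also have "\<dots> = c * (B * norm (int_vec k))" by (simp add: b_def)
    also have "\<dots> \<le> c * norm (f (int_vec k))" using c B(2) by (intro mult_left_mono) auto
    finally show ?thesis by simp
  qed
  have "(\<integral>\<^sup>+p. ennreal (exp (- c * norm p)) \<partial>count_space L)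
      = (\<integral>\<^sup>+k. ennreal (exp (- c * norm (f (int_vec k)))) \<partial>count_space UNIV)"
    unfolding f(3) by (rule nn_integral_bij_count_space[OF bij_betw_linear_int_vec[OF f(1,2)],
        symmetric])
  also have "\<dots> \<le> (\<integral>\<^sup>+k. ennreal (exp (- b * (\<Sum>i\<in>UNIV. \<bar>real_of_int (k i)\<bar>))) \<partial>count_space (UNIV ::
      ('n \<Rightarrow> int) set))"
    by (intro nn_integral_mono ennreal_leI le)
  also have "\<dots> < \<infinity>"
    using abs_summable_exp_int_vec[OF b, where 'n='n]
    by (simp add: abs_summable_on_def integrable_iff_bounded)
  finally show ?thesis .
qed

text \<open>
  The theta series with values in the extended nonnegative reals, for arbitrary sets of
  vectors. The terms of a lattice without the origin occur in the interaction.
\<close>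
definition theta_sum :: "(real^'n::finite) set \<Rightarrow> real \<Rightarrow> ennreal" where
  "theta_sum A s = (\<integral>\<^sup>+p. ennreal (exp (- pi * s * (norm p)\<^sup>2)) \<partial>count_space A)"

text \<open>
  From \<open>r\<^sup>2 \<ge> r - 1/4\<close>, the Gaussian is dominated by an exponential of the norm.
\<close>
lemma theta_sum_finite:
  assumes L: "L \<in> lattices" and s: "s > 0"
  shows "theta_sum L s < \<infinity>"
proof -
  have "exp (- pi * s * (norm p)\<^sup>2) \<le> exp (pi * s / 4) * exp (- (pi * s) * norm p)" for p :: "real^'n"
  proof -
    have "0 \<le> (norm p - 1/2)\<^sup>2" by simp
    then have "norm p - 1/4 \<le> (norm p)\<^sup>2" by (simp add: power2_diff power2_eq_square[of "1/2"])
    then have "(pi * s) * (norm p - 1/4) \<le> (pi * s) * (norm p)\<^sup>2" using s by (intro mult_left_mono) auto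
    then show ?thesis by (simp add: algebra_simps flip: exp_add)
  qed
  then have "theta_sum L s \<le> (\<integral>\<^sup>+p. ennreal (exp (pi * s / 4)) * ennreal (exp (- (pi * s) * norm
      p)) \<partial>count_space L)"
    unfolding theta_sum_def by (intro nn_integral_mono) (simp flip: ennreal_mult')
  also have "\<dots> < \<infinity>"
    using lattice_exp_norm_finite[OF L, of "pi * s"] s by (simp add: nn_integral_cmult
        ennreal_mult_less_top)
  finally show ?thesis .
qed

lemma theta_sum_eq:
  assumes "L \<in> lattices" "s > 0"
  shows "theta_sum L s = ennreal (lattice_theta L s)"
  unfolding theta_sum_def lattice_theta_def
  using nn_integral_count_space_infsum(2)[of L] theta_sum_finite[OF assms] by (simp add: theta_sum_def)

lemma lattice_theta_nonneg: "0 \<le> lattice_theta L s"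
  unfolding lattice_theta_def by (rule infsum_nonneg) simp

lemma zero_in_lattice: "L \<in> lattices \<Longrightarrow> 0 \<in> L"
  unfolding lattices_def int_span_def by (auto intro!: image_eqI[of _ _ "\<lambda>_. 0"])

lemma theta_sum_remove_0:
  assumes "0 \<in> L"
  shows "theta_sum L s = 1 + theta_sum (L - {0}) s"
proof -
  let ?f = "\<lambda>p::real^'n. ennreal (exp (- pi * s * (norm p)\<^sup>2))"
  have "theta_sum L s = (\<integral>\<^sup>+p. ?f p * indicator {0} p + ?f p * indicator (L - {0}) p \<partial>count_space L)"
    unfolding theta_sum_def by (intro nn_integral_cong) (auto simp: indicator_def)
  also have "\<dots> = (\<integral>\<^sup>+p. ?f p * indicator {0} p \<partial>count_space L) + (\<integral>\<^sup>+p. ?f p * indicator (L - {0}) p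
      \<partial>count_space L)"
    by (rule nn_integral_add) auto
  also have "(\<integral>\<^sup>+p. ?f p * indicator {0} p \<partial>count_space L) = 1"
    using assms by (subst nn_integral_indicator_finite) auto
  also have "(\<integral>\<^sup>+p. ?f p * indicator (L - {0}) p \<partial>count_space L) = theta_sum (L - {0}) s"
    unfolding theta_sum_def by (subst (1 2) nn_integral_count_space_indicator)
      (auto intro!: nn_integral_cong simp: indicator_def)
  finally show ?thesis .
qed

lemma theta_sum_nonzero_eq:
  assumes "L \<in> lattices" "s > 0"
  shows "theta_sum (L - {0}) s = ennreal (lattice_theta L s - 1)" and "1 \<le> lattice_theta L s"
proof -
  have eq: "ennreal (lattice_theta L s) = 1 + theta_sum (L - {0}) s"
    using theta_sum_eq[OF assms] theta_sum_remove_0[OF zero_in_lattice[OF assms(1)], of s] by simp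
  then have "ennreal 1 \<le> ennreal (lattice_theta L s)" by simp
  then show ge: "1 \<le> lattice_theta L s" by (subst (asm) ennreal_le_iff) (simp_all add:
      lattice_theta_nonneg)
  have "1 + theta_sum (L - {0}) s = 1 + ennreal (lattice_theta L s - 1)"
    using eq ge by (simp flip: ennreal_1 ennreal_plus)
  then show "theta_sum (L - {0}) s = ennreal (lattice_theta L s - 1)" by simp
qed

section \<open>Duality of theta functions\<close>

text \<open>
  The map \<open>g\<close> is the adjoint of the inverse of \<open>f\<close>. The coordinates of \<open>y\<close> with respect to \<open>g\<close> are
  the inner products of \<open>y\<close> with the basis vectors of the lattice, so they are integers exactly
  if \<open>y\<close> lies in the dual lattice.
\<close>
lemma dual_lattice_linear_image:
  fixes f :: "real^'n::finite \<Rightarrow> real^'n"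
  assumes f: "linear f" "det (matrix f) \<noteq> 0"
  shows "\<exists>g. linear g \<and> det (matrix g) \<noteq> 0 \<and> (\<forall>x y. g x \<bullet> f y = x \<bullet> y)
     \<and> dual_lattice (range (\<lambda>k. f (int_vec k))) = range (\<lambda>k. g (int_vec k))"
proof -
  have "inj f" using f det_nz_iff_inj by blast
  then obtain h where h: "linear h" "\<And>x. h (f x) = x" "\<And>x. f (h x) = x"
    using linear_injective_isomorphism[OF f(1)] by blast
  define g where "g = adjoint h"
  have "linear g" unfolding g_def by (rule adjoint_linear[OF h(1)])
  have gh: "g x \<bullet> z = x \<bullet> h z" for x z
    using adjoint_works[OF h(1), of z x] by (simp add: g_def inner_commute)
  then have gf: "g x \<bullet> f y = x \<bullet> y" for x y by (simp add: h)
  have "g x = 0 \<Longrightarrow> x = 0" for x using gf[of x x] by simp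
  then have "inj g" using \<open>linear g\<close> by (simp add: linear_injective_0)
  have "dual_lattice (range (\<lambda>k. f (int_vec k))) = range (\<lambda>k. g (int_vec k))"
  proof (intro equalityI subsetI)
    fix y assume y: "y \<in> dual_lattice (range (\<lambda>k. f (int_vec k)))"
    have "y \<bullet> f (axis i 1) \<in> \<int>" for i
    proof -
      have "axis i 1 = int_vec (\<lambda>j. if j = i then 1 else 0)" by (auto simp: vec_eq_iff axis_def)
      then show ?thesis using y unfolding dual_lattice_def by auto
    qed
    then have "\<forall>i. \<exists>k. y \<bullet> f (axis i 1) = of_int k" unfolding Ints_def by blast
    then obtain k where k: "\<And>i. y \<bullet> f (axis i 1) = of_int (k i)" by metis
    have "adjoint f y = int_vec k"
      using adjoint_works[OF f(1), of "axis _ 1" y]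
      by (simp add: vec_eq_iff k[symmetric] inner_axis' inner_commute)
    moreover have "y = g (adjoint f y)"
    proof (rule vector_eq_rdot[THEN iffD1], rule allI)
      fix z
      have "g (adjoint f y) \<bullet> z = h z \<bullet> adjoint f y" by (subst gh) (rule inner_commute)
      also have "\<dots> = y \<bullet> z" using adjoint_works[OF f(1), of "h z" y] by (simp add: h inner_commute)
      finally show "y \<bullet> z = g (adjoint f y) \<bullet> z" by simp
    qed
    ultimately show "y \<in> range (\<lambda>k. g (int_vec k))" by auto
  next
    have "g (int_vec k) \<bullet> f (int_vec l) \<in> \<int>" for k l
      unfolding gf by (auto simp: inner_vec_def intro!: Ints_sum Ints_mult)
    moreover fix y assume "y \<in> range (\<lambda>k. g (int_vec k))"
    ultimately show "y \<in> dual_lattice (range (\<lambda>k. f (int_vec k)))"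
      unfolding dual_lattice_def by blast
  qed
  moreover have "det (matrix g) \<noteq> 0" using \<open>inj g\<close> \<open>linear g\<close> det_nz_iff_inj by blast
  ultimately show ?thesis using \<open>linear g\<close> gf by blast
qed

lemma linear_image_lattice:
  fixes g :: "real^'n::finite \<Rightarrow> real^'n"
  assumes g: "linear g" "det (matrix g) \<noteq> 0"
  shows "range (\<lambda>k. g (int_vec k)) \<in> lattices"
proof -
  have "inj g" "surj g" using g det_nz_iff_inj linear_injective_imp_surjective by blast+
  let ?v = "\<lambda>i. g (axis i 1)"
  have rv: "range ?v = g ` Basis" by (auto simp: Basis_vec_eq)
  have "inj ?v" by (rule injI) (use injD[OF \<open>inj g\<close>] in \<open>fastforce simp: axis_eq_axis\<close>)
  moreover have "independent (range ?v)"
    unfolding rv by (rule linear_independent_injective_image) (use g \<open>inj g\<close> independent_Basis in auto)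
  moreover have "span (range ?v) = UNIV"
    unfolding rv using linear_span_image[OF g(1)] \<open>surj g\<close> by (metis span_Basis)
  moreover have "g (int_vec k) = (\<Sum>i\<in>UNIV. of_int (k i) *\<^sub>R ?v i)" for k
  proof -
    have "int_vec k = (\<Sum>i\<in>UNIV. of_int (k i) *\<^sub>R axis i 1)"
      by (simp add: vec_eq_iff axis_def if_distrib[of "\<lambda>x. _ * x"] cong: if_cong)
    then show ?thesis using g by (simp add: linear_sum linear_scale)
  qed
  ultimately show ?thesis unfolding lattices_def basis_family_def int_span_def by fastforce
qed

text \<open>
  The functional equation of the theta function, from Poisson summation for the Gaussian
  \<open>exp (-pi |x|\<^sup>2 / s)\<close>.
\<close>
lemma lattice_theta_dual:
  fixes L :: "(real^'n::finite) set"
  assumes L: "L \<in> lattices" and s: "s > 0"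
  shows "dual_lattice L \<in> lattices"
    and "covolume L > 0"
    and "lattice_theta (dual_lattice L) s = covolume L / sqrt s ^ CARD('n) * lattice_theta L (1 / s)"
proof -
  obtain f where f: "linear f" "det (matrix f) \<noteq> 0" "L = range (\<lambda>k. f (int_vec k))" "covolume L
      = \<bar>det (matrix f)\<bar>"
    using lattice_as_linear_image[OF L] by blast
  obtain g where g: "linear g" "det (matrix g) \<noteq> 0" "\<And>x y. g x \<bullet> f y = x \<bullet> y"
     "dual_lattice L = range (\<lambda>k. g (int_vec k))"
    using dual_lattice_linear_image[OF f(1,2)] unfolding f(3) by blast
  show D: "dual_lattice L \<in> lattices" unfolding g(4) by (rule linear_image_lattice[OF g(1,2)])
  show "covolume L > 0" using f by simp
  let ?c = "sqrt s ^ CARD('n) / covolume L"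
  have c: "?c > 0" using f s by simp
  have "theta_sum L (1/s) = (\<integral>\<^sup>+k. ennreal (exp (- pi * (norm (f (int_vec k)))\<^sup>2 / s)) \<partial>count_space UNIV)"
    unfolding theta_sum_def f(3)
    by (subst nn_integral_bij_count_space[OF bij_betw_linear_int_vec[OF f(1,2)], symmetric]) simp
  also have "\<dots> = (\<integral>\<^sup>+j. ennreal (?c * exp (- pi * s * (norm (g (int_vec j)))\<^sup>2)) \<partial>count_space UNIV)"
    unfolding f(4) by (rule poisson_gaussian[OF s f(1,2) g(1,3)])
  also have "\<dots> = ennreal ?c * theta_sum (dual_lattice L) s"
    unfolding theta_sum_def g(4) using c
    by (subst nn_integral_bij_count_space[OF bij_betw_linear_int_vec[OF g(1,2)], symmetric])
       (simp only: ennreal_mult'[OF less_imp_le] nn_integral_cmult borel_measurable_count_space)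
  finally have "ennreal (lattice_theta L (1/s)) = ennreal (?c * lattice_theta (dual_lattice L) s)"
    using s by (simp only: theta_sum_eq L D ennreal_mult'[OF less_imp_le[OF c]] zero_less_divide_1_iff)
  then have "lattice_theta L (1/s) = ?c * lattice_theta (dual_lattice L) s"
    by (subst (asm) ennreal_inj) (intro mult_nonneg_nonneg less_imp_le[OF c] lattice_theta_nonneg)+
  then show "lattice_theta (dual_lattice L) s
      = covolume L / sqrt s ^ CARD('n) * lattice_theta L (1 / s)"
    using c f s by (simp add: field_simps)
qed

section \<open>Yukawa potentials as mixtures of Gaussians\<close>

abbreviation gauss_cdf :: "real \<Rightarrow> real" where
  "gauss_cdf \<equiv> cdf std_normal_distribution"

text \<open>
  The distribution function differs from an arbitrary antiderivative of the density by a
  constant. It is the preferred antiderivative because its limits at both ends are known.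
\<close>
lemma gauss_cdf_deriv: "DERIV gauss_cdf y :> std_normal_density y"
proof -
  interpret real_distribution std_normal_distribution by (rule real_dist_normal_dist)
  have cont: "isCont std_normal_density x" for x
    unfolding std_normal_density_def by (intro continuous_intros) auto
  obtain F where "\<forall>x. -\<infinity> < ereal x \<longrightarrow> ereal x
      < \<infinity> \<longrightarrow> (F has_vector_derivative std_normal_density x) (at x)"
    using einterval_antiderivative[of "-\<infinity>" \<infinity> std_normal_density] cont by auto
  then have F: "DERIV F x :> std_normal_density x" for x
    by (simp add: has_real_derivative_iff_has_vector_derivative)
  have diff: "gauss_cdf b - gauss_cdf a = F b - F a" if "a < b" for a b
  proof -
    have "gauss_cdf b - gauss_cdf a = measure std_normal_distribution {a<..b}"
      by (rule cdf_diff_eq[OF that])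
    also have "ennreal \<dots> = emeasure std_normal_distribution {a<..b}"
      by (simp add: emeasure_eq_measure)
    also have "\<dots> = (\<integral>\<^sup>+x. ennreal (std_normal_density x) * indicator {a<..b} x \<partial>lborel)"
      by (subst emeasure_density) auto
    also have "\<dots> = (\<integral>\<^sup>+x. ennreal (std_normal_density x) * indicator {a..b} x \<partial>lborel)"
      using AE_lborel_singleton[of a] by (intro nn_integral_cong_AE) (auto simp: indicator_def)
    also have "\<dots> = ennreal (F b - F a)"
      by (rule nn_integral_FTC_Icc) (use that F in auto)
    finally have "ennreal (gauss_cdf b - gauss_cdf a) = ennreal (F b - F a)" .
    moreover have "F a \<le> F b"
      by (rule DERIV_nonneg_imp_nondecreasing) (use that F in \<open>auto intro: normal_density_nonneg\<close>)
    moreover have "gauss_cdf a \<le> gauss_cdf b" using that by (intro cdf_nondecreasing) simp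
    ultimately show ?thesis by (subst (asm) ennreal_inj) auto
  qed
  define d where "d = gauss_cdf 0 - F 0"
  have eq: "gauss_cdf x = F x + d" for x
    unfolding d_def using diff[of 0 x] diff[of x 0] by (cases x "0::real" rule: linorder_cases) simp_all
  have "DERIV (\<lambda>x. F x + d) y :> std_normal_density y"
    using F[of y] by (auto intro!: derivative_eq_intros)
  then show ?thesis unfolding eq[abs_def, symmetric] .
qed

lemma gauss_cdf_lim:
  shows "(gauss_cdf \<longlongrightarrow> 1) at_top" and "(gauss_cdf \<longlongrightarrow> 0) at_bot"
proof -
  interpret real_distribution std_normal_distribution by (rule real_dist_normal_dist)
  show "(gauss_cdf \<longlongrightarrow> 1) at_top" "(gauss_cdf \<longlongrightarrow> 0) at_bot"
    by (rule cdf_lim_at_top_prob cdf_lim_at_bot)+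
qed

text \<open>
  The integrand whose mixture over \<open>s > 0\<close> is the Yukawa potential \<open>exp (-c r) / r\<close>: a weight
  depending on \<open>c\<close> and \<open>s\<close>, times the Gaussian \<open>exp (-pi s r\<^sup>2)\<close>.
\<close>
definition mixing_density :: "real \<Rightarrow> real \<Rightarrow> real \<Rightarrow> real" where
  "mixing_density c r s = exp (- c\<^sup>2 / (4 * pi * s)) * exp (- pi * s * r\<^sup>2) / sqrt s"

text \<open>
  The integrand has an elementary antiderivative in terms of the normal distribution function
  \<open>\<Phi>\<close>, namely \<open>exp (c r) \<Phi>(a \<surd>s + b / \<surd>s) + exp (-c r) \<Phi>(a \<surd>s - b / \<surd>s)\<close> divided by \<open>r\<close>, where
  \<open>a b = c r\<close>. At infinity both arguments tend to infinity. At \<open>0\<close> the first one tends to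
  infinity and the second one to minus infinity, so the difference of the limits is
  \<open>exp (-c r) / r\<close>.
\<close>
lemma gaussian_mixture:
  assumes r: "r > 0" and c: "c > 0"
  shows "(\<integral>\<^sup>+s\<in>{0<..}. ennreal (mixing_density c r s) \<partial>lborel) = ennreal (exp (- c * r) / r)"
proof -
  define a where "a = r * sqrt (2 * pi)"
  define b where "b = c / sqrt (2 * pi)"
  have ab: "a > 0" "b > 0" "a * b = c * r" "a\<^sup>2 = 2 * pi * r\<^sup>2" "b\<^sup>2 = c\<^sup>2 / (2 * pi)"
    using r c by (auto simp: a_def b_def power_mult_distrib power_divide)
  define H where "H s = (exp (c * r) * gauss_cdf (a * sqrt s + b / sqrt s) + exp (- (c * r)) *
      gauss_cdf (a * sqrt s - b / sqrt s)) / r" for s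
  have der: "DERIV H s :> mixing_density c r s" if s: "s > 0" for s
  proof -
    have sq: "sqrt s > 0" "sqrt s * sqrt s = s" using s by auto
    have d1: "((\<lambda>s. a * sqrt s + b / sqrt s) has_real_derivative (a / (2 * sqrt s) - b / (2 * s *
        sqrt s))) (at s)"
      using s by (auto intro!: derivative_eq_intros simp: field_simps)
    have d2: "((\<lambda>s. a * sqrt s - b / sqrt s) has_real_derivative (a / (2 * sqrt s) + b / (2 * s *
        sqrt s))) (at s)"
      using s by (auto intro!: derivative_eq_intros simp: field_simps)
    have e1: "exp (c * r) * std_normal_density (a * sqrt s + b / sqrt s)
        = exp (- c\<^sup>2 / (4 * pi * s)) * exp (- pi * s * r\<^sup>2) / sqrt (2 * pi)"
    proof -
      have "(a * sqrt s + b / sqrt s)\<^sup>2 = a\<^sup>2 * s + b\<^sup>2 / s + 2 * (a * b)"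
        using sq s by (simp add: power2_sum power_mult_distrib power_divide)
      then have "c * r - (a * sqrt s + b / sqrt s)\<^sup>2 / 2 = - c\<^sup>2 / (4 * pi * s) + - pi * s * r\<^sup>2"
        unfolding ab(3-5) by (simp add: field_simps)
      then show ?thesis unfolding std_normal_density_def by (simp flip: exp_add)
    qed
    have e2: "exp (- (c * r)) * std_normal_density (a * sqrt s - b / sqrt s)
        = exp (- c\<^sup>2 / (4 * pi * s)) * exp (- pi * s * r\<^sup>2) / sqrt (2 * pi)"
    proof -
      have "(a * sqrt s - b / sqrt s)\<^sup>2 = a\<^sup>2 * s + b\<^sup>2 / s - 2 * (a * b)"
        using sq s by (simp add: power2_diff power_mult_distrib power_divide)
      then have "- (c * r) - (a * sqrt s - b / sqrt s)\<^sup>2 / 2 = - c\<^sup>2 / (4 * pi * s) + - pi * s * r\<^sup>2"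
        unfolding ab(3-5) by (simp add: field_simps)
      then show ?thesis unfolding std_normal_density_def by (simp flip: exp_add)
    qed
    have "DERIV H s :> (exp (c * r) * (std_normal_density (a * sqrt s + b / sqrt s) * (a / (2 *
        sqrt s) - b / (2 * s * sqrt s)))
       + exp (- (c * r)) * (std_normal_density (a * sqrt s - b / sqrt s) * (a / (2 * sqrt s) + b /
           (2 * s * sqrt s)))) / r"
      unfolding H_def
      by (intro DERIV_cdivide DERIV_add DERIV_cmult DERIV_chain2[OF gauss_cdf_deriv] d1 d2)
    also have "(exp (c * r) * (std_normal_density (a * sqrt s + b / sqrt s) * (a / (2 * sqrt s) -
        b / (2 * s * sqrt s)))
       + exp (- (c * r)) * (std_normal_density (a * sqrt s - b / sqrt s) * (a / (2 * sqrt s) + b /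
           (2 * s * sqrt s)))) / r
      = (exp (- c\<^sup>2 / (4 * pi * s)) * exp (- pi * s * r\<^sup>2) / sqrt (2 * pi)) * (a / sqrt s) / r"
      unfolding mult.assoc[symmetric] e1 e2 unfolding distrib_left[symmetric] by simp
    also have "\<dots> = mixing_density c r s" using r by (simp add: mixing_density_def a_def)
    finally show ?thesis .
  qed
  have cont: "isCont (mixing_density c r) s" if "s > 0" for s
    unfolding mixing_density_def using that by (intro continuous_intros) auto
  have l1: "(H \<longlongrightarrow> (exp (c * r) * 1 + exp (- (c * r)) * 1) / r) at_top"
  proof -
    have "filterlim (\<lambda>s. a * sqrt s + b / sqrt s) at_top at_top" "filterlim (\<lambda>s. a * sqrt s - b /
        sqrt s) at_top at_top"
      using ab(1,2) by real_asymp+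
    from this[THEN filterlim_compose[OF gauss_cdf_lim(1)]] show ?thesis
      unfolding H_def using r by (intro tendsto_intros) auto
  qed
  have l0: "(H \<longlongrightarrow> (exp (c * r) * 1 + exp (- (c * r)) * 0) / r) (at_right 0)"
  proof -
    have "filterlim (\<lambda>s. a * sqrt s + b / sqrt s) at_top (at_right 0)" "filterlim (\<lambda>s. a * sqrt s
        - b / sqrt s) at_bot (at_right 0)"
      using ab(1,2) by real_asymp+
    from filterlim_compose[OF gauss_cdf_lim(1) this(1)] filterlim_compose[OF gauss_cdf_lim(2)
        this(2)] show ?thesis
      unfolding H_def using r by (intro tendsto_intros) auto
  qed
  have nonneg: "0 \<le> mixing_density c r s" if "s > 0" for s using that by (simp add: mixing_density_def)
  have FTC: "set_integrable lborel (einterval 0 \<infinity>) (mixing_density c r)"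
    "(LBINT s=0..\<infinity>. mixing_density c r s)
        = (exp (c * r) * 1 + exp (- (c * r)) * 1) / r - (exp (c * r) * 1 + exp (- (c * r)) * 0) / r"
    by (rule interval_integral_FTC_nonneg[of 0 \<infinity> H];
        use der cont nonneg l1 l0 in \<open>auto simp: zero_ereal_def ereal_tendsto_simps\<close>)+
  have ei: "einterval 0 \<infinity> = {0<..}" by (auto simp: einterval_def zero_ereal_def)
  have "(\<integral>\<^sup>+s\<in>{0<..}. ennreal (mixing_density c r s) \<partial>lborel)
      = (\<integral>\<^sup>+s. ennreal (indicator {0<..} s *\<^sub>R mixing_density c r s) \<partial>lborel)"
    by (intro nn_integral_cong) (auto simp: indicator_def)
  also have "\<dots> = ennreal (\<integral>s. indicator {0<..} s *\<^sub>R mixing_density c r s \<partial>lborel)"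
    using FTC(1) nonneg unfolding ei set_integrable_def by (intro nn_integral_eq_integral) (auto
        simp: indicator_def)
  also have "(\<integral>s. indicator {0<..} s *\<^sub>R mixing_density c r s \<partial>lborel) = exp (- c * r) / r"
    using FTC(2) by (simp add: interval_lebesgue_integral_def ei set_lebesgue_integral_def
        diff_divide_distrib[symmetric])
  finally show ?thesis .
qed

section \<open>The interaction of two lattices\<close>

lemma borel_measurable_nn_integral_count_space:
  fixes f :: "'i \<Rightarrow> 'a \<Rightarrow> ennreal"
  assumes "countable I" and [measurable]: "\<And>i. i \<in> I \<Longrightarrow> f i \<in> borel_measurable M"
  shows "(\<lambda>x. \<integral>\<^sup>+i. f i x \<partial>count_space I) \<in> borel_measurable M"
proof (cases "finite I")
  case True
  then show ?thesis by (simp add: nn_integral_count_space_finite)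
next
  case False
  then have ne: "I \<noteq> {}" by auto
  note * = bij_betw_from_nat_into[OF \<open>countable I\<close> False]
  have "(\<integral>\<^sup>+i. f i x \<partial>count_space I) = (\<Sum>n. f (from_nat_into I n) x)" for x
    by (simp add: nn_integral_bij_count_space[symmetric, OF *] nn_integral_count_space_nat)
  moreover have "f (from_nat_into I n) \<in> borel_measurable M" for n
    using from_nat_into[OF ne] by simp
  ultimately show ?thesis by simp
qed

lemma nonzero_lattice_vector:
  fixes L :: "(real^'n::finite) set"
  assumes "L \<in> lattices"
  shows "L - {0} \<noteq> {}"
proof -
  obtain f where f: "linear f" "det (matrix f) \<noteq> 0" "L = range (\<lambda>k. f (int_vec k))"
    using lattice_as_linear_image[OF assms] by blast
  have "inj f" using f det_nz_iff_inj by blast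
  moreover have "int_vec (\<lambda>_. 1) \<noteq> (0 :: real^'n)" by (simp add: vec_eq_iff)
  ultimately have "f (int_vec (\<lambda>_. 1)) \<noteq> 0" using f(1) by (metis linear_injective_0)
  then show ?thesis using f(3) by blast
qed

lemma lattice_min_norm:
  fixes L :: "(real^'n::finite) set"
  assumes "L \<in> lattices"
  shows "\<exists>\<rho>>0. \<forall>p\<in>L - {0}. \<rho> \<le> norm p"
proof -
  obtain f where f: "linear f" "det (matrix f) \<noteq> 0" "L = range (\<lambda>k. f (int_vec k))"
    using lattice_as_linear_image[OF assms] by blast
  have "inj f" using f det_nz_iff_inj by blast
  then obtain B where B: "B > 0" "\<And>x. B * norm x \<le> norm (f x)"
    using linear_inj_bounded_below_pos[OF f(1)] by blast
  have "B \<le> norm p" if p: "p \<in> L - {0}" for p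
  proof -
    obtain k where k: "p = f (int_vec k)" "p \<noteq> 0" using p f(3) by auto
    then have "int_vec k \<noteq> 0" using f(1) linear_0 by metis
    then obtain i where i: "k i \<noteq> 0" by (auto simp: vec_eq_iff)
    then have "1 \<le> \<bar>real_of_int (k i)\<bar>" by linarith
    also have "\<dots> \<le> norm (int_vec k)" using component_le_norm_cart[of "int_vec k" i] by simp
    finally have "B * 1 \<le> B * norm (int_vec k)" using B(1) by (intro mult_left_mono) auto
    then show ?thesis using B(2)[of "int_vec k"] k by simp
  qed
  then show ?thesis using B(1) by blast
qed

lemma lattice_exp_over_norm_finite:
  fixes L :: "(real^'n::finite) set"
  assumes L: "L \<in> lattices" and c: "c > 0"
  shows "(\<integral>\<^sup>+p. ennreal (exp (- c * norm p) / norm p) \<partial>count_space (L - {0})) < \<infinity>"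
proof -
  obtain \<rho> where \<rho>: "\<rho> > 0" "\<And>p. p \<in> L - {0} \<Longrightarrow> \<rho> \<le> norm p"
    using lattice_min_norm[OF L] by blast
  have "(\<integral>\<^sup>+p. ennreal (exp (- c * norm p) / norm p) \<partial>count_space (L - {0}))
     \<le> (\<integral>\<^sup>+p. ennreal (1 / \<rho>) * ennreal (exp (- c * norm p)) \<partial>count_space (L - {0}))"
  proof (rule nn_integral_mono)
    fix p assume "p \<in> space (count_space (L - {0}))"
    then have "\<rho> \<le> norm p" using \<rho>(2) by simp
    then have "exp (- c * norm p) / norm p \<le> 1 / \<rho> * exp (- c * norm p)"
      using \<rho>(1) frac_le[of "exp (- c * norm p)" "exp (- c * norm p)" \<rho> "norm p"] by simp
    then show "ennreal (exp (- c * norm p) / norm p) \<le> ennreal (1 / \<rho>) * ennreal (exp (- c * norm p))"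
      using \<rho>(1) by (simp add: ennreal_leI flip: ennreal_mult')
  qed
  also have "\<dots> = ennreal (1 / \<rho>) * (\<integral>\<^sup>+p. ennreal (exp (- c * norm p)) \<partial>count_space (L - {0}))"
    by (rule nn_integral_cmult) simp
  also have "\<dots> < \<infinity>"
  proof -
    have "(\<integral>\<^sup>+p. ennreal (exp (- c * norm p)) \<partial>count_space (L - {0}))
        \<le> (\<integral>\<^sup>+p. ennreal (exp (- c * norm p)) \<partial>count_space L)"
      by (subst (1 2) nn_integral_count_space_indicator) (auto intro!: nn_integral_mono simp:
          indicator_def)
    also have "\<dots> < \<infinity>" by (rule lattice_exp_norm_finite[OF L c])
    finally show ?thesis by (simp add: ennreal_mult_less_top)
  qed
  finally show ?thesis .
qed

lemma theta_sum_measurable: "countable A \<Longrightarrow> theta_sum A \<in> borel_measurable borel"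
  unfolding theta_sum_def[abs_def] by (rule borel_measurable_nn_integral_count_space) measurable

text \<open>
  The sum \<open>S(L,\<Lambda>)\<close>. Its value at a pair of lattices is \<open>4 / T\<close> times the negative logarithm of
  the double product, where \<open>T / (2 |w|)\<close> is the exponent of the factors.
\<close>
definition interaction :: "real \<Rightarrow> real \<Rightarrow> (real^'n::finite) set \<Rightarrow> (real^'n) set \<Rightarrow> ennreal" where
  "interaction m t L \<Lambda> = (\<integral>\<^sup>+p. (\<integral>\<^sup>+v. ennreal (exp (- pi * t * (norm p * (m\<^sup>2 + (norm v)\<^sup>2))) / norm p)
     \<partial>count_space L) \<partial>count_space (\<Lambda> - {0}))"

lemma interaction_eq_sum_theta:
  fixes L \<Lambda> :: "(real^'n::finite) set"
  shows "interaction m t L \<Lambda>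
      = (\<integral>\<^sup>+p. ennreal (exp (- (pi * t * m\<^sup>2) * norm p) / norm p) * theta_sum L (t * norm p)
          \<partial>count_space (\<Lambda> - {0}))"
  unfolding interaction_def theta_sum_def
proof (rule nn_integral_cong)
  fix p :: "real^'n"
  have "exp (- pi * t * (norm p * (m\<^sup>2 + (norm v)\<^sup>2))) / norm p
      = (exp (- (pi * t * m\<^sup>2) * norm p) / norm p) * exp (- pi * (t * norm p) * (norm v)\<^sup>2)"
          for v :: "real^'n"
    by (simp add: algebra_simps flip: exp_add)
  then show "(\<integral>\<^sup>+v. ennreal (exp (- pi * t * (norm p * (m\<^sup>2 + (norm v)\<^sup>2))) / norm p) \<partial>count_space L)
     = ennreal (exp (- (pi * t * m\<^sup>2) * norm p) / norm p) * (\<integral>\<^sup>+v. ennreal (exp (- pi * (t * norm p)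
         * (norm v)\<^sup>2)) \<partial>count_space L)"
    by (simp only: ennreal_mult' divide_nonneg_nonneg exp_ge_zero norm_ge_zero nn_integral_cmult
        borel_measurable_count_space)
qed

text \<open>
  The vectors of \<open>\<Lambda>\<close> without \<open>0\<close> have a positive minimal length \<open>\<rho>\<close>, so all theta values are
  bounded by the one at \<open>t * \<rho>\<close>, and \<open>exp (-c |p|) / |p|\<close> is summable.
\<close>
lemma interaction_finite:
  fixes L \<Lambda> :: "(real^'n::finite) set"
  assumes L: "L \<in> lattices" "\<Lambda> \<in> lattices" and t: "t > 0" and m: "m > 0"
  shows "interaction m t L \<Lambda> < \<infinity>"
proof -
  obtain \<rho> where \<rho>: "\<rho> > 0" "\<And>p. p \<in> \<Lambda> - {0} \<Longrightarrow> \<rho> \<le> norm p"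
    using lattice_min_norm[OF L(2)] by blast
  have "interaction m t L \<Lambda>
      \<le> (\<integral>\<^sup>+p. ennreal (exp (- (pi * t * m\<^sup>2) * norm p) / norm p) * theta_sum L (t * \<rho>) \<partial>count_space
          (\<Lambda> - {0}))"
    unfolding interaction_eq_sum_theta
  proof (intro nn_integral_mono mult_left_mono)
    fix p assume "p \<in> space (count_space (\<Lambda> - {0}))"
    then have "t * \<rho> \<le> t * norm p" using \<rho>(2) t by (intro mult_left_mono) auto
    then show "theta_sum L (t * norm p) \<le> theta_sum L (t * \<rho>)"
      unfolding theta_sum_def
      by (intro nn_integral_mono ennreal_leI) (simp add: mult_right_mono mult.assoc[symmetric]
          del: mult_le_cancel_left_pos)
  qed simp
  also have "\<dots> = (\<integral>\<^sup>+p. ennreal (exp (- (pi * t * m\<^sup>2) * norm p) / norm p) \<partial>count_space (\<Lambda> - {0})) *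
      theta_sum L (t * \<rho>)"
    by (rule nn_integral_multc) simp
  also have "\<dots> < \<infinity>"
    using lattice_exp_over_norm_finite[OF L(2), of "pi * t * m\<^sup>2"] theta_sum_finite[OF L(1), of "t
        * \<rho>"] t m \<rho>(1)
    by (simp add: ennreal_mult_less_top)
  finally show ?thesis .
qed

lemma interaction_mono_left:
  assumes "t > 0" and "\<And>s. s > 0 \<Longrightarrow> theta_sum L0 s \<le> theta_sum L s"
  shows "interaction m t L0 \<Lambda> \<le> interaction m t L \<Lambda>"
  unfolding interaction_eq_sum_theta using assms by (intro nn_integral_mono mult_left_mono) auto

lemma interaction_less_left:
  fixes L \<Lambda> :: "(real^'n::finite) set"
  assumes L: "L0 \<in> lattices" "\<Lambda> \<in> lattices" and t: "t > 0" and m: "m > 0"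
    and less: "\<And>s. s > 0 \<Longrightarrow> theta_sum L0 s < theta_sum L s"
  shows "interaction m t L0 \<Lambda> < interaction m t L \<Lambda>"
  unfolding interaction_eq_sum_theta
proof (rule nn_integral_less)
  show "(\<integral>\<^sup>+p. ennreal (exp (- (pi * t * m\<^sup>2) * norm p) / norm p) * theta_sum L0 (t * norm p)
      \<partial>count_space (\<Lambda> - {0})) \<noteq> \<infinity>"
    using interaction_finite[OF L t m] by (simp add: interaction_eq_sum_theta)
  have s: "ennreal (exp (- (pi * t * m\<^sup>2) * norm p) / norm p) * theta_sum L0 (t * norm p)
      < ennreal (exp (- (pi * t * m\<^sup>2) * norm p) / norm p) * theta_sum L (t * norm p)"
          if "p \<in> \<Lambda> - {0}" for p
    by (rule ennreal_mult_strict_left_mono) (use that t less in auto)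
  then show "AE p in count_space (\<Lambda> - {0}). ennreal (exp (- (pi * t * m\<^sup>2) * norm p) / norm p) *
      theta_sum L0 (t * norm p)
      \<le> ennreal (exp (- (pi * t * m\<^sup>2) * norm p) / norm p) * theta_sum L (t * norm p)"
    unfolding AE_count_space by (blast intro: less_imp_le)
  obtain p where "p \<in> \<Lambda> - {0}" using nonzero_lattice_vector[OF L(2)] by blast
  with s show "\<not> (AE p in count_space (\<Lambda> - {0}). ennreal (exp (- (pi * t * m\<^sup>2) * norm p) / norm p)
      * theta_sum L (t * norm p)
      \<le> ennreal (exp (- (pi * t * m\<^sup>2) * norm p) / norm p) * theta_sum L0 (t * norm p))"
    unfolding AE_count_space by (meson not_le)
qed auto

text \<open>
  The weight of \<open>\<theta>\<^sub>\<Lambda>(s) - 1\<close> when the interaction is written as a mixture of theta values: every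
  \<open>v \<in> L\<close> contributes the Yukawa potential with \<open>c = pi t (m\<^sup>2 + |v|\<^sup>2)\<close>.
\<close>
definition mixing_weight :: "real \<Rightarrow> real \<Rightarrow> (real^'n::finite) set \<Rightarrow> real \<Rightarrow> ennreal" where
  "mixing_weight m t L s = (\<integral>\<^sup>+v. ennreal (exp (- (pi * t * (m\<^sup>2 + (norm v)\<^sup>2))\<^sup>2 / (4 * pi * s)) /
      sqrt s) \<partial>count_space L)"

lemma interaction_eq_integral_theta:
  fixes L \<Lambda> :: "(real^'n::finite) set"
  assumes L: "L \<in> lattices" "\<Lambda> \<in> lattices" and t: "t > 0" and m: "m > 0"
  shows "interaction m t L \<Lambda> = (\<integral>\<^sup>+s\<in>{0<..}. mixing_weight m t L s * theta_sum (\<Lambda> - {0}) s \<partial>lborel)"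
proof -
  let ?c = "\<lambda>v::real^'n. pi * t * (m\<^sup>2 + (norm v)\<^sup>2)"
  have cL: "countable L" "countable (\<Lambda> - {0})" using countable_lattice L by auto
  have mm: "mixing_density c r \<in> borel_measurable borel" for c r
    unfolding mixing_density_def by measurable
  have c: "?c v > 0" for v using t m by (simp add: add_pos_nonneg)
  have "interaction m t L \<Lambda>
      = (\<integral>\<^sup>+p. (\<integral>\<^sup>+v. (\<integral>\<^sup>+s\<in>{0<..}. ennreal (mixing_density (?c v) (norm p) s) \<partial>lborel) \<partial>count_space
          L) \<partial>count_space (\<Lambda> - {0}))"
    unfolding interaction_def
    by (intro nn_integral_cong, subst gaussian_mixture) (use c in \<open>auto simp: mult_ac\<close>)
  also have "\<dots> = (\<integral>\<^sup>+p. (\<integral>\<^sup>+s. (\<integral>\<^sup>+v. ennreal (mixing_density (?c v) (norm p) s) * indicator {0<..} s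
      \<partial>count_space L) \<partial>lborel) \<partial>count_space (\<Lambda> - {0}))"
    using mm by (intro nn_integral_cong nn_integral_count_space_nn_integral[symmetric] cL) auto
  also have "\<dots> = (\<integral>\<^sup>+s. (\<integral>\<^sup>+p. (\<integral>\<^sup>+v. ennreal (mixing_density (?c v) (norm p) s) * indicator {0<..} s
      \<partial>count_space L) \<partial>count_space (\<Lambda> - {0})) \<partial>lborel)"
    using mm by (intro nn_integral_count_space_nn_integral[symmetric] cL
        borel_measurable_nn_integral_count_space) auto
  also have "\<dots> = (\<integral>\<^sup>+s\<in>{0<..}. mixing_weight m t L s * theta_sum (\<Lambda> - {0}) s \<partial>lborel)"
  proof (rule nn_integral_cong)
    fix s :: real
    show "(\<integral>\<^sup>+p. (\<integral>\<^sup>+v. ennreal (mixing_density (?c v) (norm p) s) * indicator {0<..} s \<partial>count_space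
        L) \<partial>count_space (\<Lambda> - {0}))
       = mixing_weight m t L s * theta_sum (\<Lambda> - {0}) s * indicator {0<..} s"
    proof (cases "s > 0")
      case True
      have "mixing_density (?c v) (norm p) s
          = exp (- (?c v)\<^sup>2 / (4 * pi * s)) / sqrt s * exp (- pi * s * (norm p)\<^sup>2)" for v p :: "real^'n"
        by (simp add: mixing_density_def)
      then have "(\<integral>\<^sup>+v. ennreal (mixing_density (?c v) (norm p) s) \<partial>count_space L)
          = mixing_weight m t L s * ennreal (exp (- pi * s * (norm p)\<^sup>2))" for p :: "real^'n"
        using True
        by (simp only: mixing_weight_def ennreal_mult' ennreal_mult'' exp_ge_zero
            nn_integral_multc borel_measurable_count_space)
      then show ?thesis using True by (simp add: theta_sum_def nn_integral_cmult)
    qed simp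
  qed
  finally show ?thesis .
qed

lemma interaction_mono_right:
  assumes "L \<in> lattices" "\<Lambda>0 \<in> lattices" "\<Lambda> \<in> lattices" "t > 0" "m > 0"
    and "\<And>s. s > 0 \<Longrightarrow> theta_sum (\<Lambda>0 - {0}) s \<le> theta_sum (\<Lambda> - {0}) s"
  shows "interaction m t L \<Lambda>0 \<le> interaction m t L \<Lambda>"
  using assms by (auto simp: interaction_eq_integral_theta indicator_def intro!: nn_integral_mono
      mult_left_mono)

text \<open>
  The weight is positive, and it is finite almost everywhere because the interaction is finite.
  Hence the strict inequality of the theta functions is preserved by multiplication with it
  and by integration.
\<close>
lemma interaction_less_right:
  fixes L \<Lambda> :: "(real^'n::finite) set"
  assumes L: "L \<in> lattices" "\<Lambda>0 \<in> lattices" "\<Lambda> \<in> lattices" and t: "t > 0" and m: "m > 0"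
    and less: "\<And>s. s > 0 \<Longrightarrow> theta_sum (\<Lambda>0 - {0}) s < theta_sum (\<Lambda> - {0}) s"
  shows "interaction m t L \<Lambda>0 < interaction m t L \<Lambda>"
proof -
  let ?W = "mixing_weight m t L"
  let ?f = "\<lambda>\<Lambda> s. ?W s * theta_sum (\<Lambda> - {0}) s * indicator {0<..} s"
  have [measurable]: "?W \<in> borel_measurable borel"
    unfolding mixing_weight_def[abs_def]
    by (intro borel_measurable_nn_integral_count_space countable_lattice[OF L(1)]) measurable
  have [measurable]: "theta_sum (\<Lambda>0 - {0}) \<in> borel_measurable borel" "theta_sum (\<Lambda> - {0}) \<in>
      borel_measurable borel"
    using countable_lattice L by (auto intro!: theta_sum_measurable)
  have fin: "(\<integral>\<^sup>+s. ?f \<Lambda>0 s \<partial>lborel) \<noteq> \<infinity>"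
    using interaction_finite[OF L(1,2) t m] interaction_eq_integral_theta[OF L(1,2) t m] by simp
  have W0: "?W s > 0" if "s > 0" for s
  proof -
    have "0 < ennreal (exp (- (pi * t * (m\<^sup>2 + (norm (0::real^'n))\<^sup>2))\<^sup>2 / (4 * pi * s)) / sqrt s)"
        using that by simp
    also have "\<dots> \<le> ?W s"
      unfolding mixing_weight_def by (rule nn_integral_ge_point) (rule zero_in_lattice[OF L(1)])
    finally show ?thesis .
  qed
  have th0: "theta_sum (\<Lambda>0 - {0}) s > 0" if s: "s > 0" for s
  proof -
    obtain p where p: "p \<in> \<Lambda>0 - {0}" using nonzero_lattice_vector[OF L(2)] by blast
    have "0 < ennreal (exp (- pi * s * (norm p)\<^sup>2))" by simp
    also have "\<dots> \<le> theta_sum (\<Lambda>0 - {0}) s"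
      unfolding theta_sum_def by (rule nn_integral_ge_point[OF p])
    finally show ?thesis .
  qed
  have Wfin: "AE s in lborel. s > 0 \<longrightarrow> ?W s < \<infinity>"
  proof -
    have "AE s in lborel. ?f \<Lambda>0 s \<noteq> \<infinity>"
      by (rule nn_integral_noteq_infinite[OF _ fin]) measurable
    then show ?thesis
    proof eventually_elim
      case (elim s) then show ?case
        using th0[of s] by (auto simp: less_top[symmetric] ennreal_top_mult split: if_splits)
    qed
  qed
  have "(\<integral>\<^sup>+s. ?f \<Lambda>0 s \<partial>lborel) < (\<integral>\<^sup>+s. ?f \<Lambda> s \<partial>lborel)"
  proof (rule nn_integral_less[OF _ _ fin])
    show "AE s in lborel. ?f \<Lambda>0 s \<le> ?f \<Lambda> s"
    proof (rule AE_I2)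
      show "?f \<Lambda>0 s \<le> ?f \<Lambda> s" for s
        by (cases "s > 0") (simp_all add: mult_left_mono less_imp_le[OF less])
    qed
    show "\<not> (AE s in lborel. ?f \<Lambda> s \<le> ?f \<Lambda>0 s)"
    proof
      assume "AE s in lborel. ?f \<Lambda> s \<le> ?f \<Lambda>0 s"
      then have "AE s in lborel. s \<notin> {0<..1::real}"
        using Wfin
      proof eventually_elim
        case (elim s)
        show ?case
        proof
          assume s: "s \<in> {0<..1}"
          then have "?W s * theta_sum (\<Lambda>0 - {0}) s < ?W s * theta_sum (\<Lambda> - {0}) s"
            using elim(2) W0[of s] less[of s] by (intro ennreal_mult_strict_left_mono) auto
          then show False using elim(1) s by (simp add: not_le[symmetric])
        qed
      qed
      then have "emeasure lborel {0<..1::real} = 0"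
        by (subst (asm) AE_iff_measurable[where N="{0<..1}"]) auto
      then show False by simp
    qed
  qed measurable
  then show ?thesis
    using interaction_eq_integral_theta[OF L(1,2) t m] interaction_eq_integral_theta[OF L(1,3) t
        m] by simp
qed

section \<open>The exponent of the prefactor\<close>

text \<open>
  The bound \<open>k s \<le> exp (k s)\<close> with \<open>k = 2 b / n\<close>, raised to the power \<open>n / 2\<close>.
\<close>
lemma powr_half_le_exp:
  fixes n :: nat
  assumes n: "n > 0" and b: "b > 0"
  shows "\<exists>C>0. \<forall>s>0. s powr (real n / 2) * exp (- b * s) \<le> C"
proof (intro exI conjI allI impI)
  define k where "k = 2 * b / real n"
  have k: "k > 0" using n b by (simp add: k_def)
  show "inverse k powr (real n / 2) > 0" using k by simp
  fix s :: real assume s: "s > 0"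
  have "k * s \<le> exp (k * s)" using exp_ge_add_one_self[of "k * s"] by linarith
  then have "s \<le> inverse k * exp (k * s)" using k by (simp add: field_simps)
  then have "s powr (real n / 2) \<le> (inverse k * exp (k * s)) powr (real n / 2)"
    using s by (intro powr_mono2) auto
  also have "\<dots> = inverse k powr (real n / 2) * exp (k * s) powr (real n / 2)"
    using k by (simp only: powr_mult)
  also have "exp (k * s) powr (real n / 2) = exp (b * s)"
    using n by (simp add: exp_powr_real k_def)
  finally have "s powr (real n / 2) * exp (- b * s)
      \<le> (inverse k powr (real n / 2) * exp (b * s)) * exp (- b * s)"
    by (rule mult_right_mono) simp
  also have "\<dots> = inverse k powr (real n / 2)" by (simp add: mult.assoc flip: exp_add)
  finally show "s powr (real n / 2) * exp (- b * s) \<le> inverse k powr (real n / 2)" .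
qed

text \<open>
  Near \<open>0\<close> the factor \<open>exp (-pi m\<^sup>2 / s)\<close> beats the growth of the theta function, and near infinity
  the latter decays exponentially. Both are captured at once: half of each Gaussian
  absorbs the power of \<open>s\<close>, and the remaining integrand is \<open>mixing_density\<close> with parameters
  \<open>2 pi m\<close> and \<open>|p| / \<surd>2\<close>, so its integral is again an exponential divided by a norm.
\<close>
lemma Delta_integrand_finite:
  fixes L :: "(real^'n::finite) set"
  assumes L: "L \<in> lattices" and m: "m > 0"
  shows "(\<integral>\<^sup>+s\<in>{0<..}. ennreal (s powr ((real CARD('n) - 1) / 2) * exp (- pi * m\<^sup>2 / s)) * theta_sum
      (L - {0}) s \<partial>lborel) < \<infinity>"
proof -
  let ?h = "\<lambda>s. s powr ((real CARD('n) - 1) / 2) * exp (- pi * m\<^sup>2 / s)"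
  obtain \<rho> where \<rho>: "\<rho> > 0" "\<And>p. p \<in> L - {0} \<Longrightarrow> \<rho> \<le> norm p"
    using lattice_min_norm[OF L] by blast
  obtain C where C: "C > 0" "\<And>s. s > 0 \<Longrightarrow> s powr (real CARD('n) / 2) * exp (- (pi * \<rho>\<^sup>2 / 2) * s) \<le> C"
    using powr_half_le_exp[of "CARD('n)" "pi * \<rho>\<^sup>2 / 2"] \<rho>(1) by auto
  have bound: "?h s * exp (- pi * s * (norm p)\<^sup>2) \<le> C * mixing_density (2 * pi * m) (norm p / sqrt 2) s"
    if s: "s > 0" and p: "p \<in> L - {0}" for s p
  proof -
    have "s powr ((real CARD('n) - 1) / 2) = s powr (real CARD('n) / 2) / sqrt s"
      using s by (simp add: diff_divide_distrib powr_diff powr_half_sqrt)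
    moreover have "exp (- pi * s * (norm p)\<^sup>2)
        = exp (- (pi * (norm p)\<^sup>2 / 2) * s) * exp (- pi * s * (norm p / sqrt 2)\<^sup>2)"
      by (simp add: power_divide flip: exp_add)
    moreover have "- (2 * pi * m)\<^sup>2 / (4 * pi * s) = - pi * m\<^sup>2 / s"
      using s by (simp add: power2_eq_square)
    ultimately have eq: "?h s * exp (- pi * s * (norm p)\<^sup>2)
       = (s powr (real CARD('n) / 2) * exp (- (pi * (norm p)\<^sup>2 / 2) * s)) * mixing_density (2 * pi
           * m) (norm p / sqrt 2) s"
      by (simp only: mixing_density_def) (simp only: mult_ac times_divide_eq_right times_divide_eq_left)
    have "\<rho>\<^sup>2 \<le> (norm p)\<^sup>2" using \<rho> p by (intro power_mono) auto
    then have "exp (- (pi * (norm p)\<^sup>2 / 2) * s) \<le> exp (- (pi * \<rho>\<^sup>2 / 2) * s)"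
      using s by (simp add: mult_right_mono)
    then have "s powr (real CARD('n) / 2) * exp (- (pi * (norm p)\<^sup>2 / 2) * s)
        \<le> s powr (real CARD('n) / 2) * exp (- (pi * \<rho>\<^sup>2 / 2) * s)"
      by (rule mult_left_mono) simp
    also have "\<dots> \<le> C" by (rule C(2)[OF s])
    finally show ?thesis unfolding eq by (rule mult_right_mono) (use s in \<open>simp add:
        mixing_density_def\<close>)
  qed
  have cL: "countable (L - {0})" using countable_lattice[OF L] by auto
  have mm: "mixing_density c r \<in> borel_measurable borel" for c r
    unfolding mixing_density_def by measurable
  have "(\<integral>\<^sup>+s\<in>{0<..}. ennreal (?h s) * theta_sum (L - {0}) s \<partial>lborel)
     \<le> (\<integral>\<^sup>+s. (\<integral>\<^sup>+p. ennreal C * (ennreal (mixing_density (2 * pi * m) (norm p / sqrt 2) s) *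
         indicator {0<..} s) \<partial>count_space (L - {0})) \<partial>lborel)"
  proof (rule nn_integral_mono)
    fix s :: real
    show "ennreal (?h s) * theta_sum (L - {0}) s * indicator {0<..} s
       \<le> (\<integral>\<^sup>+p. ennreal C * (ennreal (mixing_density (2 * pi * m) (norm p / sqrt 2) s) * indicator
           {0<..} s) \<partial>count_space (L - {0}))"
    proof (cases "s > 0")
      case True
      have "ennreal (?h s) * theta_sum (L - {0}) s
          = (\<integral>\<^sup>+p. ennreal (?h s * exp (- pi * s * (norm p)\<^sup>2)) \<partial>count_space (L - {0}))"
        unfolding theta_sum_def
        by (subst nn_integral_cmult[symmetric]) (simp_all only: borel_measurable_count_space
            ennreal_mult' mult_nonneg_nonneg powr_ge_zero exp_ge_zero)
      also have "\<dots> \<le> (\<integral>\<^sup>+p. ennreal (C * mixing_density (2 * pi * m) (norm p / sqrt 2) s)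
          \<partial>count_space (L - {0}))"
        by (intro nn_integral_mono ennreal_leI bound True) simp
      finally show ?thesis using True C(1) by (simp add: ennreal_mult')
    qed simp
  qed
  also have "\<dots> = (\<integral>\<^sup>+p. (\<integral>\<^sup>+s. ennreal C * (ennreal (mixing_density (2 * pi * m) (norm p / sqrt 2)
      s) * indicator {0<..} s) \<partial>lborel) \<partial>count_space (L - {0}))"
    using mm by (intro nn_integral_count_space_nn_integral cL) auto
  also have "\<dots> = (\<integral>\<^sup>+p. ennreal C * ennreal (exp (- (2 * pi * m) * (norm p / sqrt 2)) / (norm p /
      sqrt 2)) \<partial>count_space (L - {0}))"
  proof (rule nn_integral_cong)
    fix p assume "p \<in> space (count_space (L - {0}))"
    then have "norm p / sqrt 2 > 0" by simp
    from gaussian_mixture[OF this, of "2 * pi * m"] m mm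
    show "(\<integral>\<^sup>+s. ennreal C * (ennreal (mixing_density (2 * pi * m) (norm p / sqrt 2) s) * indicator
        {0<..} s) \<partial>lborel)
       = ennreal C * ennreal (exp (- (2 * pi * m) * (norm p / sqrt 2)) / (norm p / sqrt 2))"
      by (subst nn_integral_cmult) auto
  qed
  also have "\<dots> = (\<integral>\<^sup>+p. ennreal (C * sqrt 2) * ennreal (exp (- (2 * pi * m / sqrt 2) * norm p) /
      norm p) \<partial>count_space (L - {0}))"
    using C(1) by (intro nn_integral_cong) (simp add: mult_ac flip: ennreal_mult')
  also have "\<dots> < \<infinity>"
  proof -
    have "2 * pi * m / sqrt 2 > 0" using m by simp
    from lattice_exp_over_norm_finite[OF L this] show ?thesis
      by (subst nn_integral_cmult) (auto simp: ennreal_mult_less_top)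
  qed
  finally show ?thesis .
qed

lemma Delta_integrable:
  fixes L :: "(real^'n::finite) set"
  assumes L: "L \<in> lattices" and m: "m > 0"
  shows "set_integrable lborel {0<..} (\<lambda>s. s powr ((real CARD('n) - 1) / 2) * exp (- pi * m\<^sup>2 / s)
      * (lattice_theta L s - 1))"
proof -
  let ?h = "\<lambda>s. s powr ((real CARD('n) - 1) / 2) * exp (- pi * m\<^sup>2 / s)"
  let ?F = "\<lambda>s. ennreal (?h s) * theta_sum (L - {0}) s * indicator {0<..} s"
  have [measurable]: "theta_sum (L - {0}) \<in> borel_measurable borel"
    using countable_lattice[OF L] by (intro theta_sum_measurable) auto
  have th: "lattice_theta L s - 1 \<ge> 0 \<and> theta_sum (L - {0}) s
      = ennreal (lattice_theta L s - 1)" if s: "s > 0" for s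
    using theta_sum_nonzero_eq[OF L s] by simp
  have F: "ennreal (indicator {0<..} s *\<^sub>R (?h s * (lattice_theta L s - 1))) = ?F s" for s
    using th[of s] by (auto simp: indicator_def ennreal_mult')
  have Fr: "indicator {0<..} s *\<^sub>R (?h s * (lattice_theta L s - 1)) = enn2real (?F s)" for s
    unfolding F[symmetric] using th[of s] by (auto simp: indicator_def)
  have "(\<lambda>s. enn2real (?F s)) \<in> borel_measurable lborel" by measurable
  moreover have "(\<integral>\<^sup>+s. ennreal (enn2real (?F s)) \<partial>lborel) < \<infinity>"
    unfolding Fr[symmetric] F by (rule Delta_integrand_finite[OF L m])
  ultimately show ?thesis
    unfolding set_integrable_def Fr by (intro integrableI_nonneg) auto
qed

text \<open>
  By the functional equation, the theta function of the dual at \<open>s\<close> is the theta function of the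
  lattice at \<open>1 / s\<close>, times a factor that depends on \<open>s\<close> and the covolume only. Integrability of
  both integrands is essential, as a divergent integral would have the default value \<open>0\<close>.
\<close>
lemma Delta_m_antimono:
  fixes L L0 :: "(real^'n::finite) set"
  assumes L: "L \<in> lattices" "L0 \<in> lattices" and cov: "covolume L = covolume L0" and m: "m > 0"
    and le: "\<And>s. s > 0 \<Longrightarrow> lattice_theta L0 s \<le> lattice_theta L s"
  shows "Delta_m m L \<le> Delta_m m L0"
proof -
  let ?I = "\<lambda>L. LINT s:{0<..}|lborel. s powr ((real CARD('n) - 1) / 2) * exp (- pi * m\<^sup>2 / s) *
      (lattice_theta (dual_lattice L) s - 1)"
  have "?I L0 \<le> ?I L"
  proof (rule set_integral_mono)
    show "set_integrable lborel {0<..} (\<lambda>s. s powr ((real CARD('n) - 1) / 2) * exp (- pi * m\<^sup>2 / s)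
        * (lattice_theta (dual_lattice L0) s - 1))"
      "set_integrable lborel {0<..} (\<lambda>s. s powr ((real CARD('n) - 1) / 2) * exp (- pi * m\<^sup>2 / s) *
          (lattice_theta (dual_lattice L) s - 1))"
      by (intro Delta_integrable m lattice_theta_dual(1)[of _ 1] L zero_less_one)+
    fix s :: real assume "s \<in> {0<..}"
    then have s: "s > 0" by simp
    have "lattice_theta (dual_lattice L0) s \<le> lattice_theta (dual_lattice L) s"
      unfolding lattice_theta_dual(3)[OF L(1) s] lattice_theta_dual(3)[OF L(2) s] cov
      using lattice_theta_dual(2)[OF L(2) s] s by (intro mult_left_mono le) auto
    then show "s powr ((real CARD('n) - 1) / 2) * exp (- pi * m\<^sup>2 / s) * (lattice_theta
        (dual_lattice L0) s - 1)
       \<le> s powr ((real CARD('n) - 1) / 2) * exp (- pi * m\<^sup>2 / s) * (lattice_theta (dual_lattice L)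
           s - 1)"
      by (intro mult_left_mono) auto
  qed
  moreover have "1 / (8 * pi * covolume L0 powr (1 / 2)) \<ge> 0" by simp
  ultimately have "1 / (8 * pi * covolume L0 powr (1 / 2)) * ?I L0
      \<le> 1 / (8 * pi * covolume L0 powr (1 / 2)) * ?I L"
    by (rule mult_left_mono)
  then show ?thesis unfolding Delta_m_def cov by simp
qed

section \<open>Multiples of primitive vectors\<close>

lemma lattice_diff_int_mult:
  fixes L :: "(real^'n::finite) set"
  assumes L: "L \<in> lattices" and xy: "x \<in> L" "y \<in> L"
  shows "x - of_int k *\<^sub>R y \<in> L"
proof -
  obtain f :: "real^'n \<Rightarrow> real^'n" where f: "linear f" "L = range (\<lambda>k. f (int_vec k))"
    using lattice_as_linear_image[OF L] by blast
  obtain a b where ab: "x = f (int_vec a)" "y = f (int_vec b)" using xy f(2) by auto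
  have "int_vec (\<lambda>i. a i - k * b i) = int_vec a - real_of_int k *\<^sub>R int_vec b"
    by (simp add: vec_eq_iff)
  then have "f (int_vec (\<lambda>i. a i - k * b i)) = x - of_int k *\<^sub>R y"
    using f(1) ab by (simp add: linear_diff linear_scale)
  then show ?thesis using f(2) by (metis rangeI)
qed

lemma lattice_int_mult:
  assumes L: "L \<in> lattices" and y: "y \<in> L"
  shows "of_int k *\<^sub>R y \<in> L"
  using lattice_diff_int_mult[OF L zero_in_lattice[OF L] y, of "- k"] by simp

text \<open>
  The multipliers \<open>c\<close> with \<open>c p \<in> L\<close> form a discrete subgroup of the reals containing \<open>1\<close>, hence
  consist of the multiples of a least positive \<open>c\<close>; then \<open>c p\<close> is primitive.
\<close>
lemma multiple_of_primitive:
  fixes L :: "(real^'n::finite) set"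
  assumes L: "L \<in> lattices" and p: "p \<in> L" "p \<noteq> 0"
  shows "\<exists>w\<in>primitive_vectors L. \<exists>k::nat. p = real (Suc k) *\<^sub>R w"
proof -
  obtain f where f: "linear f" "det (matrix f) \<noteq> 0" "L = range (\<lambda>k. f (int_vec k))"
    using lattice_as_linear_image[OF L] by blast
  have inj: "inj f" using f det_nz_iff_inj by blast
  obtain a where a: "p = f (int_vec a)" using p f(3) by auto
  then have "int_vec a \<noteq> (0 :: real^'n)" using p f(1) linear_0 by metis
  then obtain i where i: "a i \<noteq> 0" by (auto simp: vec_eq_iff)
  have int: "c * of_int (a i) \<in> \<int>" if c: "c *\<^sub>R p \<in> L" for c
  proof -
    obtain b where "c *\<^sub>R p = f (int_vec b)" using c f(3) by auto
    then have "f (c *\<^sub>R int_vec a) = f (int_vec b)" using a f(1) by (simp add: linear_scale)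
    then have "c *\<^sub>R int_vec a = (int_vec b :: real^'n)" using inj by (simp add: inj_eq)
    then have "c * of_int (a i)
        = of_int (b i)" by (metis int_vec_nth vector_scaleR_component real_scaleR_def)
    then show ?thesis by simp
  qed
  define H where "H c \<longleftrightarrow> c > 0 \<and> c *\<^sub>R p \<in> L" for c
  \<comment> \<open>On multipliers, \<open>c * a i\<close> is an integer; its absolute value serves as a measure for the
  choice of a least positive multiplier.\<close>
  define ht where "ht c = nat \<lfloor>\<bar>c * of_int (a i)\<bar>\<rfloor>" for c :: real
  have ht: "real (ht c) = \<bar>c * of_int (a i)\<bar>" if "c *\<^sub>R p \<in> L" for c
    using int[OF that] unfolding ht_def Ints_def by (auto simp flip: of_int_abs)
  have "H 1" using p by (simp add: H_def)
  then obtain c where c: "H c" "\<And>c'. H c' \<Longrightarrow> ht c \<le> ht c'"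
    using ex_has_least_nat[of H 1 ht] by blast
  then have c0: "c > 0" "c *\<^sub>R p \<in> L" by (auto simp: H_def)
  have mult: "h / c \<in> \<int>" if h: "h *\<^sub>R p \<in> L" for h
  proof -
    \<comment> \<open>Division with remainder: a nonzero remainder would be a smaller positive multiplier.\<close>
    define r where "r = h - of_int \<lfloor>h / c\<rfloor> * c"
    have r: "0 \<le> r" "r < c"
    proof -
      have "of_int \<lfloor>h / c\<rfloor> \<le> h / c" "h / c < of_int \<lfloor>h / c\<rfloor> + 1" by linarith+
      then have "of_int \<lfloor>h / c\<rfloor> * c \<le> h" "h < (of_int \<lfloor>h / c\<rfloor> + 1) * c"
        using c0(1) by (simp_all only: pos_le_divide_eq pos_divide_less_eq)
      then show "0 \<le> r" "r < c" by (simp_all add: r_def distrib_right)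
    qed
    have "r *\<^sub>R p \<in> L"
      using lattice_diff_int_mult[OF L h c0(2), of "\<lfloor>h / c\<rfloor>"] by (simp add: r_def scaleR_diff_left)
    have "r = 0"
    proof (rule ccontr)
      assume "r \<noteq> 0"
      then have "H r" using r \<open>r *\<^sub>R p \<in> L\<close> by (simp add: H_def)
      then have "real (ht c) \<le> real (ht r)" using c(2) by simp
      then have "c * \<bar>of_int (a i)\<bar> \<le> r * \<bar>of_int (a i)\<bar>"
        using ht[OF c0(2)] ht[OF \<open>r *\<^sub>R p \<in> L\<close>] c0(1) r by (simp add: abs_mult)
      then show False using i r by simp
    qed
    then have "h / c = of_int \<lfloor>h / c\<rfloor>" using c0(1) by (simp add: r_def field_simps)
    then show ?thesis by (metis Ints_of_int)
  qed
  have "c *\<^sub>R p \<in> primitive_vectors L"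
    unfolding primitive_vectors_def
  proof (intro CollectI conjI allI impI)
    fix h assume "h *\<^sub>R (c *\<^sub>R p) \<in> L"
    then show "h \<in> \<int>" using mult[of "h * c"] c0(1) by simp
  qed (use c0 p in auto)
  moreover have "1 / c \<in> \<int>" using mult[of 1] p by simp
  then obtain z where z: "1 / c = of_int z" by (auto simp: Ints_def)
  then have "z > 0" using c0(1) by (metis of_int_0_less_iff zero_less_divide_1_iff)
  then have "of_int z = real (Suc (nat (z - 1)))" by simp
  moreover have "p = (1 / c) *\<^sub>R (c *\<^sub>R p)" using c0(1) by simp
  ultimately show ?thesis unfolding z by metis
qed

text \<open>
  If two multiples of primitive vectors agree, the vectors are real multiples of each other,
  with a ratio that is an integer together with its inverse. So they are equal up to sign, and a
  set of representatives contains only one of them. The boolean encodes the sign and \<open>k\<close> stands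
  for the multiplier \<open>k + 1\<close>.
\<close>
lemma primitive_multiples_bij:
  fixes \<Lambda> :: "(real^'n::finite) set"
  assumes L: "\<Lambda> \<in> lattices" and R: "sign_representatives (primitive_vectors \<Lambda>) R"
  shows "bij_betw (\<lambda>(w, b, k). ((if b then 1 else - 1) * real (Suc k)) *\<^sub>R w) (R \<times> UNIV \<times> UNIV) (\<Lambda>
      - {0})"
    (is "bij_betw ?h _ _")
proof -
  have RP: "R \<subseteq> primitive_vectors \<Lambda>" and ex1: "\<And>v. v \<in> primitive_vectors \<Lambda> \<Longrightarrow> \<exists>!u. u \<in> R \<and> u \<in> {v, - v}"
    using R unfolding sign_representatives_def by auto
  have prim: "w \<in> \<Lambda>" "w \<noteq> 0" "\<And>c. c *\<^sub>R w \<in> \<Lambda> \<Longrightarrow> c \<in> \<int>" if "w \<in> R" for w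
    using RP that unfolding primitive_vectors_def by auto
  have key: "w = w' \<and> c = c'"
    if w: "w \<in> R" "w' \<in> R" and c: "c \<noteq> 0" "c' \<noteq> 0" and eq: "c *\<^sub>R w = c' *\<^sub>R w'" for w w' and c c' :: real
  proof -
    have w_eq: "(c' / c) *\<^sub>R w' = w"
    proof -
      have "(c' / c) *\<^sub>R w' = (1 / c) *\<^sub>R (c' *\<^sub>R w')" by simp
      then show ?thesis using c by (simp flip: eq)
    qed
    have w'_eq: "(c / c') *\<^sub>R w = w'"
    proof -
      have "(c / c') *\<^sub>R w = (1 / c') *\<^sub>R (c *\<^sub>R w)" by simp
      then show ?thesis using c by (simp add: eq)
    qed
    have "c' / c \<in> \<int>" by (rule prim(3)[OF w(2)]) (simp only: w_eq prim(1)[OF w(1)])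
    moreover have "c / c' \<in> \<int>" by (rule prim(3)[OF w(1)]) (simp only: w'_eq prim(1)[OF w(2)])
    ultimately obtain y z where yz: "c' / c = of_int y" "c / c' = of_int z" by (auto simp: Ints_def)
    then have "real_of_int (y * z) = 1" using c by (simp flip: yz)
    then have "y * z = 1" by linarith
    then have "y = 1 \<or> y = - 1" using zmult_eq_1_iff by blast
    then have "w \<in> {w', - w'}" using w_eq yz(1) by auto
    then have "w = w'" using ex1[of w'] w RP by auto
    then show ?thesis using eq prim(2)[OF w(1)] by simp
  qed
  show ?thesis
    unfolding bij_betw_def
  proof (intro conjI equalityI subsetI)
    show "inj_on ?h (R \<times> UNIV \<times> UNIV)"
    proof (rule inj_onI)
      fix x y assume xy: "x \<in> R \<times> UNIV \<times> UNIV" "y \<in> R \<times> UNIV \<times> UNIV" "?h x = ?h y"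
      obtain w b k where x: "x = (w, b, k)" by (cases x) auto
      obtain w' b' k' where y: "y = (w', b', k')" by (cases y) auto
      have w: "w \<in> R" "w' \<in> R" using xy x y by auto
      have eq: "((if b then 1 else - 1) * real (Suc k)) *\<^sub>R w
          = ((if b' then 1 else - 1) * real (Suc k')) *\<^sub>R w'"
        using xy(3) unfolding x y by simp
      have "w = w' \<and> (if b then 1 else - 1) * real (Suc k) = (if b' then 1 else - 1) * real (Suc k')"
        by (rule key[OF w _ _ eq]) auto
      then show "x = y" unfolding x y by (auto split: if_splits)
    qed
  next
    fix p assume "p \<in> ?h ` (R \<times> UNIV \<times> UNIV)"
    then obtain w b k where p: "w \<in> R" "p = ((if b then 1 else - 1) * real (Suc k)) *\<^sub>R w" by auto
    have "p = of_int ((if b then 1 else - 1) * int (Suc k)) *\<^sub>R w" using p(2) by simp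
    then have "p \<in> \<Lambda>" using lattice_int_mult[OF L prim(1)[OF p(1)]] by metis
    then show "p \<in> \<Lambda> - {0}" using p prim(2)[OF p(1)] by auto
  next
    fix p assume "p \<in> \<Lambda> - {0}"
    then have "p \<in> \<Lambda>" "p \<noteq> 0" by auto
    from multiple_of_primitive[OF L this]
    obtain v k where v: "v \<in> primitive_vectors \<Lambda>" "p = real (Suc k) *\<^sub>R v" by auto
    from ex1[OF v(1)] obtain u where u: "u \<in> R" "u = v \<or> u = - v" by auto
    have "p = ?h (u, True, k) \<or> p = ?h (u, False, k)"
      using u(2) v(2) by (auto simp: algebra_simps)
    then show "p \<in> ?h ` (R \<times> UNIV \<times> UNIV)" using u(1) by blast
  qed
qed

lemma sum_over_primitive_multiples:
  fixes \<Lambda> :: "(real^'n::finite) set" and F :: "real \<Rightarrow> ennreal"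
  assumes L: "\<Lambda> \<in> lattices" and R: "sign_representatives (primitive_vectors \<Lambda>) R"
  shows "(\<integral>\<^sup>+p. F (norm p) \<partial>count_space (\<Lambda> - {0}))
       = 2 * (\<integral>\<^sup>+w. (\<integral>\<^sup>+k. F (real (Suc k) * norm w) \<partial>count_space UNIV) \<partial>count_space R)"
proof -
  have cR: "countable R"
    using countable_lattice[OF L] R unfolding sign_representatives_def primitive_vectors_def
    by (metis (no_types, lifting) countable_subset mem_Collect_eq subsetI subset_iff)
  have cB: "countable (UNIV :: (bool \<times> nat) set)" by simp
  interpret S: sigma_finite_measure "count_space (UNIV :: (bool \<times> nat) set)"
    by (rule sigma_finite_measure_count_space_countable[OF cB])
  interpret N: sigma_finite_measure "count_space (UNIV :: nat set)"
    by (rule sigma_finite_measure_count_space_countable) simp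
  let ?h = "\<lambda>(w, b, k). ((if b then 1 else - 1) * real (Suc k)) *\<^sub>R w"
  have "(\<integral>\<^sup>+p. F (norm p) \<partial>count_space (\<Lambda> - {0}))
      = (\<integral>\<^sup>+x. F (norm (?h x)) \<partial>count_space (R \<times> (UNIV :: (bool \<times> nat) set)))"
    using nn_integral_bij_count_space[OF primitive_multiples_bij[OF L R], of "\<lambda>p. F (norm p)"] by
        (simp add: UNIV_Times_UNIV)
  also have "\<dots> = (\<integral>\<^sup>+x. F (norm (?h x)) \<partial>(count_space R \<Otimes>\<^sub>M count_space UNIV))"
    by (simp add: pair_measure_countable[OF cR cB])
  also have "\<dots> = (\<integral>\<^sup>+w. (\<integral>\<^sup>+y. F (norm (?h (w, y))) \<partial>count_space UNIV) \<partial>count_space R)"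
    by (rule S.nn_integral_fst[symmetric]) (simp add: pair_measure_countable[OF cR cB])
  also have "\<dots> = (\<integral>\<^sup>+w. 2 * (\<integral>\<^sup>+k. F (real (Suc k) * norm w) \<partial>count_space UNIV) \<partial>count_space R)"
  proof (rule nn_integral_cong)
    fix w :: "real^'n"
    have "(\<integral>\<^sup>+y. F (norm (?h (w, y))) \<partial>count_space UNIV)
        = (\<integral>\<^sup>+y. F (real (Suc (snd y)) * norm w) \<partial>count_space (UNIV :: (bool \<times> nat) set))"
      by (intro nn_integral_cong arg_cong[of _ _ F]) (auto simp: abs_mult)
    also have "\<dots> = (\<integral>\<^sup>+y. F (real (Suc (snd y)) * norm w) \<partial>(count_space (UNIV :: bool set) \<Otimes>\<^sub>M
        count_space (UNIV :: nat set)))"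
      by (simp add: pair_measure_countable)
    also have "\<dots> = (\<integral>\<^sup>+b. (\<integral>\<^sup>+k. F (real (Suc (snd (b, k))) * norm w) \<partial>count_space UNIV)
        \<partial>count_space (UNIV :: bool set))"
      by (rule N.nn_integral_fst[symmetric]) (simp add: pair_measure_countable)
    also have "\<dots> = 2 * (\<integral>\<^sup>+k. F (real (Suc k) * norm w) \<partial>count_space UNIV)"
      by (simp add: nn_integral_count_space_finite UNIV_bool mult_2 mult_2_right)
    finally show "(\<integral>\<^sup>+y. F (norm (?h (w, y))) \<partial>count_space UNIV)
        = 2 * (\<integral>\<^sup>+k. F (real (Suc k) * norm w) \<partial>count_space UNIV)" .
  qed
  also have "\<dots> = 2 * (\<integral>\<^sup>+w. (\<integral>\<^sup>+k. F (real (Suc k) * norm w) \<partial>count_space UNIV) \<partial>count_space R)"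
    by (rule nn_integral_cmult) simp
  finally show ?thesis .
qed

section \<open>The double product\<close>

lemma infprod_exp:
  assumes "f summable_on A"
  shows "infprod (\<lambda>x. exp (- f x)) A = exp (- infsum f A)"
  unfolding infprod_def
proof (rule tendsto_Lim)
  have "((\<lambda>F. exp (- sum f F)) \<longlongrightarrow> exp (- infsum f A)) (finite_subsets_at_top A)"
    by (intro tendsto_intros infsum_tendsto assms)
  moreover have "\<forall>\<^sub>F F in finite_subsets_at_top A. exp (- sum f F) = (\<Prod>x\<in>F. exp (- f x))"
    by (rule eventually_finite_subsets_at_top_weakI) (simp add: exp_sum flip: sum_negf)
  ultimately show "((\<lambda>F. \<Prod>x\<in>F. exp (- f x)) \<longlongrightarrow> exp (- infsum f A)) (finite_subsets_at_top A)"
    by (rule Lim_transform_eventually)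
qed simp

lemma infprod_cong:
  assumes "\<And>x. x \<in> A \<Longrightarrow> f x = g x"
  shows "infprod f A = infprod g A"
proof -
  have "\<forall>\<^sub>F X in finite_subsets_at_top A. prod f X = prod g X"
    using assms by (intro eventually_finite_subsets_at_top_weakI prod.cong) auto
  from tendsto_cong[OF this] show ?thesis unfolding infprod_def t2_space_class.Lim_def by simp
qed

lemma minus_ln_one_minus_eq_nn_integral:
  assumes y: "0 < y" "y < 1"
  shows "ennreal (- ln (1 - y)) = (\<integral>\<^sup>+k. ennreal (y ^ Suc k / real (Suc k)) \<partial>count_space UNIV)"
proof -
  have s: "summable (\<lambda>k. y ^ Suc k / real (Suc k))"
  proof (rule summable_comparison_test')
    show "summable (\<lambda>k. y * y ^ k)" using y by (intro summable_mult summable_geometric) simp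
    show "norm (y ^ Suc k / real (Suc k)) \<le> y * y ^ k" for k
      using y divide_left_mono[of 1 "real (Suc k)" "y ^ Suc k"] by simp
  qed
  have eq: "(- 1) ^ k * (1 / real (k + 1)) * ((1 - y) - 1) ^ Suc k = - (y ^ Suc k / real (Suc k))" for k
    using power_minus[of y "Suc k"] by (simp add: field_simps flip: power_mult_distrib)
  have "ln (1 - y) = (\<Sum>k. - (y ^ Suc k / real (Suc k)))"
    unfolding eq[symmetric] using y by (intro ln_series) auto
  then have "- ln (1 - y) = (\<Sum>k. y ^ Suc k / real (Suc k))" using suminf_minus[OF s] by simp
  then show ?thesis
    using y s by (simp add: nn_integral_count_space_nat suminf_ennreal2 del: power_Suc)
qed

text \<open>
  Every factor is the exponential of a nonpositive number, so the product converges to the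
  exponential of the corresponding sum. Expanding the logarithms and collecting the multiples of
  the primitive vectors, which run through \<open>\<Lambda> - {0}\<close> up to sign, gives the interaction: a factor
  \<open>1/2\<close> comes from the exponent \<open>T / (2 |w|)\<close> and another one from the sign.
\<close>
lemma double_product_eq:
  fixes L \<Lambda> :: "(real^'n::finite) set"
  assumes L: "L \<in> lattices" "\<Lambda> \<in> lattices" and R: "sign_representatives (primitive_vectors \<Lambda>) R"
    and t: "t > 0" and m: "m > 0" and T: "T > 0"
  shows "infprod (\<lambda>w. infprod (\<lambda>v. (1 - exp (- pi * t) powr (norm w * (m\<^sup>2 + (norm v)\<^sup>2))) powr (T /
      (2 * norm w))) L) R
     = exp (- (T / 4 * enn2real (interaction m t L \<Lambda>)))"
proof -
  define y where "y w v = exp (- pi * t * (norm w * (m\<^sup>2 + (norm v)\<^sup>2)))" for w v :: "real^'n"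
  define g where "g w v = T / (2 * norm w) * - ln (1 - y w v)" for w v :: "real^'n"
  let ?h = "\<lambda>r v. exp (- pi * t * (r * (m\<^sup>2 + (norm (v::real^'n))\<^sup>2))) / r"
  define F where "F r = (\<integral>\<^sup>+v. ennreal (?h r v) \<partial>count_space L)" for r
  have R0: "norm w > 0" if "w \<in> R" for w
    using R that unfolding sign_representatives_def primitive_vectors_def by auto
  have y: "0 < y w v" "y w v < 1" if "w \<in> R" for w v
    using R0[OF that] t m by (auto simp: y_def add_pos_nonneg)
  have g0: "0 \<le> g w v" if "w \<in> R" for w v
    unfolding g_def using y[OF that, of v] R0[OF that] T by (intro mult_nonneg_nonneg) auto
  have factor: "(1 - exp (- pi * t) powr (norm w * (m\<^sup>2 + (norm v)\<^sup>2))) powr (T / (2 * norm w))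
      = exp (- g w v)"
    if "w \<in> R" for w v
  proof -
    have "exp (- pi * t) powr (norm w * (m\<^sup>2 + (norm v)\<^sup>2)) = y w v"
      by (simp add: y_def exp_powr_real)
    then show ?thesis using y[OF that, of v] by (simp add: powr_def g_def)
  qed
  have gsum: "ennreal (g w v)
      = (\<integral>\<^sup>+k. ennreal (T / 2) * ennreal (?h (real (Suc k) * norm w) v) \<partial>count_space UNIV)"
    if w: "w \<in> R" for w v
  proof -
    have "ennreal (g w v) = ennreal (T / (2 * norm w)) * ennreal (- ln (1 - y w v))"
      unfolding g_def using T by (intro ennreal_mult') simp
    also have "\<dots> = (\<integral>\<^sup>+k. ennreal (T / (2 * norm w)) * ennreal (y w v ^ Suc k / real (Suc k))
        \<partial>count_space UNIV)"
      by (subst minus_ln_one_minus_eq_nn_integral[OF y[OF w]], subst nn_integral_cmult) simp_all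
    also have "\<dots> = (\<integral>\<^sup>+k. ennreal (T / 2) * ennreal (?h (real (Suc k) * norm w) v) \<partial>count_space UNIV)"
    proof (rule nn_integral_cong)
      fix k :: nat
      have "y w v ^ Suc k = exp (- pi * t * (real (Suc k) * norm w * (m\<^sup>2 + (norm v)\<^sup>2)))"
        unfolding y_def exp_of_nat_mult[symmetric] by (simp only: mult_ac)
      then have "T / (2 * norm w) * (y w v ^ Suc k / real (Suc k))
          = T / 2 * ?h (real (Suc k) * norm w) v"
        by (simp only: times_divide_times_eq mult_ac)
      then show "ennreal (T / (2 * norm w)) * ennreal (y w v ^ Suc k / real (Suc k))
          = ennreal (T / 2) * ennreal (?h (real (Suc k) * norm w) v)"
        using T by (simp only: ennreal_mult'[symmetric] divide_nonneg_nonneg less_imp_le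
            norm_ge_zero mult_nonneg_nonneg zero_le_numeral)
    qed
    finally show ?thesis .
  qed
  have inner: "(\<integral>\<^sup>+v. ennreal (g w v) \<partial>count_space L)
      = ennreal (T / 2) * (\<integral>\<^sup>+k. F (real (Suc k) * norm w) \<partial>count_space UNIV)"
    if w: "w \<in> R" for w
  proof -
    have "(\<integral>\<^sup>+v. ennreal (g w v) \<partial>count_space L)
      = (\<integral>\<^sup>+v. (\<integral>\<^sup>+k. ennreal (T / 2) * ennreal (?h (real (Suc k) * norm w) v) \<partial>count_space UNIV)
          \<partial>count_space L)"
      by (simp only: gsum[OF w])
    also have "\<dots> = (\<integral>\<^sup>+k. (\<integral>\<^sup>+v. ennreal (T / 2) * ennreal (?h (real (Suc k) * norm w) v)
        \<partial>count_space L) \<partial>count_space UNIV)"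
      by (rule nn_integral_count_space_nn_integral) simp_all
    also have "\<dots> = (\<integral>\<^sup>+k. ennreal (T / 2) * F (real (Suc k) * norm w) \<partial>count_space UNIV)"
      unfolding F_def by (intro nn_integral_cong nn_integral_cmult) simp
    also have "\<dots> = ennreal (T / 2) * (\<integral>\<^sup>+k. F (real (Suc k) * norm w) \<partial>count_space UNIV)"
      by (rule nn_integral_cmult) simp
    finally show ?thesis .
  qed
  have total: "(\<integral>\<^sup>+w. (\<integral>\<^sup>+v. ennreal (g w v) \<partial>count_space L) \<partial>count_space R)
      = ennreal (T / 4) * interaction m t L \<Lambda>"
  proof -
    let ?S = "\<integral>\<^sup>+w. (\<integral>\<^sup>+k. F (real (Suc k) * norm w) \<partial>count_space UNIV) \<partial>count_space R"
    have "(\<integral>\<^sup>+w. (\<integral>\<^sup>+v. ennreal (g w v) \<partial>count_space L) \<partial>count_space R)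
        = (\<integral>\<^sup>+w. ennreal (T / 2) * (\<integral>\<^sup>+k. F (real (Suc k) * norm w) \<partial>count_space UNIV) \<partial>count_space R)"
      by (intro nn_integral_cong inner) simp
    also have "\<dots> = ennreal (T / 2) * ?S"
      by (rule nn_integral_cmult) simp
    also have "ennreal (T / 2) = ennreal (T / 4) * 2"
    proof -
      have "ennreal (T / 4) * ennreal 2
          = ennreal (T / 4 * 2)" using T by (intro ennreal_mult'[symmetric]) simp
      then show ?thesis by simp
    qed
    also have "ennreal (T / 4) * 2 * ?S = ennreal (T / 4) * (2 * ?S)" by (rule mult.assoc)
    also have "2 * ?S = (\<integral>\<^sup>+p. F (norm p) \<partial>count_space (\<Lambda> - {0}))"
      by (rule sum_over_primitive_multiples[OF L(2) R, symmetric])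
    also have "\<dots> = interaction m t L \<Lambda>" by (simp only: interaction_def F_def)
    finally show ?thesis .
  qed
  have fin: "ennreal (T / 4) * interaction m t L \<Lambda> < \<infinity>"
    using interaction_finite[OF L t m] by (simp add: ennreal_mult_less_top)
  have inner_fin: "(\<integral>\<^sup>+v. ennreal (g w v) \<partial>count_space L) < \<infinity>" if w: "w \<in> R" for w
    using nn_integral_ge_point[OF w, of "\<lambda>w. \<integral>\<^sup>+v. ennreal (g w v) \<partial>count_space L"] fin unfolding total
    by (rule order.strict_trans1)
  note inner_sum = nn_integral_count_space_infsum[OF g0 inner_fin]
  have G0: "0 \<le> infsum (g w) L" if "w \<in> R" for w
    by (rule infsum_nonneg) (rule g0[OF that])
  have outer: "(\<integral>\<^sup>+w. ennreal (infsum (g w) L) \<partial>count_space R) = ennreal (T / 4) * interaction m t L \<Lambda>"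
    unfolding total[symmetric] by (intro nn_integral_cong) (simp add: inner_sum(2))
  have outer_fin: "(\<integral>\<^sup>+w. ennreal (infsum (g w) L) \<partial>count_space R) < \<infinity>"
    unfolding outer by (rule fin)
  note outer_sum = nn_integral_count_space_infsum[OF G0 outer_fin]
  have "ennreal (infsum (\<lambda>w. infsum (g w) L) R) = ennreal (T / 4 * enn2real (interaction m t L \<Lambda>))"
  proof -
    have "ennreal (infsum (\<lambda>w. infsum (g w) L) R) = ennreal (T / 4) * interaction m t L \<Lambda>"
      using outer_sum(2) outer by simp
    also have "\<dots> = ennreal (T / 4) * ennreal (enn2real (interaction m t L \<Lambda>))"
      using interaction_finite[OF L t m] by simp
    also have "\<dots> = ennreal (T / 4 * enn2real (interaction m t L \<Lambda>))"
      using T by (intro ennreal_mult'[symmetric]) simp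
    finally show ?thesis .
  qed
  then have total_real: "infsum (\<lambda>w. infsum (g w) L) R = T / 4 * enn2real (interaction m t L \<Lambda>)"
    using T by (subst (asm) ennreal_inj) (auto intro!: infsum_nonneg G0)
  have "infprod (\<lambda>w. infprod (\<lambda>v. (1 - exp (- pi * t) powr (norm w * (m\<^sup>2 + (norm v)\<^sup>2))) powr (T /
      (2 * norm w))) L) R
     = infprod (\<lambda>w. exp (- infsum (g w) L)) R"
  proof (rule infprod_cong)
    fix w assume w: "w \<in> R"
    have "infprod (\<lambda>v. (1 - exp (- pi * t) powr (norm w * (m\<^sup>2 + (norm v)\<^sup>2))) powr (T / (2 * norm
        w))) L = infprod (\<lambda>v. exp (- g w v)) L"
      by (simp only: factor[OF w])
    also have "\<dots> = exp (- infsum (g w) L)" by (rule infprod_exp[OF inner_sum(1)[OF w w]])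
    finally show "infprod (\<lambda>v. (1 - exp (- pi * t) powr (norm w * (m\<^sup>2 + (norm v)\<^sup>2))) powr (T / (2
        * norm w))) L = exp (- infsum (g w) L)" .
  qed
  also have "\<dots> = exp (- infsum (\<lambda>w. infsum (g w) L) R)"
    by (rule infprod_exp[OF outer_sum(1)])
  finally show ?thesis unfolding total_real .
qed

lemma E_fun_eq:
  fixes L \<Lambda> :: "(real^'n::finite) set"
  assumes "L \<in> lattices" "\<Lambda> \<in> lattices" and "sign_representatives (primitive_vectors \<Lambda>) (rep \<Lambda>)"
    and "t > 0" and "m > 0"
  shows "E_fun rep m L \<Lambda> t
      = exp (t powr ((real CARD('n) - 1) / 2) * (pi * t * Delta_m m L - enn2real (interaction m t
          L \<Lambda>) / 4))"
  unfolding E_fun_def Let_def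
  using assms by (subst double_product_eq) (auto simp: exp_powr_real algebra_simps simp flip: exp_add)

section \<open>Maximality\<close>

text \<open>
  A lattice that is not isometric to the optimal one cannot attain the minimal theta value for
  any single parameter, since it would be a second minimizer.
\<close>
lemma theta_minimal:
  fixes Ld :: "(real^'n::finite) set"
  assumes opt: "theta_optimal Ld" and V: "V > 0" and L: "L \<in> lattices_of_covolume V" and s: "s > 0"
  defines "L0 \<equiv> dilate (V powr (1 / CARD('n))) Ld"
  shows "L0 \<in> lattices_of_covolume V"
    and "lattice_theta L0 s \<le> lattice_theta L s"
    and "\<not> isometric L0 L \<Longrightarrow> lattice_theta L0 s < lattice_theta L s"
proof -
  have u: "unique_minimizer_upto isometric (\<lambda>L. lattice_theta L s) (lattices_of_covolume V) L0"
    using opt V s unfolding theta_optimal_def L0_def by blast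
  then have min: "is_arg_min (\<lambda>L. lattice_theta L s) (\<lambda>L. L \<in> lattices_of_covolume V) L0"
    and uniq: "\<And>L. is_arg_min (\<lambda>L. lattice_theta L s) (\<lambda>L. L \<in> lattices_of_covolume V) L
        \<Longrightarrow> isometric L0 L"
    unfolding unique_minimizer_upto_def by blast+
  show "L0 \<in> lattices_of_covolume V" using min unfolding is_arg_min_def by blast
  show le: "lattice_theta L0 s
      \<le> lattice_theta L s" using min L unfolding is_arg_min_def by (meson not_le)
  show "lattice_theta L0 s < lattice_theta L s" if "\<not> isometric L0 L"
  proof (rule ccontr)
    assume "\<not> lattice_theta L0 s < lattice_theta L s"
    then have "is_arg_min (\<lambda>L. lattice_theta L s) (\<lambda>L. L \<in> lattices_of_covolume V) L"
      using min L unfolding is_arg_min_def by (meson le_less_trans not_le)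
    then show False using uniq that by blast
  qed
qed

theorem theorem3p2:
  fixes Ld :: "(real^'n::finite) set"
    and rep :: "(real^'n) set \<Rightarrow> (real^'n) set"
    and t m V1 V2 :: real
  assumes "theta_optimal Ld"
    and "\<And>\<Lambda>. \<Lambda> \<in> lattices \<Longrightarrow> sign_representatives (primitive_vectors \<Lambda>) (rep \<Lambda>)"
    and "t > 0" and "m > 0" and "V1 > 0" and "V2 > 0"
  shows "unique_maximizer_upto
           (\<lambda>(L, \<Lambda>) (L', \<Lambda>'). isometric L L' \<and> isometric \<Lambda> \<Lambda>')
           (\<lambda>(L, \<Lambda>). E_fun rep m L \<Lambda> t)
           (lattices_of_covolume V1 \<times> lattices_of_covolume V2)
           (dilate (V1 powr (1 / CARD('n))) Ld, dilate (V2 powr (1 / CARD('n))) Ld)"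
proof -
  note opt = assms(1) and rep = assms(2) and t = assms(3) and m = assms(4) and V1
      = assms(5) and V2 = assms(6)
  let ?S1 = "lattices_of_covolume V1 :: (real^'n) set set" and ?S2
      = "lattices_of_covolume V2 :: (real^'n) set set"
  define L0 where "L0 = dilate (V1 powr (1 / CARD('n))) Ld"
  define \<Lambda>0 where "\<Lambda>0 = dilate (V2 powr (1 / CARD('n))) Ld"
  let ?E = "\<lambda>L \<Lambda>. E_fun rep m L \<Lambda> t"
  let ?c = "interaction m t"
  have latt: "L \<in> lattices" if "L \<in> lattices_of_covolume V" for L :: "(real^'n) set" and V
    using that unfolding lattices_of_covolume_def by blast
  have ne: "?S1 \<noteq> {}" "?S2 \<noteq> {}"
    using opt V1 V2 unfolding theta_optimal_def unique_minimizer_upto_def is_arg_min_def by (metis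
        empty_iff zero_less_one)+
  have in1: "L0 \<in> ?S1" and in2: "\<Lambda>0 \<in> ?S2"
    using theta_minimal(1)[OF opt V1 _ zero_less_one] theta_minimal(1)[OF opt V2 _ zero_less_one] ne
    unfolding L0_def \<Lambda>0_def by blast+
  have T: "t powr ((real CARD('n) - 1) / 2) > 0" using t by simp
  have le1: "?c L0 \<Lambda> \<le> ?c L \<Lambda>" if "L \<in> ?S1" for L \<Lambda>
    using theta_minimal(2)[OF opt V1 that, folded L0_def] latt[OF that] latt[OF in1]
    by (intro interaction_mono_left t) (simp add: theta_sum_eq ennreal_leI)
  have less1: "?c L0 \<Lambda> < ?c L \<Lambda>" if "L \<in> ?S1" "\<Lambda> \<in> ?S2" "\<not> isometric L0 L" for L \<Lambda>
    using theta_minimal(3)[OF opt V1 that(1), folded L0_def, OF _ that(3)] latt[OF that(1)] latt[OF in1]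
    by (intro interaction_less_left t m latt[OF that(2)]) (auto simp: theta_sum_eq
        lattice_theta_nonneg intro!: ennreal_lessI le_less_trans[OF lattice_theta_nonneg])
  have le2: "?c L0 \<Lambda>0 \<le> ?c L0 \<Lambda>" if "\<Lambda> \<in> ?S2" for \<Lambda>
    using theta_minimal(2)[OF opt V2 that, folded \<Lambda>0_def] latt[OF that] latt[OF in2]
    by (intro interaction_mono_right t m latt[OF in1]) (auto simp: theta_sum_nonzero_eq intro!:
        ennreal_leI)
  have less2: "?c L0 \<Lambda>0 < ?c L0 \<Lambda>" if "\<Lambda> \<in> ?S2" "\<not> isometric \<Lambda>0 \<Lambda>" for \<Lambda>
  proof (rule interaction_less_right[OF latt[OF in1] latt[OF in2] latt[OF that(1)] t m])
    fix s :: real assume s: "s > 0"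
    show "theta_sum (\<Lambda>0 - {0}) s < theta_sum (\<Lambda> - {0}) s"
      unfolding theta_sum_nonzero_eq(1)[OF latt[OF in2] s] theta_sum_nonzero_eq(1)[OF latt[OF
          that(1)] s]
      using theta_minimal(3)[OF opt V2 that(1) s, folded \<Lambda>0_def, OF that(2)]
          theta_sum_nonzero_eq(2)[OF latt[OF in2] s]
      by (intro ennreal_lessI) auto
  qed
  have Delta: "Delta_m m L \<le> Delta_m m L0" if "L \<in> ?S1" for L
    using that in1 theta_minimal(2)[OF opt V1 that, folded L0_def] unfolding lattices_of_covolume_def
    by (intro Delta_m_antimono m) auto
  have E: "?E L \<Lambda> = exp (t powr ((real CARD('n) - 1) / 2) * (pi * t * Delta_m m L - enn2real (?c L
      \<Lambda>) / 4))"
    if "L \<in> ?S1" "\<Lambda> \<in> ?S2" for L \<Lambda>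
    using E_fun_eq[OF latt[OF that(1)] latt[OF that(2)] _ t m] rep latt that by blast
  have fin: "?c L \<Lambda> < \<infinity>" if "L \<in> ?S1" "\<Lambda> \<in> ?S2" for L \<Lambda>
    using interaction_finite[OF latt latt t m] that by blast
  have E_le: "?E L \<Lambda> \<le> ?E L0 \<Lambda>0" if "?c L0 \<Lambda>0 \<le> ?c L \<Lambda>" "L \<in> ?S1" "\<Lambda> \<in> ?S2" for L \<Lambda>
  proof -
    have "enn2real (?c L0 \<Lambda>0) \<le> enn2real (?c L \<Lambda>)" using that fin by (intro enn2real_mono) auto
    moreover have "pi * t * Delta_m m L \<le> pi * t * Delta_m m L0" using Delta[OF that(2)] t by simp
    ultimately have "pi * t * Delta_m m L - enn2real (?c L \<Lambda>) / 4
        \<le> pi * t * Delta_m m L0 - enn2real (?c L0 \<Lambda>0) / 4"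
      by linarith
    then show ?thesis
      unfolding E[OF that(2,3)] E[OF in1 in2] exp_le_cancel_iff using T by (intro mult_left_mono) auto
  qed
  have E_less: "?E L \<Lambda> < ?E L0 \<Lambda>0" if "?c L0 \<Lambda>0 < ?c L \<Lambda>" "L \<in> ?S1" "\<Lambda> \<in> ?S2" for L \<Lambda>
  proof -
    have "enn2real (?c L0 \<Lambda>0) < enn2real (?c L \<Lambda>)"
      using that fin[OF that(2,3)] fin[OF in1 in2] by (metis ennreal_enn2real ennreal_less_iff
          enn2real_nonneg infinity_ennreal_def)
    moreover have "pi * t * Delta_m m L \<le> pi * t * Delta_m m L0" using Delta[OF that(2)] t by simp
    ultimately have "pi * t * Delta_m m L - enn2real (?c L \<Lambda>) / 4
        < pi * t * Delta_m m L0 - enn2real (?c L0 \<Lambda>0) / 4"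
      by linarith
    then show ?thesis
      unfolding E[OF that(2,3)] E[OF in1 in2] exp_less_cancel_iff using T by (rule
          mult_strict_left_mono)
  qed
  have max: "?E L \<Lambda> \<le> ?E L0 \<Lambda>0" if "L \<in> ?S1" "\<Lambda> \<in> ?S2" for L \<Lambda>
    using E_le[OF order_trans[OF le2 le1]] that by blast
  have strict: "isometric L0 L \<and> isometric \<Lambda>0 \<Lambda>" if "L \<in> ?S1" "\<Lambda> \<in> ?S2" "\<not> ?E L \<Lambda> < ?E L0 \<Lambda>0" for L \<Lambda>
  proof (rule ccontr)
    assume "\<not> (isometric L0 L \<and> isometric \<Lambda>0 \<Lambda>)"
    then have "?c L0 \<Lambda>0 < ?c L \<Lambda>"
      using less1[OF that(1,2)] less2[OF that(2)] le1[OF that(1), of \<Lambda>] le2[OF that(2)] by (meson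
          le_less_trans less_le_trans)
    then show False using E_less that by blast
  qed
  show ?thesis
    unfolding unique_maximizer_upto_def is_arg_max_def L0_def[symmetric] \<Lambda>0_def[symmetric]
    using in1 in2 max strict by (auto simp: not_less)
qed

end
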